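(* Assume $r_0>-\infty$ and $\mathbb E[(\min\{t_1^+,\dots,t_{2d}^+\})^d]<\infty$. Then there exist deterministic continuous convex functions $g:\operatorname{int}\mathcal U\to[r_0,\infty)$ and $g^o:\operatorname{int}\mathcal U\to[r_0\wedge0,\infty)$, and an event $\Omega_0$ of probability one, such that the following holds for every fixed $\omega\in\Omega_0$. For any $\xi\in\mathbb R^d$, any real $\alpha>|\xi|_1$, and any sequences $k_n\to\infty$ in $\mathbb N$, $x_n\in\mathcal D_{k_n}$, $y_n\in\mathcal D^o_{k_n}$ with $k_n/n\to\alpha$, $x_n/n\to\xi$ and $y_n/n\to\xi$, $$\alpha\, g(\xi/\alpha)=\lim_{n\to\infty}\frac{G_{0,(k_n),x_n}}{n}\quad\text{and}\quad\alpha\, g^o(\xi/\alpha)=\lim_{n\to\infty}\frac{G^o_{0,(k_n),y_n}}{n}.$$ Furthermore: - $g(0)=r_0$ and $g^o(0)=r_0\wedge0$; - $g^o\le g$ on $\operatorname{int}\mathcal U$; - if $r_0\le0$, then $g=g^o$ on all of $\operatorname{int}\mathcal U$; - if $r_0>0$, then $g>g^o$ in a neighborhood of the origin.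
   Context: Let $d\ge2$. The edge weights $\{t(e)\}$ on the undirected nearest-neighbor edges of $\mathbb Z^d$ are i.i.d. real random variables, and $t_i$ are i.i.d. copies with $t_i^+=t_i\vee0$. Set $r_0=\operatorname{ess\,inf}t(e)$. Let $\mathcal R=\{\pm e_1,\dots,\pm e_d\}$ and $\mathcal R^o=\mathcal R\cup\{0\}$. Zero steps $\{x,x\}$ are assigned weight $t(\{x,x\})=0$. $\Pi_{x,(n),y}$ is the set of sequences $(x_0,\dots,x_n)$ with $x_0=x$, $x_n=y$ and each $x_i-x_{i-1}\in\mathcal R$. $\Pi^o_{x,(n),y}$ is the same with steps in $\mathcal R^o$. Set $$G_{x,(n),y}=\min_{\Pi_{x,(n),y}}\sum_{k=0}^{n-1}t(\{x_k,x_{k+1}\}),\qquad G^o_{x,(n),y}=\min_{\Pi^o_{x,(n),y}}\sum_{k=0}^{n-1}t(\{x_k,x_{k+1}\}),$$ with value $+\infty$ if the set of paths is empty. Let $\mathcal D_n=\{x:\Pi_{0,(n),x}\ne\emptyset\}$ and $\mathcal D^o_n=\{x:\Pi^o_{0,(n),x}\ne\emptyset\}$. Let $\mathcal U=\{\xi\in\mathbb R^d:|\xi|_1\le1\}$ and let $\operatorname{int}\mathcal U=\{|\xi|_1<1\}$ be its interior. *)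

theory Defs
  imports "HOL-Probability.Probability"
begin

definition l1norm :: "('b::{abs,comm_monoid_add})^'d \<Rightarrow> 'b" where
  "l1norm v = (\<Sum>i\<in>UNIV. \<bar>v $ i\<bar>)"

definition nn_edges :: "(int^'d) set set" where
  "nn_edges = {{x, y} | x y. l1norm (x - y) = 1}"

definition steps :: "(int^'d) set" where
  "steps = {v. \<exists>i. v = axis i 1 \<or> v = axis i (-1)}"

definition steps0 :: "(int^'d) set" where
  "steps0 = insert 0 steps"

definition step_wt :: "((int^'d) set \<Rightarrow> real) \<Rightarrow> int^'d \<Rightarrow> int^'d \<Rightarrow> real" where
  "step_wt t x y = (if x = y then 0 else t {x, y})"

definition paths :: "(int^'d) set \<Rightarrow> int^'d \<Rightarrow> nat \<Rightarrow> int^'d \<Rightarrow> (nat \<Rightarrow> int^'d) set" where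
  "paths S x n y = {p. p 0 = x \<and> p n = y \<and> (\<forall>i<n. p (Suc i) - p i \<in> S)}"

text \<open>Restricted passage time; +infinity if no admissible path.\<close>
definition pass_time :: "(int^'d) set \<Rightarrow> ((int^'d) set \<Rightarrow> real) \<Rightarrow> int^'d \<Rightarrow> nat \<Rightarrow> int^'d \<Rightarrow> ereal" where
  "pass_time S t x n y =
     Inf ((\<lambda>p. ereal (\<Sum>k<n. step_wt t (p k) (p (Suc k)))) ` paths S x n y)"

abbreviation G :: "((int^'d) set \<Rightarrow> real) \<Rightarrow> int^'d \<Rightarrow> nat \<Rightarrow> int^'d \<Rightarrow> ereal" where
  "G \<equiv> pass_time steps"

abbreviation Go :: "((int^'d) set \<Rightarrow> real) \<Rightarrow> int^'d \<Rightarrow> nat \<Rightarrow> int^'d \<Rightarrow> ereal" where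
  "Go \<equiv> pass_time steps0"

definition reach :: "nat \<Rightarrow> (int^'d) set" where
  "reach n = {x. paths steps 0 n x \<noteq> {}}"

definition reach0 :: "nat \<Rightarrow> (int^'d) set" where
  "reach0 n = {x. paths steps0 0 n x \<noteq> {}}"

definition intU :: "(real^'d) set" where
  "intU = {\<xi>. l1norm \<xi> < 1}"

definition ess_inf_dist :: "real measure \<Rightarrow> ereal" where
  "ess_inf_dist D = - esssup D (\<lambda>x. ereal (- x))"

definition scaled :: "int^'d \<Rightarrow> nat \<Rightarrow> real^'d" where
  "scaled x n = (\<chi> i. real_of_int (x $ i) / real n)"

end

theory Submission
  imports Defs "HOL-Real_Asymp.Real_Asymp"
begin

text \<open>
  Subtracting a lower bound \<open>c\<close> for the step weights turns the passage times into nonnegative subadditive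
  quantities. Between \<open>0\<close> and \<open>L e\<^sub>i\<close> there are \<open>2d\<close> edge-disjoint routes of almost minimal length, so
  local passage times have a finite \<open>d\<close>-th moment.
  A block of \<open>m\<close> steps depends only on the edges within distance \<open>m\<close> of its start, so sums of block
  times along a line split into i.i.d. sums. A Chernoff bound for truncated blocks and Borel-Cantelli
  give the upper bound \<open>n (\<mu> + \<epsilon>)\<close> along rational directions, uniformly over all starting points at distance
  \<open>O(n)\<close>; the moment of order \<open>d\<close> removes the truncation.
  The matching lower bound is a covering argument for \<open>h = liminf X\<^sub>n / n\<close>: it gives \<open>E h \<ge> \<mu>\<close>, while \<open>h \<le> \<mu>\<close>
  almost surely by the upper bound, so no ergodic theorem is needed.
  Because the upper bound is uniform in the starting point, passage times in every cone
  \<open>|v| \<le> \<rho> l\<close>, \<open>\<rho> < 1\<close>, are \<open>O(l)\<close>; comparing \<open>(k\<^sub>n, x\<^sub>n)\<close> with multiples of a nearby rational direction run for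
  times \<open>(1 \<plusminus> \<theta>) k\<^sub>n\<close> then gives the limit for all sequences at once, for every typical environment.
\<close>

subsection \<open>Lattice geometry\<close>

text \<open>Both families are treated at once: the limit is proved for a step set \<open>S\<close>
  and a subtracted constant \<open>c\<close>, and used for (\<open>steps\<close>, r0) and
  (\<open>steps0\<close>, min r0 0). Because the number of steps is prescribed, the subtraction
  changes every path by the same amount c n. The moment hypothesis speaks of a minimum of 2d
  weights, and the best of 2d edge-disjoint routes is governed by exactly such a minimum: over the
  routes, of the largest weight on each. A single weight may have infinite mean, so waiting on a
  given edge has no bound uniform in its position; surplus time is spent on long walks out and back.
  A prescribed number of steps also imposes parity, which zero steps remove; comparisons are
  therefore made at even times and even points. The slack \<theta> k_n is kept because a
  displacement error can be repaired at linear cost only if the time left for it is a positive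
  fraction of the whole. If r0 \<le> 0, zero steps can be replaced by pacing an edge of nearly
  minimal weight, which identifies the two limits.\<close>

lemma l1norm_nonneg [simp]: "0 \<le> l1norm (x :: 'b::linordered_idom^'d)"
  by (simp add: l1norm_def sum_nonneg)

lemma l1norm_triangle: "l1norm (x + y) \<le> l1norm x + l1norm (y :: 'b::linordered_idom^'d)"
  by (simp add: l1norm_def sum.distrib[symmetric] sum_mono abs_triangle_ineq)

lemma l1norm_minus_commute: "l1norm (x - y) = l1norm (y - x :: 'b::linordered_idom^'d)"
  by (simp add: l1norm_def abs_minus_commute)

lemma l1norm_zero [simp]: "l1norm (0 :: 'b::linordered_idom^'d) = 0"
  by (simp add: l1norm_def)

lemma l1norm_eq_0_iff [simp]: "l1norm x = 0 \<longleftrightarrow> x = (0 :: 'b::linordered_idom^'d)"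
  by (auto simp: l1norm_def sum_nonneg_eq_0_iff vec_eq_iff)

lemma l1norm_uminus [simp]: "l1norm (- x) = l1norm (x :: 'b::linordered_idom^'d)"
  by (simp add: l1norm_def)

lemma l1norm_axis [simp]: "l1norm (axis i a) = \<bar>a :: 'b::linordered_idom\<bar>"
  by (simp add: l1norm_def axis_def if_distrib[of abs] cong: if_cong)

lemma l1norm_scale: "l1norm (a *s x) = \<bar>a\<bar> * l1norm (x :: 'b::linordered_idom^'d)"
  by (simp add: l1norm_def abs_mult sum_distrib_left)

lemma abs_nth_le_l1norm: "\<bar>x $ i\<bar> \<le> l1norm (x :: 'b::linordered_idom^'d)"
  unfolding l1norm_def by (rule member_le_sum) auto

lemma l1norm_diff_le: "l1norm (x - z) \<le> l1norm (x - y) + l1norm (y - z :: 'b::linordered_idom^'d)"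
  using l1norm_triangle[of "x - y" "y - z"] by simp

lemma finite_steps [simp]: "finite (steps :: (int^'d) set)"
proof -
  have eq: "steps = range (\<lambda>i. axis i 1 :: int^'d) \<union> range (\<lambda>i. axis i (-1))"
    by (auto simp: steps_def)
  show ?thesis unfolding eq by simp
qed

lemma l1norm_steps: "s \<in> steps \<Longrightarrow> l1norm s = 1"
  by (auto simp: steps_def)

lemma l1norm_steps0: "s \<in> steps0 \<Longrightarrow> l1norm s \<le> 1"
  by (auto simp: steps0_def l1norm_steps)

lemma zero_notin_steps [simp]: "0 \<notin> steps"
proof
  assume "(0 :: int^'a) \<in> steps"
  from l1norm_steps[OF this] show False by simp
qed

lemma uminus_steps: "s \<in> steps \<Longrightarrow> - s \<in> steps"
proof -
  have "- axis i (a::int) = (axis i (-a) :: int^'d)" for i a by (simp add: axis_def vec_eq_iff)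
  then show "s \<in> steps \<Longrightarrow> - s \<in> steps" by (auto simp: steps_def)
qed

lemma edge_in_nn_edges: "s \<in> steps \<Longrightarrow> {x, x + s} \<in> nn_edges"
  unfolding nn_edges_def using l1norm_steps[of s] l1norm_minus_commute[of x "x + s"] by fastforce

subsection \<open>Restricted passage times as an extended nonnegative recursion\<close>

text \<open>Recursion on the first step instead of a minimum over paths: translation, locality and
  measurability become inductions on n. The value \<top> stands for the absence of a path. Weights
  pass through \<open>ennreal\<close>, so W is meant to be nonnegative on steps of S.\<close>

primrec ptime ::
  "(int^'d) set \<Rightarrow> (int^'d \<Rightarrow> int^'d \<Rightarrow> real) \<Rightarrow> nat \<Rightarrow> int^'d \<Rightarrow> int^'d \<Rightarrow> ennreal"
where
  "ptime S W 0 x y = (if x = y then 0 else \<top>)"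
| "ptime S W (Suc n) x y = (INF s\<in>S. ennreal (W x (x + s)) + ptime S W n (x + s) y)"

lemma finite_INF_attained:
  fixes f :: "'a \<Rightarrow> 'b::complete_linorder"
  assumes "finite S" "S \<noteq> {}"
  obtains s where "s \<in> S" "(INF s\<in>S. f s) = f s"
proof -
  have "Inf (f ` S) = Min (f ` S)" using assms by (intro Min_Inf[symmetric]) auto
  also have "\<dots> \<in> f ` S" using assms by (intro Min_in) auto
  finally show ?thesis using that by auto
qed

lemma ptime_step: "s \<in> S \<Longrightarrow> ptime S W (Suc n) x y \<le> ennreal (W x (x + s)) + ptime S W n (x + s) y"
  unfolding ptime.simps by (rule INF_lower)

lemma ptime_Suc_cases:
  assumes "finite S" "S \<noteq> {}"
  obtains s where "s \<in> S" "ptime S W (Suc n) x y = ennreal (W x (x + s)) + ptime S W n (x + s) y"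
  by (rule finite_INF_attained[OF assms, of "\<lambda>s. ennreal (W x (x + s)) + ptime S W n (x + s) y"])
    (rule that, simp_all)

lemma ptime_add:
  assumes "finite S" "S \<noteq> {}"
  shows "ptime S W (m + n) x z \<le> ptime S W m x y + ptime S W n y z"
proof (induction m arbitrary: x)
  case (Suc m)
  obtain s where s: "s \<in> S" "ptime S W (Suc m) x y = ennreal (W x (x + s)) + ptime S W m (x + s) y"
    using ptime_Suc_cases[OF assms] by blast
  have "ptime S W (Suc m + n) x z \<le> ennreal (W x (x + s)) + ptime S W (m + n) (x + s) z"
    using ptime_step[OF s(1), of W "m + n" x z] by simp
  also have "\<dots> \<le> ennreal (W x (x + s)) + (ptime S W m (x + s) y + ptime S W n y z)"
    by (intro add_left_mono Suc)
  finally show ?case unfolding s(2) by (simp add: add.assoc)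
qed (auto simp: top_add)

lemma ptime_sum:
  assumes "finite S" "S \<noteq> {}"
  shows "ptime S W (n * m) z (z + int n *s x) \<le>
    (\<Sum>i<n. ptime S W m (z + int i *s x) (z + int (Suc i) *s x))"
proof (induction n)
  case (Suc n)
  have "ptime S W (n * m + m) z (z + int (Suc n) *s x)
    \<le> ptime S W (n * m) z (z + int n *s x) + ptime S W m (z + int n *s x) (z + int (Suc n) *s x)"
    by (rule ptime_add[OF assms])
  also have "\<dots> \<le> (\<Sum>i<n. ptime S W m (z + int i *s x) (z + int (Suc i) *s x))
       + ptime S W m (z + int n *s x) (z + int (Suc n) *s x)"
    by (intro add_right_mono Suc)
  finally show ?case by (simp add: add.commute)
qed simp

lemma ptime_shift: "ptime S W n (x + v) (y + v) = ptime S (\<lambda>a b. W (a + v) (b + v)) n x y"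
proof (induction n arbitrary: x)
  case (Suc n)
  have "ptime S W n (x + v + s) (y + v) = ptime S (\<lambda>a b. W (a + v) (b + v)) n (x + s) y" for s
    using Suc[of "x + s"] by (simp add: algebra_simps)
  then show ?case by (simp add: algebra_simps)
qed simp

text \<open>Steps of \<open>steps0\<close> have norm at most 1, so a walk of n steps stays in the
  ball of radius n about its start and sees only the weights there. This is the source of the finite
  range of dependence.\<close>

lemma ptime_cong:
  assumes "S \<subseteq> steps0"
    and "\<And>a s. s \<in> S \<Longrightarrow> l1norm (a - x) \<le> int n \<Longrightarrow> l1norm (a + s - x) \<le> int n \<Longrightarrow> W a (a + s) = W' a (a + s)"
  shows "ptime S W n x y = ptime S W' n x y"
  using assms(2)
proof (induction n arbitrary: x)
  case (Suc n)
  have "W x (x + s) = W' x (x + s) \<and> ptime S W n (x + s) y = ptime S W' n (x + s) y" if s: "s \<in> S" for s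
  proof
    have s1: "l1norm s \<le> 1" using s assms(1) l1norm_steps0 by blast
    then show "W x (x + s) = W' x (x + s)" by (intro Suc.prems s) auto
    have b: "l1norm (b - x) \<le> int (Suc n)" if "l1norm (b - (x + s)) \<le> int n" for b
      using l1norm_diff_le[of b x "x + s"] that s1 by simp
    show "ptime S W n (x + s) y = ptime S W' n (x + s) y"
      by (intro Suc.IH Suc.prems b)
  qed
  then show ?case by (auto intro!: INF_cong)
qed simp

lemma ptime_measurable:
  assumes "S \<subseteq> steps0"
    and "\<And>a s. s \<in> S \<Longrightarrow> l1norm (a - x) \<le> int n \<Longrightarrow> l1norm (a + s - x) \<le> int n
        \<Longrightarrow> (\<lambda>\<omega>. W \<omega> a (a + s)) \<in> borel_measurable M"
  shows "(\<lambda>\<omega>. ptime S (W \<omega>) n x y) \<in> borel_measurable M"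
  using assms(2)
proof (induction n arbitrary: x)
  case (Suc n)
  have "finite S" using assms(1) finite_subset by (fastforce simp: steps0_def)
  have "(\<lambda>\<omega>. W \<omega> x (x + s)) \<in> borel_measurable M \<and> (\<lambda>\<omega>. ptime S (W \<omega>) n (x + s) y) \<in> borel_measurable M"
    if s: "s \<in> S" for s
  proof
    have s1: "l1norm s \<le> 1" using s assms(1) l1norm_steps0 by blast
    then show "(\<lambda>\<omega>. W \<omega> x (x + s)) \<in> borel_measurable M" by (intro Suc.prems s) auto
    have b: "l1norm (b - x) \<le> int (Suc n)" if "l1norm (b - (x + s)) \<le> int n" for b
      using l1norm_diff_le[of b x "x + s"] that s1 by simp
    show "(\<lambda>\<omega>. ptime S (W \<omega>) n (x + s) y) \<in> borel_measurable M"
      by (intro Suc.IH Suc.prems b)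
  qed
  then show ?case using \<open>finite S\<close>
    by (auto intro!: borel_measurable_INF countable_finite borel_measurable_add measurable_compose[OF _ measurable_ennreal])
qed simp

section \<open>Minima over paths satisfy the same recursion\<close>

lemma pass_time_0: "pass_time S t x 0 y = (if x = y then 0 else \<infinity>)"
proof -
  have "paths S x 0 y = (if x = y then {p. p 0 = x} else {})"
    by (auto simp: paths_def)
  moreover have "\<exists>p :: nat \<Rightarrow> int^'a. p 0 = x" by (rule exI[of _ "\<lambda>_. x"]) simp
  ultimately show ?thesis
    by (auto simp: pass_time_def zero_ereal_def top_ereal_def intro!: INF_const)
qed

lemma pass_time_Suc:
  "pass_time S t x (Suc n) y = (INF s\<in>S. ereal (step_wt t x (x + s)) + pass_time S t (x + s) n y)"
proof (rule antisym)
  show "pass_time S t x (Suc n) y \<le> (INF s\<in>S. ereal (step_wt t x (x + s)) + pass_time S t (x + s) n y)"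
  proof (rule INF_greatest)
    fix s assume s: "s \<in> S"
    \<comment> \<open>The finite first weight is moved to the left, so that the infimum over the
      remaining paths can be bounded path by path.\<close>
    have "pass_time S t x (Suc n) y - ereal (step_wt t x (x + s)) \<le> pass_time S t (x + s) n y"
      unfolding pass_time_def[of _ _ "x + s"]
    proof (rule INF_greatest)
      fix p assume p: "p \<in> paths S (x + s) n y"
      define q where "q = case_nat x p"
      have "q \<in> paths S x (Suc n) y"
        using p s by (auto simp: paths_def q_def split: nat.splits)
      then have "pass_time S t x (Suc n) y \<le> ereal (\<Sum>k<Suc n. step_wt t (q k) (q (Suc k)))"
        unfolding pass_time_def by (rule INF_lower)
      also have "(\<Sum>k<Suc n. step_wt t (q k) (q (Suc k))) =
          step_wt t x (x + s) + (\<Sum>k<n. step_wt t (p k) (p (Suc k)))"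
        using p unfolding sum.lessThan_Suc_shift by (simp add: q_def paths_def)
      finally show "pass_time S t x (Suc n) y - ereal (step_wt t x (x + s))
          \<le> ereal (\<Sum>k<n. step_wt t (p k) (p (Suc k)))"
        by (simp add: ereal_minus_le add.commute)
    qed
    then show "pass_time S t x (Suc n) y \<le> ereal (step_wt t x (x + s)) + pass_time S t (x + s) n y"
      by (simp add: ereal_minus_le add.commute)
  qed
  show "(INF s\<in>S. ereal (step_wt t x (x + s)) + pass_time S t (x + s) n y) \<le> pass_time S t x (Suc n) y"
    unfolding pass_time_def[of _ _ x]
  proof (rule INF_greatest)
    fix q assume q: "q \<in> paths S x (Suc n) y"
    define s where "s = q 1 - x"
    have s: "s \<in> S" using q by (auto simp: paths_def s_def)
    have "(\<lambda>k. q (Suc k)) \<in> paths S (x + s) n y" using q by (auto simp: paths_def s_def)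
    then have "pass_time S t (x + s) n y \<le> ereal (\<Sum>k<n. step_wt t (q (Suc k)) (q (Suc (Suc k))))"
      unfolding pass_time_def by (rule INF_lower)
    then have "ereal (step_wt t x (x + s)) + pass_time S t (x + s) n y \<le>
       ereal (step_wt t x (x + s)) + ereal (\<Sum>k<n. step_wt t (q (Suc k)) (q (Suc (Suc k))))"
      by (rule add_left_mono)
    also have "\<dots> = ereal (\<Sum>k<Suc n. step_wt t (q k) (q (Suc k)))"
      using q unfolding sum.lessThan_Suc_shift by (simp add: paths_def s_def)
    finally show "(INF s\<in>S. ereal (step_wt t x (x + s)) + pass_time S t (x + s) n y)
        \<le> ereal (\<Sum>k<Suc n. step_wt t (q k) (q (Suc k)))"
      by (rule INF_lower2[OF s])
  qed
qed

text \<open>Each of the n steps, zero steps included, is shifted by c. All competing paths have n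
  steps, so the minimum is shifted by exactly c n.\<close>

lemma pass_time_eq_ptime:
  assumes fin: "finite S" "S \<noteq> {}"
    and W: "\<And>a s. s \<in> S \<Longrightarrow> 0 \<le> W a (a + s) \<and> step_wt t a (a + s) = W a (a + s) + c"
  shows "pass_time S t x n y = enn2ereal (ptime S W n x y) + ereal (c * real n)"
proof (induction n arbitrary: x)
  case 0
  then show ?case by (simp add: pass_time_0 zero_ereal_def[symmetric] zero_ennreal.rep_eq)
next
  case (Suc n)
  have eq: "ereal (step_wt t x (x + s)) + pass_time S t (x + s) n y
     = enn2ereal (ennreal (W x (x + s)) + ptime S W n (x + s) y) + ereal (c * real (Suc n))" if "s \<in> S" for s
  proof -
    have 1: "ereal (step_wt t x (x + s)) = ereal (W x (x + s)) + ereal c" using W[OF that, of x] by simp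
    have 2: "ereal (c * real (Suc n)) = ereal c + ereal (c * real n)" by (simp add: algebra_simps)
    have 3: "enn2ereal (ennreal (W x (x + s)) + ptime S W n (x + s) y)
        = ereal (W x (x + s)) + enn2ereal (ptime S W n (x + s) y)"
      using W[OF that, of x] by (simp add: plus_ennreal.rep_eq enn2ereal_ennreal)
    have 4: "a + b + (e + f) = a + e + (b + f)" for a b e f :: ereal
      by (simp only: ac_simps)
    show ?thesis unfolding Suc 1 2 3 by (rule 4)
  qed
  show ?case
  proof (rule antisym)
    obtain s where s: "s \<in> S" "ptime S W (Suc n) x y = ennreal (W x (x + s)) + ptime S W n (x + s) y"
      using ptime_Suc_cases[OF fin] by blast
    show "pass_time S t x (Suc n) y \<le> enn2ereal (ptime S W (Suc n) x y) + ereal (c * real (Suc n))"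
      unfolding pass_time_Suc s(2) eq[OF s(1), symmetric] using s(1) by (rule INF_lower)
    show "enn2ereal (ptime S W (Suc n) x y) + ereal (c * real (Suc n)) \<le> pass_time S t x (Suc n) y"
      unfolding pass_time_Suc
    proof (rule INF_greatest)
      fix s assume "s \<in> S"
      then show "enn2ereal (ptime S W (Suc n) x y) + ereal (c * real (Suc n))
          \<le> ereal (step_wt t x (x + s)) + pass_time S t (x + s) n y"
        unfolding eq[OF \<open>s \<in> S\<close>] using ptime_step[of s S W n x y]
        by (intro add_right_mono) (simp add: less_eq_ennreal.rep_eq)
    qed
  qed
qed

subsection \<open>The canonical product space\<close>

text \<open>The truncation at r0 makes edge weights at least r0 - c for every environment, not only
  almost every one; it is inactive where all weights are at least r0. A zero step gets weight
  -c.\<close>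

definition wt :: "real \<Rightarrow> real \<Rightarrow> ((int^'d) set \<Rightarrow> real) \<Rightarrow> int^'d \<Rightarrow> int^'d \<Rightarrow> real" where
  "wt r0 c \<omega> x y = (if x = y then 0 else max r0 (\<omega> {x, y})) - c"

text \<open>The restriction to \<open>nn_edges\<close> keeps the translated environment in the
  extensional function space underlying the product measure.\<close>

definition translate :: "int^'d \<Rightarrow> ((int^'d) set \<Rightarrow> real) \<Rightarrow> (int^'d) set \<Rightarrow> real" where
  "translate v \<omega> = (\<lambda>e\<in>nn_edges. \<omega> ((\<lambda>a. a + v) ` e))"

text \<open>Covers both models. The condition c \<le> r0 makes edge weights nonnegative after
  subtraction; when zero steps are allowed, c \<le> 0 does the same for them.\<close>

locale fpp =
  fixes D :: "real measure" and r0 c :: real and S :: "(int^'d) set"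
  assumes prob_D: "prob_space D" and sets_D [measurable_cong]: "sets D = sets borel"
    and dim: "CARD('d) \<ge> 2"
    and moment: "(\<integral>\<^sup>+ z. ennreal ((Min ((\<lambda>i. max (z i) 0) ` {..<2 * CARD('d)})) ^ CARD('d))
                    \<partial>(PiM {..<2 * CARD('d)} (\<lambda>_. D))) < \<infinity>"
    and c_le_r0: "c \<le> r0" and S_cases: "S = steps \<or> S = steps0 \<and> c \<le> 0"
begin

abbreviation P :: "((int^'d) set \<Rightarrow> real) measure" where
  "P \<equiv> PiM nn_edges (\<lambda>_. D)"

abbreviation pt :: "nat \<Rightarrow> int^'d \<Rightarrow> int^'d \<Rightarrow> ((int^'d) set \<Rightarrow> real) \<Rightarrow> ennreal" where
  "pt n x y \<omega> \<equiv> ptime S (wt r0 c \<omega>) n x y"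

sublocale P: prob_space P
  by (intro prob_space_PiM prob_D)

lemma S_sub: "steps \<subseteq> S" "S \<subseteq> steps0" and S_fin [simp]: "finite S" "S \<noteq> {}"
proof -
  have "axis undefined 1 \<in> (steps :: (int^'d) set)" by (auto simp: steps_def)
  then show "steps \<subseteq> S" "S \<subseteq> steps0" "finite S" "S \<noteq> {}"
    using S_cases by (auto simp: steps0_def)
qed

lemma wt_nonneg: "s \<in> S \<Longrightarrow> 0 \<le> wt r0 c \<omega> a (a + s)"
  using S_cases c_le_r0 by (auto simp: wt_def)

lemma edge_cases: "s \<in> S \<Longrightarrow> s = 0 \<or> {a, a + s} \<in> nn_edges"
  using S_sub(2) edge_in_nn_edges by (auto simp: steps0_def)

lemma pt_add: "pt (m + n) x z \<omega> \<le> pt m x y \<omega> + pt n y z \<omega>"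
  by (rule ptime_add) simp_all

lemma shift_edge: "e \<in> nn_edges \<Longrightarrow> (\<lambda>a. a + v) ` e \<in> nn_edges"
proof -
  assume "e \<in> nn_edges"
  then obtain x y where e: "e = {x, y}" "l1norm (x - y) = 1" by (auto simp: nn_edges_def)
  then have "(\<lambda>a. a + v) ` e = {x + v, y + v} \<and> l1norm ((x + v) - (y + v)) = 1" by simp
  then show ?thesis unfolding nn_edges_def by blast
qed

text \<open>Translation is an injective relabelling of i.i.d. coordinates.\<close>

lemma distr_translate: "distr P P (translate v) = P"
proof -
  have "inj (\<lambda>a::int^'d. a + v)" by (simp add: inj_def)
  then have "inj_on (image (\<lambda>a::int^'d. a + v)) nn_edges"
    by (simp add: inj_on_def inj_image_eq_iff)
  then show ?thesis unfolding translate_def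
    by (intro distr_PiM_reindex prob_D) (auto intro: shift_edge)
qed

lemma translate_measurable [measurable]: "translate v \<in> P \<rightarrow>\<^sub>M P"
  unfolding translate_def
  by (intro measurable_restrict measurable_component_singleton shift_edge)

lemma pt_shift: "pt n (x + v) (y + v) \<omega> = pt n x y (translate v \<omega>)"
  unfolding ptime_shift
proof (rule ptime_cong[OF S_sub(2)])
  fix a s assume "s \<in> S"
  then show "wt r0 c \<omega> (a + v) (a + s + v) = wt r0 c (translate v \<omega>) a (a + s)"
    using edge_cases[of s a] by (auto simp: wt_def translate_def)
qed

lemma pt_translate: "pt n x (x + y) \<omega> = pt n 0 y (translate x \<omega>)"
  using pt_shift[of \<omega> n 0 x y] by (simp add: add.commute)

section \<open>Locality and independence of passage times\<close>

definition ball_edges :: "int^'d \<Rightarrow> nat \<Rightarrow> (int^'d) set set" where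
  "ball_edges z n = {e \<in> nn_edges. \<forall>a\<in>e. l1norm (a - z) \<le> int n}"

lemma wt_measurable:
  "s \<in> S \<Longrightarrow> l1norm (a - x) \<le> int n \<Longrightarrow> l1norm (a + s - x) \<le> int n
    \<Longrightarrow> (\<lambda>\<omega>. wt r0 c \<omega> a (a + s)) \<in> borel_measurable (PiM (ball_edges x n) (\<lambda>_. D))"
proof -
  assume a: "s \<in> S" "l1norm (a - x) \<le> int n" "l1norm (a + s - x) \<le> int n"
  consider "s = 0" | "s \<noteq> 0" "{a, a + s} \<in> ball_edges x n"
    using edge_cases[OF a(1), of a] a by (auto simp: ball_edges_def)
  then show ?thesis
  proof cases
    case 2
    have m: "(\<lambda>\<omega>. \<omega> {a, a + s}) \<in> PiM (ball_edges x n) (\<lambda>_. D) \<rightarrow>\<^sub>M D"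
      using 2(2) by (rule measurable_component_singleton)
    have [measurable]: "(\<lambda>\<omega>. \<omega> {a, a + s}) \<in> borel_measurable (PiM (ball_edges x n) (\<lambda>_. D))"
      using m unfolding measurable_cong_sets[OF refl sets_D] .
    show ?thesis using 2 unfolding wt_def by simp
  qed (simp add: wt_def)
qed

lemma pt_measurable_local: "pt n x y \<in> borel_measurable (PiM (ball_edges x n) (\<lambda>_. D))"
  by (rule ptime_measurable[OF S_sub(2)]) (rule wt_measurable)

lemma pt_restrict: "pt n x y \<omega> = pt n x y (restrict \<omega> (ball_edges x n))"
proof (rule ptime_cong[OF S_sub(2)])
  fix a s assume "s \<in> S" "l1norm (a - x) \<le> int n" "l1norm (a + s - x) \<le> int n"
  then show "wt r0 c \<omega> a (a + s) = wt r0 c (restrict \<omega> (ball_edges x n)) a (a + s)"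
    using edge_cases[of s a] by (auto simp: wt_def ball_edges_def)
qed

lemma pt_measurable [measurable]: "pt n x y \<in> borel_measurable P"
proof -
  have "(\<lambda>\<omega>. restrict \<omega> (ball_edges x n)) \<in> P \<rightarrow>\<^sub>M PiM (ball_edges x n) (\<lambda>_. D)"
    by (rule measurable_restrict_subset) (auto simp: ball_edges_def)
  from measurable_compose[OF this pt_measurable_local] show ?thesis
    by (simp add: pt_restrict[symmetric])
qed

lemma nn_integral_translate:
  "f \<in> borel_measurable P \<Longrightarrow> (\<integral>\<^sup>+\<omega>. f (translate v \<omega>) \<partial>P) = (\<integral>\<^sup>+\<omega>. f \<omega> \<partial>P)"
  by (subst (2) distr_translate[of v, symmetric]) (simp add: nn_integral_distr)

lemma indep_coords: "P.indep_vars (\<lambda>_. D) (\<lambda>e \<omega>. \<omega> e) nn_edges"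
proof (subst P.indep_vars_iff_distr_eq_PiM')
  have "{0, 0 + axis undefined 1} \<in> (nn_edges :: (int^'d) set set)"
    by (rule edge_in_nn_edges) (auto simp: steps_def)
  then show "nn_edges \<noteq> ({} :: (int^'d) set set)" by force
  show "P.random_variable D (\<lambda>\<omega>. \<omega> e)" if "e \<in> nn_edges" for e
    using that by (rule measurable_component_singleton)
  have "distr P P (\<lambda>x. \<lambda>e\<in>nn_edges. x e) = distr P P (\<lambda>x. x)"
    by (rule distr_cong) (auto simp: space_PiM)
  also have "\<dots> = P" by (rule distr_id)
  also have "\<dots> = (\<Pi>\<^sub>M i\<in>nn_edges. distr P D (\<lambda>x. x i))"
    by (intro PiM_cong refl distr_PiM_component[symmetric] prob_D)
  finally show "distr P P (\<lambda>x. \<lambda>e\<in>nn_edges. x e) = (\<Pi>\<^sub>M i\<in>nn_edges. distr P D (\<lambda>x. x i))" .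
qed

text \<open>At distance more than 2m the balls of radius m about the starting points are disjoint,
  so the passage times read disjoint families of independent weights.\<close>

lemma indep_pt:
  assumes "\<And>i j. i \<in> J \<Longrightarrow> j \<in> J \<Longrightarrow> i \<noteq> j \<Longrightarrow> 2 * int m < l1norm (z i - z j)"
  shows "P.indep_vars (\<lambda>_. borel) (\<lambda>i \<omega>. pt m (z i) (y i) \<omega>) J"
proof -
  have "disjoint_family_on (\<lambda>i. ball_edges (z i) m) J"
    unfolding disjoint_family_on_def
  proof safe
    fix i j e assume *: "i \<in> J" "j \<in> J" "i \<noteq> j" "e \<in> ball_edges (z i) m" "e \<in> ball_edges (z j) m"
    then obtain a where "a \<in> e" by (auto simp: ball_edges_def nn_edges_def)
    then have "l1norm (a - z i) \<le> int m" "l1norm (a - z j) \<le> int m" using * by (auto simp: ball_edges_def)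
    then show "e \<in> {}"
      using l1norm_diff_le[of "z i" "z j" a] assms[OF *(1-3)] l1norm_minus_commute[of a "z i"] by simp
  qed
  from P.indep_vars_restrict[OF indep_coords _ this]
  have "P.indep_vars (\<lambda>i. PiM (ball_edges (z i) m) (\<lambda>_. D)) (\<lambda>i \<omega>. restrict \<omega> (ball_edges (z i) m)) J"
    by (simp add: ball_edges_def)
  from P.indep_vars_compose2[OF this, of "\<lambda>i. pt m (z i) (y i)" "\<lambda>_. borel"]
  show ?thesis by (simp add: pt_measurable_local pt_restrict[symmetric])
qed

end

subsection \<open>Edge-disjoint routes and moments\<close>

primrec walk_edges :: "int^'d \<Rightarrow> (int^'d) list \<Rightarrow> (int^'d) set set" where
  "walk_edges x [] = {}"
| "walk_edges x (s # ss) = insert {x, x + s} (walk_edges (x + s) ss)"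

lemma walk_edges_append:
  "walk_edges x (ss @ ts) = walk_edges x ss \<union> walk_edges (x + sum_list ss) ts"
  by (induction ss arbitrary: x) (auto simp: add.assoc)

lemma finite_walk_edges [simp]: "finite (walk_edges x ss)"
  by (induction ss arbitrary: x) auto

lemma walk_edges_nn: "set ss \<subseteq> steps \<Longrightarrow> walk_edges x ss \<subseteq> nn_edges"
  by (induction ss arbitrary: x) (auto intro: edge_in_nn_edges)

text \<open>Reduces the cost of an explicit route to the largest weight on it, the only feature of a
  route that the moment argument uses.\<close>

lemma (in fpp) walk_le:
  assumes "set ss \<subseteq> steps" "\<And>e. e \<in> walk_edges x ss \<Longrightarrow> max r0 (\<omega> e) - c \<le> K" "0 \<le> K"
  shows "pt (length ss) x (x + sum_list ss) \<omega> \<le> ennreal (real (length ss) * K)"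
  using assms(1,2)
proof (induction ss arbitrary: x)
  case (Cons s ss)
  have s: "s \<in> S" "s \<noteq> 0" using Cons.prems S_sub(1) by auto
  have "pt (length (s # ss)) x (x + sum_list (s # ss)) \<omega>
     \<le> ennreal (wt r0 c \<omega> x (x + s)) + pt (length ss) (x + s) (x + s + sum_list ss) \<omega>"
    using ptime_step[OF s(1), of "wt r0 c \<omega>" "length ss" x "x + sum_list (s # ss)"] by (simp add: add.assoc)
  also have "\<dots> \<le> ennreal K + ennreal (real (length ss) * K)"
    using Cons.prems s by (intro add_mono Cons.IH ennreal_leI) (auto simp: wt_def)
  also have "\<dots> = ennreal (real (length (s # ss)) * K)"
    using assms(3) by (simp add: ennreal_plus[symmetric] algebra_simps del: ennreal_plus)
  finally show ?case .
qed simp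

text \<open>Pads a route to a prescribed length by pacing a single edge, so that the padding adds at
  most one edge to it.\<close>

definition back_forth :: "nat \<Rightarrow> int^'d \<Rightarrow> (int^'d) list" where
  "back_forth r b = concat (replicate r [b, - b])"

lemma back_forth_simps: 
  "length (back_forth r b) = 2 * r" "sum_list (back_forth r b) = 0"
  "b \<in> steps \<Longrightarrow> set (back_forth r b) \<subseteq> steps"
  by (induction r) (auto simp: back_forth_def uminus_steps)

lemma walk_edges_back_forth: "walk_edges x (back_forth r b) \<subseteq> {{x, x + b}}"
  by (induction r) (auto simp: back_forth_def insert_commute)

text \<open>The routes from \<open>0\<close> to \<open>L a\<close>, indexed by their first step \<open>b\<close>.\<close>

definition route :: "int^'d \<Rightarrow> int^'d \<Rightarrow> nat \<Rightarrow> int^'d \<Rightarrow> (int^'d) list" where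
  "route a b0 L b =
    (if b = a then replicate L a
     else if b = - a then [- a, b0, b0] @ replicate (L + 2) a @ [- b0, - b0, - a]
     else [b] @ replicate L a @ [- b])"

text \<open>The unpadded lengths are L for b = a, L + 8 for b = - a, and L + 2 otherwise. The
  padding counts j + 4, j and j + 3 bring all of them to the common length L + 8 + 2 j.\<close>

definition padded_route :: "int^'d \<Rightarrow> int^'d \<Rightarrow> nat \<Rightarrow> nat \<Rightarrow> int^'d \<Rightarrow> (int^'d) list" where
  "padded_route a b0 L j b =
    back_forth (if b = a then j + 4 else if b = - a then j else j + 3) b @ route a b0 L b"

definition idot :: "int^'d \<Rightarrow> int^'d \<Rightarrow> int" where
  "idot x y = (\<Sum>i\<in>UNIV. x $ i * y $ i)"

lemma idot_axis: "idot (axis i p) (axis j q) = (if i = j then p * q else 0)"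
  unfolding idot_def axis_def by (simp add: if_distrib[of "\<lambda>x. x * _"] cong: if_cong)

lemma idot_steps: "a \<in> steps \<Longrightarrow> idot a a = 1"
  "a \<in> steps \<Longrightarrow> b \<in> steps \<Longrightarrow> b \<noteq> a \<Longrightarrow> b \<noteq> - a \<Longrightarrow> idot a b = 0"
proof -
  have *: "- axis i (p::int) = (axis i (-p) :: int^'d)" for i p by (simp add: axis_def vec_eq_iff)
  show "a \<in> steps \<Longrightarrow> idot a a = 1"
    by (auto simp: steps_def idot_axis)
  show "a \<in> steps \<Longrightarrow> b \<in> steps \<Longrightarrow> b \<noteq> a \<Longrightarrow> b \<noteq> - a \<Longrightarrow> idot a b = 0"
    by (auto simp: steps_def idot_axis *)
qed

lemma idot_lin: "idot a (k *s x + m *s y) = k * idot a x + m * idot a y"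
  by (simp add: idot_def algebra_simps sum.distrib sum_distrib_left)

text \<open>Every vertex of the route with first step \<open>b\<close> is labelled \<open>b\<close> or lies on the segment
  \<open>[0, L a]\<close>, and for \<open>b \<noteq> a\<close> every edge has a vertex labelled \<open>b\<close>: this separates the routes.\<close>

definition label :: "int^'d \<Rightarrow> nat \<Rightarrow> int^'d \<Rightarrow> (int^'d) option" where
  "label a L v = (let r = v - idot a v *s a in
    if 0 \<le> idot a v \<and> idot a v \<le> int L then
      (if r = 0 then None else if r \<in> steps then Some r else Some (- a))
    else Some (- a))"

definition pnt :: "int^'d \<Rightarrow> int^'d \<Rightarrow> int \<Rightarrow> int \<Rightarrow> int^'d" where
  "pnt a b k m = k *s a + m *s b"

lemma label_coord:
  assumes "a \<in> steps" "b \<in> steps" "b \<noteq> a" "b \<noteq> - a"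
  shows "label a L (pnt a b k m) =
    (if 0 \<le> k \<and> k \<le> int L then
      (if m = 0 then None else if m = 1 then Some b else if m = -1 then Some (- b) else Some (- a))
    else Some (- a))"
proof -
  have d: "idot a (pnt a b k m) = k"
    using assms by (simp add: pnt_def idot_lin idot_steps)
  have b0: "b \<noteq> 0" using assms(2) zero_notin_steps by metis
  have m: "m *s b = 0 \<longleftrightarrow> m = 0"
    using b0 l1norm_scale[of m b] l1norm_steps[OF assms(2)] l1norm_eq_0_iff[of "m *s b"] by auto
  have st: "m *s b \<in> steps \<longleftrightarrow> m = 1 \<or> m = -1"
  proof
    assume "m *s b \<in> steps"
    then show "m = 1 \<or> m = -1"
      using l1norm_scale[of m b] l1norm_steps[OF assms(2)] l1norm_steps[of "m *s b"] by auto
  next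
    assume "m = 1 \<or> m = -1"
    moreover have "(-1) *s b = - b" by (simp add: vec_eq_iff)
    ultimately show "m *s b \<in> steps" using assms(2) uminus_steps by auto
  qed
  have "(-1) *s b = - b" by (simp add: vec_eq_iff)
  then show ?thesis unfolding label_def d Let_def using m st by (auto simp: pnt_def)
qed

lemma coord_steps:
  fixes a b :: "int^'d"
  shows "pnt a b k m + a = pnt a b (k + 1) m" "pnt a b k m + b = pnt a b k (m + 1)"
    "pnt a b k m + - a = pnt a b (k - 1) m" "pnt a b k m + - b = pnt a b k (m - 1)"
  by (simp_all add: pnt_def vec_eq_iff algebra_simps)

lemma sum_list_replicate_coord:
  fixes a b :: "int^'d"
  shows "pnt a b k m + sum_list (replicate n a) = pnt a b (k + int n) m"
  by (induction n) (auto simp: pnt_def vec_eq_iff algebra_simps)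

lemma walk_edges_replicate:
  fixes a b :: "int^'d"
  assumes "e \<in> walk_edges (pnt a b k m) (replicate n a)"
  shows "\<exists>i. k \<le> i \<and> i < k + int n \<and> e = {pnt a b i m, pnt a b (i + 1) m}"
  using assms
proof (induction n arbitrary: k)
  case (Suc n)
  then consider "e = {pnt a b k m, pnt a b (k + 1) m}"
    | "e \<in> walk_edges (pnt a b (k + 1) m) (replicate n a)"
    by (auto simp: coord_steps)
  then show ?case
  proof cases
    case 2
    from Suc.IH[OF this] obtain i where "k + 1 \<le> i" "i < k + 1 + int n"
      "e = {pnt a b i m, pnt a b (i + 1) m}" by blast
    then show ?thesis by (intro exI[of _ i]) simp
  qed (auto intro!: exI[of _ k])
qed simp

text \<open>In coordinates along a and transversal to it, a transversal route runs at height 1 over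
  [0, L]. The route starting with - a runs at height 2 in direction b0, since height 1 there belongs
  to the route of b0, and changes height only beyond the ends of the segment; both regions carry the
  label - a.\<close>

lemma route_labels:
  assumes a: "a \<in> steps" and b0: "b0 \<in> steps" "b0 \<noteq> a" "b0 \<noteq> - a" and b: "b \<in> steps"
    and e: "e \<in> walk_edges 0 (padded_route a b0 L j b)" and L: "L \<ge> 1"
  shows "(\<forall>v\<in>e. label a L v = None \<or> label a L v = Some b) \<and> (b \<noteq> a \<longrightarrow> (\<exists>v\<in>e. label a L v = Some b))"
proof -
  \<comment> \<open>The route itself begins with the step b, so the edge used for padding is already
    one of its edges.\<close>
  have first: "\<exists>ts. route a b0 L b = b # ts"
    using L by (cases L) (auto simp: route_def)
  have e': "e \<in> walk_edges 0 (route a b0 L b)"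
    using e walk_edges_back_forth[of 0 _ b] first
    unfolding padded_route_def walk_edges_append back_forth_simps by (auto split: if_splits)
  consider "b = a" | "b = - a" "b \<noteq> a" | "b \<noteq> a" "b \<noteq> - a" by blast
  then show ?thesis
  proof cases
    case 1
    have z: "pnt a b0 0 0 = 0" by (simp add: pnt_def)
    have "\<exists>i. 0 \<le> i \<and> i < 0 + int L \<and> e = {pnt a b0 i 0, pnt a b0 (i + 1) 0}"
      using e' 1 by (intro walk_edges_replicate) (simp add: route_def z)
    then obtain i where i: "0 \<le> i" "i < int L" "e = {pnt a b0 i 0, pnt a b0 (i + 1) 0}" by auto
    show ?thesis using i(1,2) 1 unfolding i(3) by (simp add: label_coord[OF a b0])
  next
    case 2
    have "e \<in> walk_edges (pnt a b0 0 0) ([- a, b0, b0] @ replicate (L + 2) a @ [- b0, - b0, - a])"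
      using e' 2 by (simp add: route_def pnt_def)
    then have "e \<in> walk_edges (pnt a b0 (-1) 2) (replicate (L + 2) a) \<or>
      e \<in> {{pnt a b0 0 0, pnt a b0 (-1) 0}, {pnt a b0 (-1) 0, pnt a b0 (-1) 1},
         {pnt a b0 (-1) 1, pnt a b0 (-1) 2}, {pnt a b0 (int L + 1) 2, pnt a b0 (int L + 1) 1},
         {pnt a b0 (int L + 1) 1, pnt a b0 (int L + 1) 0}, {pnt a b0 (int L + 1) 0, pnt a b0 (int L) 0}}"
      unfolding walk_edges_append walk_edges.simps sum_list.Cons sum_list.Nil add_0_right add.assoc[symmetric]
        coord_steps sum_list_replicate_coord by (simp add: coord_steps add.commute, elim disjE, simp_all)
    then show ?thesis
    proof
      assume "e \<in> walk_edges (pnt a b0 (-1) 2) (replicate (L + 2) a)"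
      from walk_edges_replicate[OF this] obtain i where
        i: "e = {pnt a b0 i 2, pnt a b0 (i + 1) 2}" by auto
      show ?thesis using 2(1) unfolding i by (simp add: label_coord[OF a b0])
    next
      assume *: "e \<in> {{pnt a b0 0 0, pnt a b0 (-1) 0}, {pnt a b0 (-1) 0, pnt a b0 (-1) 1},
         {pnt a b0 (-1) 1, pnt a b0 (-1) 2}, {pnt a b0 (int L + 1) 2, pnt a b0 (int L + 1) 1},
         {pnt a b0 (int L + 1) 1, pnt a b0 (int L + 1) 0}, {pnt a b0 (int L + 1) 0, pnt a b0 (int L) 0}}"
      show ?thesis using * 2(1)
        by (elim insertE emptyE) (simp_all add: label_coord[OF a b0])
    qed
  next
    case 3
    have "e \<in> walk_edges (pnt a b 0 0) ([b] @ replicate L a @ [- b])"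
      using e' 3 by (simp add: route_def pnt_def)
    then have "e \<in> walk_edges (pnt a b 0 1) (replicate L a) \<or>
      e \<in> {{pnt a b 0 0, pnt a b 0 1}, {pnt a b (int L) 1, pnt a b (int L) 0}}"
      unfolding walk_edges_append walk_edges.simps sum_list.Cons sum_list.Nil add_0_right add.assoc[symmetric]
        coord_steps sum_list_replicate_coord by (simp add: coord_steps, blast)
    then show ?thesis
    proof
      assume "e \<in> walk_edges (pnt a b 0 1) (replicate L a)"
      from walk_edges_replicate[OF this] obtain i where
        i: "0 \<le> i" "i < int L" "e = {pnt a b i 1, pnt a b (i + 1) 1}" by auto
      show ?thesis using i(1,2) unfolding i(3)
        by (simp add: label_coord[OF a b 3])
    next
      assume *: "e \<in> {{pnt a b 0 0, pnt a b 0 1}, {pnt a b (int L) 1, pnt a b (int L) 0}}"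
      show ?thesis using *
        by (elim insertE emptyE) (simp_all add: label_coord[OF a b 3])
    qed
  qed
qed

lemma padded_routes_disjoint:
  assumes a: "a \<in> steps" and b0: "b0 \<in> steps" "b0 \<noteq> a" "b0 \<noteq> - a" and L: "L \<ge> 1"
    and b: "b \<in> steps" "b' \<in> steps" "b \<noteq> b'"
  shows "walk_edges 0 (padded_route a b0 L j b) \<inter> walk_edges 0 (padded_route a b0 L j b') = {}"
proof safe
  fix e assume e: "e \<in> walk_edges 0 (padded_route a b0 L j b)" "e \<in> walk_edges 0 (padded_route a b0 L j b')"
  note 1 = route_labels[OF a b0 b(1) e(1) L] and 2 = route_labels[OF a b0 b(2) e(2) L]
  show "e \<in> {}"
  proof (cases "b = a")
    case True
    then show ?thesis using 1 2 b(3) by force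
  next
    case False
    then show ?thesis using 1 2 b(3) by force
  qed
qed

lemma padded_route_props:
  assumes a: "a \<in> steps" and b0: "b0 \<in> steps" "b0 \<noteq> a" "b0 \<noteq> - a" and L: "L \<ge> 1"
    and b: "b \<in> steps"
  shows "length (padded_route a b0 L j b) = L + 8 + 2 * j" "sum_list (padded_route a b0 L j b) = int L *s a"
    "set (padded_route a b0 L j b) \<subseteq> steps" "walk_edges 0 (padded_route a b0 L j b) \<noteq> {}"
proof -
  have r: "sum_list (replicate n a) = int n *s a" for n
    by (induction n) (auto simp: vec_eq_iff algebra_simps)
  show "length (padded_route a b0 L j b) = L + 8 + 2 * j"
    by (auto simp: padded_route_def route_def back_forth_simps)
  then show "walk_edges 0 (padded_route a b0 L j b) \<noteq> {}"
    by (cases "padded_route a b0 L j b") auto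
  show "sum_list (padded_route a b0 L j b) = int L *s a"
    by (auto simp: padded_route_def route_def back_forth_simps r vec_eq_iff algebra_simps)
  show "set (padded_route a b0 L j b) \<subseteq> steps"
    using a b0 b back_forth_simps(3)[OF b]
    by (auto simp: padded_route_def route_def uminus_steps)
qed

lemma card_steps: "card (steps :: (int^'d) set) = 2 * CARD('d)"
proof -
  have eq: "steps = range (\<lambda>i. axis i 1 :: int^'d) \<union> range (\<lambda>i. axis i (-1))"
    by (auto simp: steps_def)
  have "card (range (\<lambda>i. axis i p :: int^'d)) = CARD('d)" if "p \<noteq> 0" for p
    using that by (intro card_image) (auto simp: inj_def axis_eq_axis)
  moreover have "range (\<lambda>i. axis i 1 :: int^'d) \<inter> range (\<lambda>i. axis i (-1)) = {}"
    by (auto simp: axis_eq_axis)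
  ultimately show ?thesis unfolding eq by (subst card_Un_disjoint) auto
qed

lemma ennreal_power_mono: "x \<le> y \<Longrightarrow> x ^ n \<le> (y :: ennreal) ^ n"
  by (induction n) (auto intro: mult_mono)

lemma ennreal_add_power_le: "(x + y) ^ n \<le> 2 ^ n * (x ^ n + (y :: ennreal) ^ n)"
proof -
  have *: "(u + v) ^ n \<le> 2 ^ n * (u ^ n + v ^ n)" if "u \<le> v" for u v :: ennreal
  proof -
    have "u + v \<le> 2 * v" using add_mono[OF that order_refl[of v]] by (simp add: mult_2)
    then have "(u + v) ^ n \<le> (2 * v) ^ n" by (rule ennreal_power_mono)
    also have "\<dots> = 2 ^ n * v ^ n" by (rule power_mult_distrib)
    also have "\<dots> \<le> 2 ^ n * (u ^ n + v ^ n)" by (intro mult_left_mono) auto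
    finally show ?thesis .
  qed
  show ?thesis using *[of x y] *[of y x] by (cases x y rule: linorder_le_cases) (auto simp: add.commute)
qed

lemma ennreal_le_one_add_power:
  assumes "i \<le> n"
  shows "y ^ i \<le> 1 + (y :: ennreal) ^ n"
proof (cases "y \<le> 1")
  case True
  then have "y ^ i \<le> 1 ^ i" by (rule ennreal_power_mono)
  then show ?thesis by (simp add: add_increasing2)
next
  case False
  have "y ^ i * 1 ^ (n - i) \<le> y ^ i * y ^ (n - i)"
    using False by (intro mult_left_mono ennreal_power_mono) auto
  then have "y ^ i \<le> y ^ n" using assms by (simp add: power_add[symmetric])
  then show ?thesis by (simp add: add_increasing)
qed

section \<open>Finite moments of order d\<close>

context fpp
begin

text \<open>Weights of 2d distinct edges are i.i.d. copies, so their minimum has the law of the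
  moment hypothesis whichever edges are selected.\<close>

lemma min_moment:
  fixes f :: "int^'d \<Rightarrow> (int^'d) set"
  assumes f: "inj_on f steps" "f \<in> steps \<rightarrow> nn_edges"
  shows "(\<integral>\<^sup>+\<omega>. ennreal (Min ((\<lambda>b. max (\<omega> (f b)) 0) ` steps)) ^ CARD('d) \<partial>P) < \<infinity>"
proof -
  let ?I = "{..<2 * CARD('d)}"
  obtain h where h: "bij_betw h ?I (steps :: (int^'d) set)"
    using ex_bij_betw_nat_finite[OF finite_steps] card_steps[where 'd='d] by (metis atLeast0LessThan)
  have inj: "inj_on (\<lambda>i. f (h i)) ?I"
    using h f(1) comp_inj_on[of h ?I f] by (auto simp: bij_betw_def comp_def)
  have im: "(\<lambda>i. f (h i)) \<in> ?I \<rightarrow> nn_edges" using h f(2) by (auto simp: bij_betw_def)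
  have d: "distr P (PiM ?I (\<lambda>_. D)) (\<lambda>\<omega>. \<lambda>i\<in>?I. \<omega> (f (h i))) = PiM ?I (\<lambda>_. D)"
    by (intro distr_PiM_reindex prob_D inj im)
  have mf: "(\<lambda>\<omega>. \<lambda>i\<in>?I. \<omega> (f (h i))) \<in> P \<rightarrow>\<^sub>M PiM ?I (\<lambda>_. D)"
    using im by (intro measurable_restrict measurable_component_singleton) auto
  have m1: "(\<lambda>z. z i) \<in> borel_measurable (PiM ?I (\<lambda>_. D))" if "i \<in> ?I" for i
    using measurable_component_singleton[OF that, of "\<lambda>_. D"] unfolding measurable_cong_sets[OF refl sets_D] .
  have m2: "(\<lambda>z. Min ((\<lambda>i. max (z i) 0) ` ?I)) \<in> borel_measurable (PiM ?I (\<lambda>_. D))"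
    by (intro borel_measurable_Min borel_measurable_max m1) auto
  have "(\<integral>\<^sup>+\<omega>. ennreal (Min ((\<lambda>b. max (\<omega> (f b)) 0) ` steps)) ^ CARD('d) \<partial>P)
    = (\<integral>\<^sup>+\<omega>. ennreal (Min ((\<lambda>i. max ((\<lambda>i\<in>?I. \<omega> (f (h i))) i) 0) ` ?I)) ^ CARD('d) \<partial>P)"
  proof (intro nn_integral_cong)
    fix \<omega> :: "(int^'d) set \<Rightarrow> real"
    have "(\<lambda>i. max ((\<lambda>i\<in>?I. \<omega> (f (h i))) i) 0) ` ?I = (\<lambda>b. max (\<omega> (f b)) 0) ` (h ` ?I)"
      by (auto simp: image_image)
    then show "ennreal (Min ((\<lambda>b. max (\<omega> (f b)) 0) ` steps)) ^ CARD('d) =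
      ennreal (Min ((\<lambda>i. max ((\<lambda>i\<in>?I. \<omega> (f (h i))) i) 0) ` ?I)) ^ CARD('d)"
      using h by (simp only: bij_betw_def)
  qed
  also have "\<dots> = (\<integral>\<^sup>+z. ennreal (Min ((\<lambda>i. max (z i) 0) ` ?I)) ^ CARD('d)
      \<partial>distr P (PiM ?I (\<lambda>_. D)) (\<lambda>\<omega>. \<lambda>i\<in>?I. \<omega> (f (h i))))"
    using m2 by (subst nn_integral_distr[OF mf]) auto
  also have "\<dots> = (\<integral>\<^sup>+z. ennreal ((Min ((\<lambda>i. max (z i) 0) ` ?I)) ^ CARD('d)) \<partial>PiM ?I (\<lambda>_. D))"
  proof -
    have "0 < CARD('d)" by simp
    then have "?I \<noteq> {}" by (auto simp: lessThan_empty_iff simp del: zero_less_card_finite)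
    then have "0 \<le> Min ((\<lambda>i. max (z i) 0) ` ?I)" for z :: "nat \<Rightarrow> real"
      by (subst Min_ge_iff) auto
    then show ?thesis unfolding d by (simp add: ennreal_power)
  qed
  finally show ?thesis using moment by simp
qed

text \<open>Finiteness forces x to be reachable in m steps, so parity never has to be listed as a
  separate condition.\<close>

definition finite_moment :: "nat \<Rightarrow> int^'d \<Rightarrow> bool" where
  "finite_moment m x \<longleftrightarrow> (\<integral>\<^sup>+\<omega>. pt m 0 x \<omega> ^ CARD('d) \<partial>P) < \<infinity>"

lemma finite_moment_add:
  assumes "finite_moment m x" "finite_moment n y"
  shows "finite_moment (m + n) (x + y)"
proof -
  have "(\<integral>\<^sup>+\<omega>. pt (m + n) 0 (x + y) \<omega> ^ CARD('d) \<partial>P)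
     \<le> (\<integral>\<^sup>+\<omega>. 2 ^ CARD('d) * (pt m 0 x \<omega> ^ CARD('d) + pt n 0 y (translate x \<omega>) ^ CARD('d)) \<partial>P)"
  proof (intro nn_integral_mono)
    fix \<omega>
    have "pt (m + n) 0 (x + y) \<omega> ^ CARD('d) \<le> (pt m 0 x \<omega> + pt n 0 y (translate x \<omega>)) ^ CARD('d)"
      using pt_add[of \<omega> m n 0 "x + y" x] pt_translate[of \<omega> n x y] by (intro ennreal_power_mono) simp
    then show "pt (m + n) 0 (x + y) \<omega> ^ CARD('d)
       \<le> 2 ^ CARD('d) * (pt m 0 x \<omega> ^ CARD('d) + pt n 0 y (translate x \<omega>) ^ CARD('d))"
      using ennreal_add_power_le order_trans by blast
  qed
  also have "\<dots> = 2 ^ CARD('d) * ((\<integral>\<^sup>+\<omega>. pt m 0 x \<omega> ^ CARD('d) \<partial>P) + (\<integral>\<^sup>+\<omega>. pt n 0 y (translate x \<omega>) ^ CARD('d) \<partial>P))"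
    by (subst nn_integral_cmult) (auto simp: nn_integral_add)
  also have "(\<integral>\<^sup>+\<omega>. pt n 0 y (translate x \<omega>) ^ CARD('d) \<partial>P) = (\<integral>\<^sup>+\<omega>. pt n 0 y \<omega> ^ CARD('d) \<partial>P)"
    by (rule nn_integral_translate) simp
  also have "2 ^ CARD('d) * ((\<integral>\<^sup>+\<omega>. pt m 0 x \<omega> ^ CARD('d) \<partial>P) + (\<integral>\<^sup>+\<omega>. pt n 0 y \<omega> ^ CARD('d) \<partial>P)) < \<infinity>"
    using assms unfolding finite_moment_def by (auto simp: ennreal_mult_less_top power_less_top_ennreal)
  finally show ?thesis unfolding finite_moment_def .
qed

lemma ex_orthogonal_step:
  assumes "a \<in> (steps :: (int^'d) set)"
  obtains b where "b \<in> steps" "b \<noteq> a" "b \<noteq> - a"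
proof -
  obtain i where i: "a = axis i 1 \<or> a = axis i (-1)" using assms by (auto simp: steps_def)
  have "(UNIV :: 'd set) \<noteq> {i}" 
  proof
    assume "(UNIV :: 'd set) = {i}"
    then have "CARD('d) = card {i}" by simp
    then show False using dim by simp
  qed
  then obtain j where "j \<noteq> i" by auto
  then have "axis j (1::int) \<noteq> a" "axis j (1::int) \<noteq> - a" using i
    by (auto simp: vec_eq_iff axis_def)
  then show ?thesis by (intro that[of "axis j 1"]) (auto simp: steps_def)
qed

text \<open>Take the heaviest edge of each route. The route whose heaviest edge is lightest costs at
  most its length times a minimum of 2d weights. These edges depend on the environment but range
  over finitely many selections, and disjointness of the routes makes the edges of each selection
  distinct.\<close>

lemma finite_moment_route:
  assumes a: "a \<in> steps" and L: "L \<ge> 1"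
  shows "finite_moment (L + 8 + 2 * j) (int L *s a)"
proof -
  let ?d = "CARD('d)"
  obtain b0 where b0: "b0 \<in> (steps :: (int^'d) set)" "b0 \<noteq> a" "b0 \<noteq> - a" using ex_orthogonal_step[OF a] .
  define E where "E b = walk_edges 0 (padded_route a b0 L j b)" for b
  define N where "N = L + 8 + 2 * j"
  \<comment> \<open>Absorbs the truncation at r0 and the subtraction of c: max r0 w - c is at most
    max w 0 + |r0| + |c|.\<close>
  define \<kappa> where "\<kappa> = \<bar>r0\<bar> + \<bar>c\<bar>"
  define u where "u f \<omega> = Min ((\<lambda>b. max (\<omega> (f b)) 0) ` (steps :: (int^'d) set))"
    for f and \<omega> :: "(int^'d) set \<Rightarrow> real"
  note props = padded_route_props[OF a b0 L]
  have ne: "steps \<noteq> ({} :: (int^'d) set)" using a by auto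
  have u0: "0 \<le> u f \<omega>" for f \<omega> unfolding u_def using ne by (subst Min_ge_iff) auto
  define F where "F = PiE (steps :: (int^'d) set) E"
  have finF: "finite F" unfolding F_def by (intro finite_PiE) (auto simp: E_def)
  have "\<exists>f\<in>F. pt N 0 (int L *s a) \<omega> \<le> ennreal (real N * (u f \<omega> + \<kappa>))" for \<omega>
  proof -
    have "\<exists>e\<in>E b. \<forall>e'\<in>E b. \<omega> e' \<le> \<omega> e" if "b \<in> steps" for b
    proof -
      have "finite (\<omega> ` E b)" "\<omega> ` E b \<noteq> {}" using props(4)[OF that] by (auto simp: E_def)
      from Max_in[OF this] Max_ge[OF this(1)] show ?thesis by fastforce
    qed
    then obtain f where f: "\<And>b. b \<in> steps \<Longrightarrow> f b \<in> E b \<and> (\<forall>e'\<in>E b. \<omega> e' \<le> \<omega> (f b))" by metis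
    let ?f = "restrict f steps"
    have "u ?f \<omega> \<in> (\<lambda>b. max (\<omega> (?f b)) 0) ` steps"
      unfolding u_def by (intro Min_in) (use ne in auto)
    then obtain b where b: "b \<in> steps" "u ?f \<omega> = max (\<omega> (f b)) 0" by auto
    have "pt (length (padded_route a b0 L j b)) 0 (0 + sum_list (padded_route a b0 L j b)) \<omega>
      \<le> ennreal (real (length (padded_route a b0 L j b)) * (u ?f \<omega> + \<kappa>))"
    proof (intro walk_le props b)
      fix e assume "e \<in> walk_edges 0 (padded_route a b0 L j b)"
      then have "\<omega> e \<le> \<omega> (f b)" using f[OF b(1)] by (auto simp: E_def)
      then show "max r0 (\<omega> e) - c \<le> u ?f \<omega> + \<kappa>" unfolding b(2) \<kappa>_def by linarith
    qed (use u0 in \<open>auto simp: \<kappa>_def\<close>)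
    then have "pt N 0 (int L *s a) \<omega> \<le> ennreal (real N * (u ?f \<omega> + \<kappa>))"
      using props(1,2)[OF b(1)] by (simp add: N_def)
    moreover have "?f \<in> F" unfolding F_def using f by auto
    ultimately show ?thesis by blast
  qed
  then obtain f where f: "\<And>\<omega>. f \<omega> \<in> F" "\<And>\<omega>. pt N 0 (int L *s a) \<omega> \<le> ennreal (real N * (u (f \<omega>) \<omega> + \<kappa>))" by metis
  define K where "K = ennreal (real N) ^ ?d * 2 ^ ?d"
  have K: "K < \<infinity>" unfolding K_def by (auto simp: ennreal_mult_less_top power_less_top_ennreal)
  have uN: "ennreal (real N * (u g \<omega> + \<kappa>)) ^ ?d \<le> K * (ennreal (u g \<omega>) ^ ?d + ennreal \<kappa> ^ ?d)" for g \<omega>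
  proof -
    have "ennreal (real N * (u g \<omega> + \<kappa>)) = ennreal (real N) * (ennreal (u g \<omega>) + ennreal \<kappa>)"
      using u0[of g \<omega>] by (simp add: ennreal_mult ennreal_plus[symmetric] \<kappa>_def del: ennreal_plus)
    then have "ennreal (real N * (u g \<omega> + \<kappa>)) ^ ?d = ennreal (real N) ^ ?d * (ennreal (u g \<omega>) + ennreal \<kappa>) ^ ?d"
      by (simp add: power_mult_distrib)
    also have "\<dots> \<le> ennreal (real N) ^ ?d * (2 ^ ?d * (ennreal (u g \<omega>) ^ ?d + ennreal \<kappa> ^ ?d))"
      by (intro mult_left_mono ennreal_add_power_le) auto
    finally show ?thesis by (simp add: K_def mult.assoc)
  qed
  have meas: "(\<lambda>\<omega>. u g \<omega>) \<in> borel_measurable P" if "g \<in> F" for g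
    unfolding u_def
  proof (intro borel_measurable_Min borel_measurable_max)
    fix b :: "int^'d" assume "b \<in> steps"
    then have "g b \<in> nn_edges" using that walk_edges_nn[OF props(3)] unfolding F_def E_def by blast
    from measurable_component_singleton[OF this, of "\<lambda>_. D"]
    show "(\<lambda>\<omega>. \<omega> (g b)) \<in> borel_measurable P" unfolding measurable_cong_sets[OF refl sets_D] .
  qed auto
  have fin: "(\<integral>\<^sup>+\<omega>. K * (ennreal (u g \<omega>) ^ ?d + ennreal \<kappa> ^ ?d) \<partial>P) < \<infinity>" if g: "g \<in> F" for g
  proof -
    have gE: "g b \<in> E b" if "b \<in> steps" for b using g that by (auto simp: F_def)
    have "inj_on g steps"
    proof (rule inj_onI)
      fix b b' assume *: "b \<in> steps" "b' \<in> steps" "g b = g b'"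
      show "b = b'"
      proof (rule ccontr)
        assume "b \<noteq> b'"
        from padded_routes_disjoint[OF a b0 L *(1,2) this, of j] gE *
        show False unfolding E_def by (metis IntI empty_iff)
      qed
    qed
    moreover have "g \<in> steps \<rightarrow> nn_edges" using gE walk_edges_nn[OF props(3)] unfolding E_def by blast
    ultimately have "(\<integral>\<^sup>+\<omega>. ennreal (u g \<omega>) ^ ?d \<partial>P) < \<infinity>" unfolding u_def by (rule min_moment)
    moreover have "(\<integral>\<^sup>+\<omega>. K * (ennreal (u g \<omega>) ^ ?d + ennreal \<kappa> ^ ?d) \<partial>P)
      = K * ((\<integral>\<^sup>+\<omega>. ennreal (u g \<omega>) ^ ?d \<partial>P) + ennreal \<kappa> ^ ?d)"
      using meas[OF g] by (subst nn_integral_cmult) (auto simp: nn_integral_add P.emeasure_space_1)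
    ultimately show ?thesis using K by (auto simp: ennreal_mult_less_top power_less_top_ennreal)
  qed
  \<comment> \<open>Summing over all selections in F replaces the selection by environment, whose
    measurability would otherwise have to be examined.\<close>
  have "(\<integral>\<^sup>+\<omega>. pt N 0 (int L *s a) \<omega> ^ ?d \<partial>P)
    \<le> (\<integral>\<^sup>+\<omega>. (\<Sum>g\<in>F. K * (ennreal (u g \<omega>) ^ ?d + ennreal \<kappa> ^ ?d)) \<partial>P)"
  proof (intro nn_integral_mono)
    fix \<omega>
    have "pt N 0 (int L *s a) \<omega> ^ ?d \<le> K * (ennreal (u (f \<omega>) \<omega>) ^ ?d + ennreal \<kappa> ^ ?d)"
      using ennreal_power_mono[OF f(2)[of \<omega>], of ?d] uN[of "f \<omega>" \<omega>] by (rule order_trans)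
    also have "\<dots> \<le> (\<Sum>g\<in>F. K * (ennreal (u g \<omega>) ^ ?d + ennreal \<kappa> ^ ?d))"
      by (rule member_le_sum) (use f(1) finF in auto)
    finally show "pt N 0 (int L *s a) \<omega> ^ ?d \<le> (\<Sum>g\<in>F. K * (ennreal (u g \<omega>) ^ ?d + ennreal \<kappa> ^ ?d))" .
  qed
  also have "\<dots> = (\<Sum>g\<in>F. (\<integral>\<^sup>+\<omega>. K * (ennreal (u g \<omega>) ^ ?d + ennreal \<kappa> ^ ?d) \<partial>P))"
    using meas by (intro nn_integral_sum) auto
  also have "\<dots> < \<infinity>" using fin finF by (simp add: less_top[symmetric])
  finally show ?thesis unfolding finite_moment_def N_def .
qed

text \<open>The 18 comes from v = 0, treated as a unit route out and another back, each of 1 + 8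
  steps. For v \<noteq> 0 a route of |v| + 8 steps is padded to the same form.\<close>

lemma finite_moment_axis: "finite_moment (nat \<bar>v\<bar> + 18 + 2 * j) (axis i v)"
proof (cases "v = 0")
  case True
  have "finite_moment ((1 + 8 + 2 * 0) + (1 + 8 + 2 * j)) (int 1 *s axis i 1 + int 1 *s axis i (-1))"
    by (intro finite_moment_add finite_moment_route) (auto simp: steps_def)
  moreover have "int 1 *s axis i 1 + int 1 *s axis i (-1) = (axis i v :: int^'d)"
    using True by (simp add: vec_eq_iff axis_def)
  ultimately show ?thesis using True by (simp add: numeral_eq_Suc)
next
  case False
  have "finite_moment (nat \<bar>v\<bar> + 8 + 2 * (j + 5)) (int (nat \<bar>v\<bar>) *s axis i (sgn v))"
    using False by (intro finite_moment_route) (auto simp: steps_def sgn_if)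
  moreover have "int (nat \<bar>v\<bar>) *s axis i (sgn v) = (axis i v :: int^'d)"
    by (simp add: vec_eq_iff axis_def abs_mult_sgn)
  ultimately show ?thesis by (simp add: algebra_simps)
qed

text \<open>The coordinates are travelled one after another, each with 18 extra steps; the remaining
  surplus is even by parity and is spent in a single coordinate.\<close>

lemma finite_moment_vec:
  assumes "int m \<ge> l1norm x + 18 * int CARD('d)" "even (int m + l1norm x)"
  shows "finite_moment m x"
proof -
  have *: "finite_moment ((\<Sum>i\<in>I. nat \<bar>x $ i\<bar> + 18) + 2 * j) (\<Sum>i\<in>I. axis i (x $ i))"
    if "finite I" "I \<noteq> {}" for I j
    using that
  proof (induction rule: finite_ne_induct)
    case (singleton i)
    then show ?case using finite_moment_axis by simp
  next
    case (insert i I)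
    have "finite_moment ((nat \<bar>x $ i\<bar> + 18 + 2 * 0) + ((\<Sum>i\<in>I. nat \<bar>x $ i\<bar> + 18) + 2 * j))
       (axis i (x $ i) + (\<Sum>i\<in>I. axis i (x $ i)))"
      by (intro finite_moment_add finite_moment_axis insert)
    then show ?case using insert by (simp add: algebra_simps)
  qed
  have sum_axis: "(\<Sum>i\<in>UNIV. axis i (x $ i)) = x"
    by (simp add: vec_eq_iff axis_def if_distrib cong: if_cong)
  have N: "int (\<Sum>i\<in>UNIV. nat \<bar>x $ i\<bar> + 18) = l1norm x + 18 * int CARD('d)"
    by (simp add: l1norm_def sum.distrib)
  obtain q where q: "int m - (l1norm x + 18 * int CARD('d)) = 2 * q"
    using assms(2) by (metis dvd_def even_add even_diff even_mult_iff even_numeral)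
  then have "q \<ge> 0" using assms(1) by linarith
  then have "m = (\<Sum>i\<in>UNIV. nat \<bar>x $ i\<bar> + 18) + 2 * nat q"
    using q N by linarith
  then show ?thesis using *[of UNIV "nat q"] sum_axis by simp
qed

lemma finite_moment_less_top:
  assumes "finite_moment m x" "i \<le> CARD('d)"
  shows "(\<integral>\<^sup>+\<omega>. pt m 0 x \<omega> ^ i \<partial>P) < \<infinity>"
proof -
  have "(\<integral>\<^sup>+\<omega>. pt m 0 x \<omega> ^ i \<partial>P) \<le> (\<integral>\<^sup>+\<omega>. 1 + pt m 0 x \<omega> ^ CARD('d) \<partial>P)"
    by (intro nn_integral_mono ennreal_le_one_add_power assms)
  also have "\<dots> = 1 + (\<integral>\<^sup>+\<omega>. pt m 0 x \<omega> ^ CARD('d) \<partial>P)"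
    by (subst nn_integral_add) (auto simp: P.emeasure_space_1)
  also have "\<dots> < \<infinity>" using assms(1) by (simp add: finite_moment_def)
  finally show ?thesis .
qed

end

subsection \<open>Uniform upper bounds along lines\<close>

text \<open>Multiply 1 - u \<le> exp(-u) by exp u, then once more by u. The linear term keeps
  coefficient 1, so no part of the mean is lost in the Chernoff bound.\<close>

lemma exp_le_quadratic:
  fixes u :: real
  assumes "0 \<le> u"
  shows "exp u \<le> 1 + u + u\<^sup>2 * exp u"
proof -
  have "1 - u \<le> exp (- u)" using exp_ge_add_one_self[of "-u"] by simp
  then have "(1 - u) * exp u \<le> exp (- u) * exp u" by (intro mult_right_mono) auto
  then have *: "exp u - 1 \<le> u * exp u" by (simp add: exp_minus algebra_simps)
  then have "u * (exp u - 1) \<le> u * (u * exp u)" using assms by (intro mult_left_mono)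
  with * show ?thesis by (simp add: power2_eq_square algebra_simps)
qed

lemma card_l1_ball:
  shows "finite {z :: int^'d. l1norm z \<le> int n}" "card {z :: int^'d. l1norm z \<le> int n} \<le> (2 * n + 1) ^ CARD('d)"
proof -
  let ?F = "PiE (UNIV :: 'd set) (\<lambda>_. {- int n..int n})"
  have sub: "{z :: int^'d. l1norm z \<le> int n} \<subseteq> (\<lambda>f. \<chi> i. f i) ` ?F"
  proof
    fix z :: "int^'d" assume "z \<in> {z. l1norm z \<le> int n}"
    then have "\<bar>z $ i\<bar> \<le> int n" for i using abs_nth_le_l1norm[of z i] by simp
    then have "($) z \<in> ?F" by (auto simp: abs_le_iff) (metis minus_le_iff)
    then show "z \<in> (\<lambda>f. \<chi> i. f i) ` ?F" by (rule rev_image_eqI) simp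
  qed
  have fin: "finite ?F" by (intro finite_PiE) auto
  then show "finite {z :: int^'d. l1norm z \<le> int n}" using sub by (blast intro: finite_subset)
  have "card {z :: int^'d. l1norm z \<le> int n} \<le> card ?F"
    using sub fin by (meson card_image_le card_mono finite_imageI order_trans)
  also have "\<dots> = (2 * n + 1) ^ CARD('d)" by (simp add: card_PiE nat_add_distrib nat_mult_distrib)
  finally show "card {z :: int^'d. l1norm z \<le> int n} \<le> (2 * n + 1) ^ CARD('d)" .
qed

text \<open>Used with R = 2m + 1: legs of one residue class are far enough apart to be
  independent.\<close>

lemma sum_residue_classes:
  fixes f :: "nat \<Rightarrow> 'a::comm_monoid_add"
  shows "(\<Sum>i<R * Q. f i) = (\<Sum>r<R. \<Sum>q<Q. f (r + R * q))"
proof (induction Q)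
  case (Suc Q)
  have *: "(\<Sum>i<m + n. f i) = (\<Sum>i<m. f i) + (\<Sum>i<n. f (m + i))" for m n
    by (induction n) (simp_all add: add.assoc)
  have "(\<Sum>i<R * Suc Q. f i) = (\<Sum>i<R * Q. f i) + (\<Sum>r<R. f (R * Q + r))"
    using *[of "R * Q" R] by (simp add: add.commute)
  then show ?case unfolding Suc by (simp add: sum.distrib add.commute)
qed simp

text \<open>The Chernoff exponent for Q legs truncated at Q / (2\<kappa>), with parameter \<theta> =
  \<kappa> ln Q / Q. Then exp(\<theta> B) is only the square root of Q, so the quadratic term is
  O((ln Q)^2 / sqrt Q), while the excess \<eta> per leg contributes - \<kappa> \<eta> ln Q = - K ln
  Q.\<close>

lemma chernoff_exponent:
  fixes a b \<eta> K :: real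
  assumes "\<eta> > 0" "K > 0" "b \<ge> 0"
  defines "\<kappa> \<equiv> K / \<eta>"
  shows "eventually (\<lambda>Q::nat. real Q * (\<kappa> * ln Q / Q * a + (\<kappa> * ln Q / Q)\<^sup>2 * b * exp (\<kappa> * ln Q / Q * (1 / (2 * \<kappa>) * Q)))
     - \<kappa> * ln Q / Q * (Q * (a + \<eta>)) \<le> 1 - K * ln Q) sequentially"
proof -
  have k: "\<kappa> > 0" "\<kappa> * \<eta> = K" using assms by auto
  have "((\<lambda>Q::nat. \<kappa>\<^sup>2 * b * ((ln Q)\<^sup>2 * exp (ln Q / 2) / Q)) \<longlongrightarrow> \<kappa>\<^sup>2 * b * 0) sequentially"
    by (intro tendsto_mult tendsto_const) real_asymp
  then have "eventually (\<lambda>Q::nat. \<kappa>\<^sup>2 * b * ((ln Q)\<^sup>2 * exp (ln Q / 2) / Q) < 1) sequentially"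
    by (intro order_tendstoD(2)) auto
  moreover have "eventually (\<lambda>Q::nat. Q > 0) sequentially" by (rule eventually_gt_at_top)
  ultimately show ?thesis
  proof eventually_elim
    case (elim Q)
    have e: "\<kappa> * ln Q / Q * (1 / (2 * \<kappa>) * Q) = ln Q / 2" using k elim by (simp add: field_simps)
    have "real Q * (\<kappa> * ln Q / Q * a + (\<kappa> * ln Q / Q)\<^sup>2 * b * exp (\<kappa> * ln Q / Q * (1 / (2 * \<kappa>) * Q)))
     - \<kappa> * ln Q / Q * (Q * (a + \<eta>)) = \<kappa>\<^sup>2 * b * ((ln Q)\<^sup>2 * exp (ln Q / 2) / Q) - (\<kappa> * \<eta>) * ln Q"
      unfolding e using elim by (simp add: field_simps power2_eq_square)
    then show ?case using elim k by simp
  qed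
qed

section \<open>Chernoff bounds for truncated legs\<close>

context fpp
begin

definition leg :: "nat \<Rightarrow> int^'d \<Rightarrow> int^'d \<Rightarrow> ((int^'d) set \<Rightarrow> real) \<Rightarrow> ennreal" where
  "leg m x z \<omega> = pt m z (z + x) \<omega>"

lemma leg_measurable [measurable]: "leg m x z \<in> borel_measurable P"
  unfolding leg_def by simp

lemma leg_translate: "leg m x z \<omega> = leg m x 0 (translate z \<omega>)"
  by (simp add: leg_def pt_translate)

lemma nn_integral_leg:
  "f \<in> borel_measurable borel \<Longrightarrow> (\<integral>\<^sup>+\<omega>. f (leg m x z \<omega>) \<partial>P) = (\<integral>\<^sup>+\<omega>. f (leg m x 0 \<omega>) \<partial>P)"
  unfolding leg_translate[of m x z] by (rule nn_integral_translate) simp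

definition tleg :: "nat \<Rightarrow> int^'d \<Rightarrow> real \<Rightarrow> int^'d \<Rightarrow> ((int^'d) set \<Rightarrow> real) \<Rightarrow> real" where
  "tleg m x B z \<omega> = enn2real (min (leg m x z \<omega>) (ennreal B))"

lemma tleg_measurable [measurable]: "tleg m x B z \<in> borel_measurable P"
  unfolding tleg_def by measurable

lemma tleg_bounds: "0 \<le> B \<Longrightarrow> 0 \<le> tleg m x B z \<omega> \<and> tleg m x B z \<omega> \<le> B \<and> ennreal (tleg m x B z \<omega>) \<le> leg m x z \<omega>"
proof -
  assume B: "0 \<le> B"
  have lt: "min (leg m x z \<omega>) (ennreal B) < \<top>" by (simp add: min_less_iff_disj)
  have "enn2real (min (leg m x z \<omega>) (ennreal B)) \<le> enn2real (ennreal B)"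
    by (rule enn2real_mono) auto
  then show ?thesis using lt B by (auto simp: tleg_def ennreal_enn2real_if)
qed

text \<open>The truncation level enters only through exp(\<theta> B); the other terms involve the
  first two moments of the leg itself, finite because d \<ge> 2.\<close>

lemma tleg_exp_moment:
  assumes "0 \<le> B" "0 \<le> \<theta>"
    and a: "(\<integral>\<^sup>+\<omega>. leg m x 0 \<omega> \<partial>P) \<le> ennreal a" "0 \<le> a"
    and b: "(\<integral>\<^sup>+\<omega>. leg m x 0 \<omega> ^ 2 \<partial>P) \<le> ennreal b" "0 \<le> b"
  shows "(\<integral>\<^sup>+\<omega>. ennreal (exp (\<theta> * tleg m x B z \<omega>)) \<partial>P) \<le> ennreal (exp (\<theta> * a + \<theta>\<^sup>2 * b * exp (\<theta> * B)))"
proof -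
  let ?Y = "tleg m x B z"
  note Y = tleg_bounds[OF assms(1), of m x z]
  have "(\<integral>\<^sup>+\<omega>. ennreal (exp (\<theta> * ?Y \<omega>)) \<partial>P)
      \<le> (\<integral>\<^sup>+\<omega>. 1 + ennreal \<theta> * leg m x z \<omega> + ennreal (\<theta>\<^sup>2 * exp (\<theta> * B)) * leg m x z \<omega> ^ 2 \<partial>P)"
  proof (intro nn_integral_mono)
    fix \<omega>
    have "exp (\<theta> * ?Y \<omega>) \<le> 1 + \<theta> * ?Y \<omega> + (\<theta> * ?Y \<omega>)\<^sup>2 * exp (\<theta> * ?Y \<omega>)"
      using Y[of \<omega>] assms(2) by (intro exp_le_quadratic) auto
    also have "\<dots> \<le> 1 + \<theta> * ?Y \<omega> + (\<theta> * ?Y \<omega>)\<^sup>2 * exp (\<theta> * B)"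
      using Y[of \<omega>] assms(2) by (intro add_left_mono mult_left_mono) (auto intro: mult_left_mono)
    also have "\<dots> = 1 + \<theta> * ?Y \<omega> + (\<theta>\<^sup>2 * exp (\<theta> * B)) * (?Y \<omega>)\<^sup>2"
      by (simp add: power_mult_distrib algebra_simps)
    finally have "ennreal (exp (\<theta> * ?Y \<omega>)) \<le> ennreal (1 + \<theta> * ?Y \<omega> + (\<theta>\<^sup>2 * exp (\<theta> * B)) * (?Y \<omega>)\<^sup>2)"
      by (rule ennreal_leI)
    also have "\<dots> = 1 + ennreal \<theta> * ennreal (?Y \<omega>) + ennreal (\<theta>\<^sup>2 * exp (\<theta> * B)) * ennreal (?Y \<omega>) ^ 2"
      using Y[of \<omega>] assms(2) by (simp add: ennreal_plus ennreal_mult ennreal_power ennreal_1[symmetric] del: ennreal_1)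
    also have "\<dots> \<le> 1 + ennreal \<theta> * leg m x z \<omega> + ennreal (\<theta>\<^sup>2 * exp (\<theta> * B)) * leg m x z \<omega> ^ 2"
      using Y[of \<omega>] by (intro add_mono mult_left_mono ennreal_power_mono) auto
    finally show "ennreal (exp (\<theta> * ?Y \<omega>)) \<le> 1 + ennreal \<theta> * leg m x z \<omega> + ennreal (\<theta>\<^sup>2 * exp (\<theta> * B)) * leg m x z \<omega> ^ 2" .
  qed
  also have "\<dots> = 1 + ennreal \<theta> * (\<integral>\<^sup>+\<omega>. leg m x z \<omega> \<partial>P) + ennreal (\<theta>\<^sup>2 * exp (\<theta> * B)) * (\<integral>\<^sup>+\<omega>. leg m x z \<omega> ^ 2 \<partial>P)"
    by (simp add: nn_integral_add nn_integral_cmult P.emeasure_space_1)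
  also have "\<dots> = 1 + ennreal \<theta> * (\<integral>\<^sup>+\<omega>. leg m x 0 \<omega> \<partial>P) + ennreal (\<theta>\<^sup>2 * exp (\<theta> * B)) * (\<integral>\<^sup>+\<omega>. leg m x 0 \<omega> ^ 2 \<partial>P)"
    using nn_integral_leg[of "\<lambda>u. u" m x z] nn_integral_leg[of "\<lambda>u. u ^ 2" m x z] by simp
  also have "\<dots> \<le> 1 + ennreal \<theta> * ennreal a + ennreal (\<theta>\<^sup>2 * exp (\<theta> * B)) * ennreal b"
    by (intro add_mono mult_left_mono a b) auto
  also have "\<dots> = ennreal (1 + (\<theta> * a + \<theta>\<^sup>2 * b * exp (\<theta> * B)))"
    using assms by (simp add: ennreal_plus ennreal_mult ennreal_1[symmetric] algebra_simps del: ennreal_1)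
  also have "\<dots> \<le> ennreal (exp (\<theta> * a + \<theta>\<^sup>2 * b * exp (\<theta> * B)))"
    by (intro ennreal_leI exp_ge_add_one_self)
  finally show ?thesis .
qed

text \<open>Exponential Markov inequality; separation of the starting points turns the expectation
  of the product into a product of expectations.\<close>

lemma chernoff_legs:
  assumes "0 \<le> B" "0 \<le> \<theta>" "finite J"
    and a: "(\<integral>\<^sup>+\<omega>. leg m x 0 \<omega> \<partial>P) \<le> ennreal a" "0 \<le> a"
    and b: "(\<integral>\<^sup>+\<omega>. leg m x 0 \<omega> ^ 2 \<partial>P) \<le> ennreal b" "0 \<le> b"
    and sep: "\<And>i j. i \<in> J \<Longrightarrow> j \<in> J \<Longrightarrow> i \<noteq> j \<Longrightarrow> 2 * int m < l1norm (z i - z j)"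
  shows "P.prob {\<omega> \<in> space P. s \<le> (\<Sum>i\<in>J. tleg m x B (z i) \<omega>)}
    \<le> exp (real (card J) * (\<theta> * a + \<theta>\<^sup>2 * b * exp (\<theta> * B)) - \<theta> * s)"
proof -
  let ?e = "\<lambda>i \<omega>. ennreal (exp (\<theta> * tleg m x B (z i) \<omega>))"
  let ?A = "{\<omega> \<in> space P. s \<le> (\<Sum>i\<in>J. tleg m x B (z i) \<omega>)}"
  let ?M = "\<theta> * a + \<theta>\<^sup>2 * b * exp (\<theta> * B)"
  have "P.indep_vars (\<lambda>_. borel) (\<lambda>i \<omega>. (\<lambda>u. ennreal (exp (\<theta> * enn2real (min u (ennreal B))))) (pt m (z i) (z i + x) \<omega>)) J"
    by (rule P.indep_vars_compose2[OF indep_pt]) (use sep in auto)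
  then have ind: "P.indep_vars (\<lambda>_. borel) ?e J" by (simp add: tleg_def leg_def)
  have "emeasure P ?A \<le> emeasure P {\<omega> \<in> space P. 1 \<le> ennreal (exp (- \<theta> * s)) * (\<Prod>i\<in>J. ?e i \<omega>)}"
  proof (rule emeasure_mono)
    show "?A \<subseteq> {\<omega> \<in> space P. 1 \<le> ennreal (exp (- \<theta> * s)) * (\<Prod>i\<in>J. ?e i \<omega>)}"
    proof safe
      fix \<omega> assume "s \<le> (\<Sum>i\<in>J. tleg m x B (z i) \<omega>)"
      then have "\<theta> * s \<le> (\<Sum>i\<in>J. \<theta> * tleg m x B (z i) \<omega>)"
        using assms(2) by (simp add: sum_distrib_left[symmetric] mult_left_mono)
      then have "1 \<le> exp (- \<theta> * s) * exp (\<Sum>i\<in>J. \<theta> * tleg m x B (z i) \<omega>)"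
        by (simp add: exp_add[symmetric])
      also have "exp (\<Sum>i\<in>J. \<theta> * tleg m x B (z i) \<omega>) = (\<Prod>i\<in>J. exp (\<theta> * tleg m x B (z i) \<omega>))"
        using assms(3) by (rule exp_sum)
      finally have "1 \<le> ennreal (exp (- \<theta> * s) * (\<Prod>i\<in>J. exp (\<theta> * tleg m x B (z i) \<omega>)))"
        by (metis ennreal_1 ennreal_leI)
      then show "1 \<le> ennreal (exp (- \<theta> * s)) * (\<Prod>i\<in>J. ?e i \<omega>)"
        by (simp add: ennreal_mult prod_nonneg prod_ennreal)
    qed
  qed measurable
  also have "\<dots> \<le> ennreal (exp (- \<theta> * s)) * (\<integral>\<^sup>+\<omega>. (\<Prod>i\<in>J. ?e i \<omega>) * indicator (space P) \<omega> \<partial>P)"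
    by (rule nn_integral_Markov_inequality) measurable
  also have "(\<integral>\<^sup>+\<omega>. (\<Prod>i\<in>J. ?e i \<omega>) * indicator (space P) \<omega> \<partial>P) = (\<integral>\<^sup>+\<omega>. (\<Prod>i\<in>J. ?e i \<omega>) \<partial>P)"
    by (intro nn_integral_cong) auto
  also have "\<dots> = (\<Prod>i\<in>J. \<integral>\<^sup>+\<omega>. ?e i \<omega> \<partial>P)"
    by (rule P.indep_vars_nn_integral[OF assms(3) ind]) auto
  also have "\<dots> \<le> (\<Prod>i\<in>J. ennreal (exp ?M))"
    by (intro prod_mono_ennreal tleg_exp_moment assms)
  also have "ennreal (exp (- \<theta> * s)) * \<dots> = ennreal (exp (real (card J) * ?M - \<theta> * s))"
    by (simp add: ennreal_power exp_of_nat_mult[symmetric] ennreal_mult[symmetric] exp_add[symmetric])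
  finally show ?thesis
    unfolding P.emeasure_eq_measure by (simp add: mult_left_mono)
qed


text \<open>This is where the exponent \<open>d\<close> in the moment assumption is needed: only finitely many of the
  legs starting at \<open>z\<close> exceed \<open>\<delta> |z|\<close>.\<close>

lemma AE_finite_long_legs:
  assumes fm: "finite_moment m x" and \<delta>: "\<delta> > 0"
  shows "AE \<omega> in P. finite {z. ennreal (\<delta> * real_of_int (l1norm z)) < leg m x z \<omega>}"
proof -
  let ?d = "CARD('d)"
  let ?n = "\<lambda>z :: int^'d. ennreal (\<delta> * real_of_int (l1norm z))"
  \<comment> \<open>Starting points are enumerated by naturals for Borel-Cantelli. The condition on
    \<open>to_nat\<close> discards numbers that code no point.\<close>
  define A where "A k = {\<omega> \<in> space P. to_nat (from_nat k :: int^'d) = k \<and> ?n (from_nat k) < leg m x (from_nat k) \<omega>}" for k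
  have [measurable]: "A k \<in> sets P" for k unfolding A_def by measurable
  define I where "I u = {k. to_nat (from_nat k :: int^'d) = k \<and> ?n (from_nat k) < u}" for u
  have emA: "emeasure P (A k) = (\<integral>\<^sup>+\<omega>. indicator (I (leg m x 0 \<omega>)) k \<partial>P)" for k
  proof -
    let ?f = "\<lambda>u. indicator {u. to_nat (from_nat k :: int^'d) = k \<and> ?n (from_nat k) < u} u :: ennreal"
    have "emeasure P (A k) = (\<integral>\<^sup>+\<omega>. indicator (A k) \<omega> \<partial>P)" by simp
    also have "\<dots> = (\<integral>\<^sup>+\<omega>. ?f (leg m x (from_nat k) \<omega>) \<partial>P)"
      by (intro nn_integral_cong) (auto simp: A_def indicator_def)
    also have "\<dots> = (\<integral>\<^sup>+\<omega>. ?f (leg m x 0 \<omega>) \<partial>P)"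
      by (rule nn_integral_leg[of ?f]) measurable
    also have "\<dots> = (\<integral>\<^sup>+\<omega>. indicator (I (leg m x 0 \<omega>)) k \<partial>P)"
      by (intro nn_integral_cong) (auto simp: I_def indicator_def)
    finally show ?thesis .
  qed
  \<comment> \<open>By stationarity the probabilities sum to the expected number of z with \<delta>
    |z| < u, where u is the leg at 0. These z lie in a ball of radius u / \<delta>, which has O(u^d
    + 1) points.\<close>
  have count: "(\<Sum>k. indicator (I u) k) \<le> 2 ^ ?d * ((ennreal (2 / \<delta>) * u) ^ ?d + 1)" for u :: ennreal
  proof (cases u)
    case (real r)
    define n where "n = nat \<lfloor>r / \<delta>\<rfloor>"
    have n: "real n \<le> r / \<delta>" using real \<delta> by (simp add: n_def)
    have sub: "I u \<subseteq> to_nat ` {z :: int^'d. l1norm z \<le> int n}"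
    proof
      fix k assume "k \<in> I u"
      then have k: "to_nat (from_nat k :: int^'d) = k" "\<delta> * real_of_int (l1norm (from_nat k :: int^'d)) < r"
        using real \<delta> by (auto simp: I_def ennreal_less_iff)
      then have "real_of_int (l1norm (from_nat k :: int^'d)) < r / \<delta>" using \<delta> by (simp add: field_simps)
      then have "l1norm (from_nat k :: int^'d) \<le> \<lfloor>r / \<delta>\<rfloor>" by linarith
      also have "\<dots> \<le> int n" by (simp add: n_def)
      finally show "k \<in> to_nat ` {z :: int^'d. l1norm z \<le> int n}" using k(1) by (metis (mono_tags) image_eqI mem_Collect_eq)
    qed
    have fin: "finite (I u)" using sub card_l1_ball(1) finite_subset by blast
    have "card (I u) \<le> card (to_nat ` {z :: int^'d. l1norm z \<le> int n})"
      using sub by (intro card_mono finite_imageI card_l1_ball(1))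
    also have "\<dots> \<le> card {z :: int^'d. l1norm z \<le> int n}" by (intro card_image_le card_l1_ball(1))
    also have "\<dots> \<le> (2 * n + 1) ^ ?d" by (rule card_l1_ball)
    finally have "real (card (I u)) \<le> real ((2 * n + 1) ^ ?d)" by linarith
    also have "\<dots> = (2 * real n + 1) ^ ?d" by (simp add: add.commute)
    also have "\<dots> \<le> (2 / \<delta> * r + 1) ^ ?d" using n by (intro power_mono) auto
    finally have *: "ennreal (card (I u)) \<le> ennreal ((2 / \<delta> * r + 1) ^ ?d)" by (rule ennreal_leI)
    have "(\<Sum>k. indicator (I u) k :: ennreal) = (\<integral>\<^sup>+k. indicator (I u) k \<partial>count_space UNIV)"
      by (rule nn_integral_count_space_nat[symmetric])
    also have "\<dots> = of_nat (card (I u))" using fin by simp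
    also have "\<dots> = ennreal (card (I u))" by (simp add: ennreal_of_nat_eq_real_of_nat)
    also note *
    also have "ennreal ((2 / \<delta> * r + 1) ^ ?d) = (ennreal (2 / \<delta>) * u + 1) ^ ?d"
      using real \<delta> by (simp add: ennreal_power[symmetric] ennreal_plus ennreal_mult[symmetric])
    also have "\<dots> \<le> 2 ^ ?d * ((ennreal (2 / \<delta>) * u) ^ ?d + 1 ^ ?d)" by (rule ennreal_add_power_le)
    finally show ?thesis by simp
  next
    case top
    have "ennreal (2 / \<delta>) * \<top> = \<top>" using \<delta> by (simp add: ennreal_mult_top)
    then show ?thesis using top by (simp add: ennreal_mult_top power_eq_top_ennreal)
  qed
  have "(\<Sum>k. emeasure P (A k)) = (\<integral>\<^sup>+\<omega>. (\<Sum>k. indicator (I (leg m x 0 \<omega>)) k) \<partial>P)"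
    unfolding emA by (rule nn_integral_suminf[symmetric]) (simp add: I_def indicator_def)
  also have "\<dots> \<le> (\<integral>\<^sup>+\<omega>. 2 ^ ?d * (ennreal (2 / \<delta>) ^ ?d * leg m x 0 \<omega> ^ ?d + 1) \<partial>P)"
    using count by (intro nn_integral_mono) (simp add: power_mult_distrib)
  also have "\<dots> = 2 ^ ?d * (ennreal (2 / \<delta>) ^ ?d * (\<integral>\<^sup>+\<omega>. leg m x 0 \<omega> ^ ?d \<partial>P) + 1)"
    by (simp add: nn_integral_cmult nn_integral_add P.emeasure_space_1)
  also have "\<dots> < \<infinity>"
    using fm unfolding finite_moment_def leg_def by (auto simp: ennreal_mult_less_top power_less_top_ennreal)
  finally have fin: "(\<Sum>k. ennreal (P.prob (A k))) \<noteq> \<top>" by (simp add: P.emeasure_eq_measure)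
  have "AE \<omega> in P. eventually (\<lambda>k. \<omega> \<in> space P - A k) sequentially"
    by (rule borel_cantelli_AE1) (auto intro: summable_suminf_not_top[OF _ fin] simp: P.emeasure_eq_measure)
  then show ?thesis
  proof eventually_elim
    case (elim \<omega>)
    then obtain k0 where k0: "\<And>k. k \<ge> k0 \<Longrightarrow> \<omega> \<in> space P - A k" by (auto simp: eventually_sequentially)
    have "to_nat z < k0" if "?n z < leg m x z \<omega>" for z
      using k0[of "to_nat z"] that by (force simp: A_def)
    then have "{z. ?n z < leg m x z \<omega>} \<subseteq> to_nat -` {..<k0}" by auto
    then show ?case by (rule finite_subset) (auto intro: finite_vimageI)
  qed
qed

text \<open>All but finitely many legs are at most \<delta> |z| with \<delta> = \<epsilon> / (C +
  1), hence at most \<epsilon> n in the ball considered. The finitely many others are finite, and a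
  fixed number is eventually below \<epsilon> n.\<close>

lemma AE_legs_le:
  assumes fm: "finite_moment m x" and \<epsilon>: "\<epsilon> > 0"
  shows "AE \<omega> in P. eventually (\<lambda>n. \<forall>z. l1norm z \<le> int C * int n \<longrightarrow> leg m x z \<omega> \<le> ennreal (\<epsilon> * real n)) sequentially"
proof -
  have "AE \<omega> in P. leg m x z \<omega> \<noteq> \<top>" for z
  proof -
    have "(\<integral>\<^sup>+\<omega>. leg m x z \<omega> \<partial>P) = (\<integral>\<^sup>+\<omega>. leg m x 0 \<omega> \<partial>P)" using nn_integral_leg[of "\<lambda>u. u" m x z] by simp
    also have "\<dots> < \<infinity>" using finite_moment_less_top[OF fm, of 1] dim by (simp add: leg_def)
    finally show ?thesis using nn_integral_PInf_AE[of "leg m x z" P] by auto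
  qed
  then have "AE \<omega> in P. \<forall>z. leg m x z \<omega> \<noteq> \<top>" by (simp add: AE_all_countable)
  moreover have "AE \<omega> in P. finite {z. ennreal (\<epsilon> / (real C + 1) * real_of_int (l1norm z)) < leg m x z \<omega>}"
    using \<epsilon> by (intro AE_finite_long_legs fm) (auto intro: add_nonneg_pos)
  ultimately show ?thesis
  proof eventually_elim
    case (elim \<omega>)
    let ?E = "{z. ennreal (\<epsilon> / (real C + 1) * real_of_int (l1norm z)) < leg m x z \<omega>}"
    define b where "b = (\<Sum>z\<in>?E. enn2real (leg m x z \<omega>))"
    have b: "leg m x z \<omega> \<le> ennreal b" if "z \<in> ?E" for z
    proof -
      have "enn2real (leg m x z \<omega>) \<le> b" unfolding b_def using that elim(2) by (intro member_le_sum) auto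
      then have "ennreal (enn2real (leg m x z \<omega>)) \<le> ennreal b" by (rule ennreal_leI)
      then show ?thesis using elim(1) by (simp add: ennreal_enn2real_if)
    qed
    have "eventually (\<lambda>n. b / \<epsilon> \<le> real n) sequentially"
      using filterlim_real_sequentially unfolding filterlim_at_top by blast
    then show ?case
    proof eventually_elim
      case (elim n)
      show ?case
      proof safe
        fix z :: "int^'d" assume z: "l1norm z \<le> int C * int n"
        show "leg m x z \<omega> \<le> ennreal (\<epsilon> * real n)"
        proof (cases "z \<in> ?E")
          case True
          have "b \<le> \<epsilon> * real n" using elim \<epsilon> by (simp add: field_simps)
          then show ?thesis using b[OF True] ennreal_leI order_trans by blast
        next
          case False
          then have "leg m x z \<omega> \<le> ennreal (\<epsilon> / (real C + 1) * real_of_int (l1norm z))" by simp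
          also have "\<dots> \<le> ennreal (\<epsilon> * real n)"
          proof (rule ennreal_leI)
            have "real_of_int (l1norm z) \<le> real_of_int (int C * int n)" using z by (simp only: of_int_le_iff)
            also have "\<dots> = real C * real n" by simp
            also have "\<dots> \<le> (real C + 1) * real n" by (simp add: mult_right_mono)
            finally have "\<epsilon> / (real C + 1) * real_of_int (l1norm z) \<le> \<epsilon> / (real C + 1) * ((real C + 1) * real n)"
              using \<epsilon> by (intro mult_left_mono) auto
            then show "\<epsilon> / (real C + 1) * real_of_int (l1norm z) \<le> \<epsilon> * real n"
              using add_nonneg_pos[of "real C" 1] by simp
          qed
          finally show ?thesis .
        qed
      qed
    qed
  qed
qed

text \<open>O(Q^d) starting points times a failure probability O(Q^{-(d+2)}) leaves Q^{-2}.\<close>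

lemma summable_union_bound:
  "summable (\<lambda>Q::nat. real ((2 * (C * Q) + 1) ^ d * R) * exp (1 - (real d + 2) * ln (real Q)))"
proof (rule summable_comparison_test_ev)
  let ?K = "(2 * real C + 1) ^ d * real R * exp 1"
  show "summable (\<lambda>Q. ?K * (1 / real Q ^ 2))"
    by (intro summable_mult) (use inverse_power_summable[of 2, where 'a=real] in \<open>simp add: inverse_eq_divide\<close>)
  show "eventually (\<lambda>Q::nat. norm (real ((2 * (C * Q) + 1) ^ d * R) * exp (1 - (real d + 2) * ln (real Q)))
     \<le> ?K * (1 / real Q ^ 2)) sequentially"
    using eventually_gt_at_top[of 0]
  proof eventually_elim
    case (elim Q)
    have "exp (1 - (real d + 2) * ln (real Q)) = exp 1 / exp (real (d + 2) * ln (real Q))"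
      by (simp add: exp_diff algebra_simps)
    also have "exp (real (d + 2) * ln (real Q)) = real Q ^ (d + 2)"
      unfolding exp_of_nat_mult using elim by simp
    finally have e: "exp (1 - (real d + 2) * ln (real Q)) = exp 1 / real Q ^ (d + 2)" .
    have "2 * (real C * real Q) + 1 \<le> (2 * real C + 1) * real Q" using elim by (simp add: algebra_simps)
    then have "(2 * (real C * real Q) + 1) ^ d \<le> ((2 * real C + 1) * real Q) ^ d" by (intro power_mono) auto
    then have "(2 * (real C * real Q) + 1) ^ d * real R * (exp 1 / real Q ^ (d + 2))
       \<le> ((2 * real C + 1) * real Q) ^ d * real R * (exp 1 / real Q ^ (d + 2))"
      by (intro mult_right_mono) auto
    also have "\<dots> = ?K * (1 / real Q ^ 2)"
    proof -
      have "(A * q) ^ d * r * (e / q ^ (d + 2)) = A ^ d * r * e * (1 / q ^ 2)" if "q > 0" for A q r e :: real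
        using that by (simp add: power_mult_distrib power_add power2_eq_square field_simps)
      then show ?thesis using elim by simp
    qed
    finally show ?case unfolding e by (simp add: abs_mult add.commute)
  qed
qed

text \<open>Union bound over all starting points in a ball of radius C Q and all residue classes,
  then Borel-Cantelli.\<close>

lemma AE_truncated_legs:
  assumes fm: "finite_moment m x" and x: "x \<noteq> 0"
    and a: "(\<integral>\<^sup>+\<omega>. leg m x 0 \<omega> \<partial>P) \<le> ennreal a" "0 \<le> a" and \<eta>: "\<eta> > 0"
  defines "R \<equiv> 2 * m + 1"
  obtains \<epsilon> where "\<epsilon> > 0" "\<And>C. AE \<omega> in P. eventually (\<lambda>Q. \<forall>z. l1norm z \<le> int C * int Q \<longrightarrow>
      (\<forall>r<R. (\<Sum>q<Q. tleg m x (\<epsilon> * real Q) (z + int (r + R * q) *s x) \<omega>) \<le> real Q * (a + \<eta>))) sequentially"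
proof -
  let ?d = "CARD('d)"
  have "(\<integral>\<^sup>+\<omega>. leg m x 0 \<omega> ^ 2 \<partial>P) < \<infinity>"
    using finite_moment_less_top[OF fm, of 2] dim by (simp add: leg_def)
  then obtain b where b: "(\<integral>\<^sup>+\<omega>. leg m x 0 \<omega> ^ 2 \<partial>P) \<le> ennreal b" "0 \<le> b"
    by (cases "\<integral>\<^sup>+\<omega>. leg m x 0 \<omega> ^ 2 \<partial>P") auto
  \<comment> \<open>The power d pays for the number of starting points, the further 2 for
    summability.\<close>
  define K where "K = real ?d + 2"
  define \<kappa> where "\<kappa> = K / \<eta>"
  define \<epsilon> where "\<epsilon> = 1 / (2 * \<kappa>)"
  have \<epsilon>: "\<epsilon> > 0" "\<kappa> > 0" "K > 0" using \<eta> by (auto simp: \<epsilon>_def \<kappa>_def K_def intro!: divide_pos_pos add_nonneg_pos mult_pos_pos)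
  have "AE \<omega> in P. eventually (\<lambda>Q. \<forall>z. l1norm z \<le> int C * int Q \<longrightarrow>
      (\<forall>r<R. (\<Sum>q<Q. tleg m x (\<epsilon> * real Q) (z + int (r + R * q) *s x) \<omega>) \<le> real Q * (a + \<eta>))) sequentially" for C
  proof -
    define B where "B Q z r = {\<omega> \<in> space P. real Q * (a + \<eta>) \<le> (\<Sum>q<Q. tleg m x (\<epsilon> * real Q) (z + int (r + R * q) *s x) \<omega>)}"
      for Q :: nat and z and r
    let ?Z = "\<lambda>Q. {z :: int^'d. l1norm z \<le> int (C * Q)}"
    define E where "E Q = (\<Union>(z, r) \<in> ?Z Q \<times> {..<R}. B Q z r)" for Q
    have Bm [measurable]: "B Q z r \<in> sets P" for Q z r unfolding B_def by measurable
    have Zfin: "finite (?Z Q \<times> {..<R})" for Q using card_l1_ball(1) by blast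
    have Em: "E Q \<in> sets P" for Q unfolding E_def
      by (intro sets.finite_UN Zfin) auto
    have "eventually (\<lambda>Q. P.prob (E Q) \<le> real ((2 * (C * Q) + 1) ^ ?d * R) * exp (1 - K * ln (real Q))) sequentially"
      using chernoff_exponent[OF \<eta> \<epsilon>(3) b(2), of a, folded \<kappa>_def] eventually_gt_at_top[of 0]
    proof eventually_elim
      case (elim Q)
      let ?t = "\<kappa> * ln (real Q) / real Q"
      have t: "0 \<le> ?t" using \<epsilon>(2) elim(2) by simp
      have Bp: "P.prob (B Q z r) \<le> exp (1 - K * ln (real Q))" for z r
      proof -
        have "P.prob (B Q z r) \<le> exp (real (card {..<Q}) * (?t * a + ?t\<^sup>2 * b * exp (?t * (\<epsilon> * real Q))) - ?t * (real Q * (a + \<eta>)))"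
          unfolding B_def
        proof (rule chernoff_legs[OF _ t _ a b])
          fix i j assume ij: "i \<noteq> (j :: nat)"
          have "1 \<le> l1norm x" using x l1norm_nonneg[of x] l1norm_eq_0_iff[of x] by linarith
          have "z + int (r + R * i) *s x - (z + int (r + R * j) *s x) = (int R * (int i - int j)) *s x"
            by (simp add: vec_eq_iff algebra_simps)
          then have "l1norm (z + int (r + R * i) *s x - (z + int (r + R * j) *s x)) = int R * \<bar>int i - int j\<bar> * l1norm x"
            by (simp only: l1norm_scale abs_mult abs_of_nat)
          moreover have "int R * 1 * 1 \<le> int R * \<bar>int i - int j\<bar> * l1norm x"
            using ij \<open>1 \<le> l1norm x\<close> by (intro mult_mono) auto
          moreover have "int R = 2 * int m + 1" by (simp add: R_def)
          ultimately show "2 * int m < l1norm (z + int (r + R * i) *s x - (z + int (r + R * j) *s x))"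
            by linarith
        qed (use \<epsilon> in auto)
        also have "\<dots> \<le> exp (1 - K * ln (real Q))" using elim(1) unfolding \<epsilon>_def by simp
        finally show ?thesis .
      qed
      have "P.prob (E Q) \<le> (\<Sum>(z, r) \<in> ?Z Q \<times> {..<R}. P.prob (B Q z r))"
        unfolding E_def
        by (intro order_trans[OF P.finite_measure_subadditive_finite[OF Zfin]]) (auto simp: case_prod_beta)
      also have "\<dots> \<le> (\<Sum>(z, r) \<in> ?Z Q \<times> {..<R}. exp (1 - K * ln (real Q)))"
        using Bp by (intro sum_mono) auto
      also have "\<dots> = real (card (?Z Q) * R) * exp (1 - K * ln (real Q))"
        by (simp add: card_cartesian_product)
      also have "\<dots> \<le> real ((2 * (C * Q) + 1) ^ ?d * R) * exp (1 - K * ln (real Q))"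
        using card_l1_ball(2)[where n="C * Q" and 'd='d] by (intro mult_right_mono of_nat_mono mult_le_mono1) auto
      finally show ?case .
    qed
    then have "summable (\<lambda>Q. P.prob (E Q))"
      by (intro summable_comparison_test_ev[OF _ summable_union_bound[of C ?d R]]) (auto simp: K_def)
    then have "AE \<omega> in P. eventually (\<lambda>Q. \<omega> \<in> space P - E Q) sequentially"
      using Em by (intro borel_cantelli_AE1) (auto simp: P.emeasure_eq_measure)
    then show ?thesis
    proof eventually_elim
      case (elim \<omega>)
      then show ?case
      proof eventually_elim
        case (elim Q)
        show ?case
        proof (intro allI impI)
          fix z :: "int^'d" and r assume zr: "l1norm z \<le> int C * int Q" "r < R"
          then have "\<omega> \<in> space P - B Q z r" using elim by (force simp: E_def)
          then show "(\<Sum>q<Q. tleg m x (\<epsilon> * real Q) (z + int (r + R * q) *s x) \<omega>) \<le> real Q * (a + \<eta>)"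
            by (auto simp: B_def)
        qed
      qed
    qed
  qed
  then show ?thesis using that \<epsilon>(1) by blast
qed

text \<open>For large n every leg involved is below the truncation level, so the truncated sums are
  the true ones and the bounds for the residue classes can be added.\<close>

lemma AE_line_sums_le:
  assumes fm: "finite_moment m x" and x: "x \<noteq> 0" and a: "(\<integral>\<^sup>+\<omega>. leg m x 0 \<omega> \<partial>P) < ennreal a"
  shows "AE \<omega> in P. eventually (\<lambda>n. \<forall>z. l1norm z \<le> int C * int n \<longrightarrow>
     (\<Sum>i<n. leg m x (z + int i *s x) \<omega>) \<le> ennreal (real n * a)) sequentially"
proof -
  define R where "R = 2 * m + 1"
  obtain a0 where a0: "(\<integral>\<^sup>+\<omega>. leg m x 0 \<omega> \<partial>P) = ennreal a0" "0 \<le> a0"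
    using a by (cases "\<integral>\<^sup>+\<omega>. leg m x 0 \<omega> \<partial>P") auto
  \<comment> \<open>Half of the gap between a and the mean is the excess allowed per leg; the other
    half pays for rounding n up to a multiple of R.\<close>
  define \<eta> where "\<eta> = (a - a0) / 2"
  have \<eta>: "\<eta> > 0" using a a0 by (simp add: \<eta>_def ennreal_less_iff)
  obtain \<epsilon> where \<epsilon>: "\<epsilon> > 0" "\<And>C. AE \<omega> in P. eventually (\<lambda>Q. \<forall>z. l1norm z \<le> int C * int Q \<longrightarrow>
      (\<forall>r<R. (\<Sum>q<Q. tleg m x (\<epsilon> * real Q) (z + int (r + R * q) *s x) \<omega>) \<le> real Q * (a0 + \<eta>))) sequentially"
    using AE_truncated_legs[OF fm x _ a0(2) \<eta>] a0(1) unfolding R_def by auto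
  \<comment> \<open>C R bounds the starting point z, and R |x| the displacement along a line of R Q
    legs, both in units of Q.\<close>
  define C' where "C' = C * R + R * nat (l1norm x)"
  from \<epsilon>(2)[of "C * R"] AE_legs_le[OF fm \<epsilon>(1), of C'] show ?thesis
  proof eventually_elim
    case (elim \<omega>)
    have lim: "filterlim (\<lambda>n. n div R + 1) at_top sequentially"
      unfolding filterlim_at_top
    proof safe
      fix Z :: nat
      show "eventually (\<lambda>n. Z \<le> n div R + 1) sequentially"
        using eventually_ge_at_top[of "Z * R"]
      proof eventually_elim
        case (elim n)
        have "R \<noteq> 0" by (simp add: R_def)
        from div_le_mono[OF elim, of R] nonzero_mult_div_cancel_right[OF this, of Z] show ?case by simp
      qed
    qed
    have "eventually (\<lambda>n. real R * (a0 + \<eta>) / \<eta> \<le> real n) sequentially"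
      using filterlim_real_sequentially unfolding filterlim_at_top by blast
    with eventually_compose_filterlim[OF elim(1) lim] eventually_compose_filterlim[OF elim(2) lim]
    show ?case
    proof eventually_elim
      case (elim n)
      \<comment> \<open>Rounded up, so that R Q \<ge> n; the legs added are nonnegative and only
        increase the sum.\<close>
      define Q where "Q = n div R + 1"
      have nQ: "n \<le> R * Q" "R * Q \<le> n + R"
      proof -
        have "n = R * (n div R) + n mod R" by (rule mult_div_mod_eq[symmetric])
        moreover have "n mod R < R" by (simp add: R_def)
        ultimately show "n \<le> R * Q" "R * Q \<le> n + R"
          unfolding Q_def distrib_left mult_1_right by linarith+
      qed
      show ?case
      proof (intro allI impI)
        fix z :: "int^'d" assume z: "l1norm z \<le> int C * int n"
        have "int C * int n \<le> int C * int (R * Q)" using nQ(1) by (intro mult_left_mono) (simp_all only: of_nat_le_iff of_nat_0_le_iff)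
        then have zQ: "l1norm z \<le> int (C * R) * int Q" using z by (simp add: mult.assoc)
        have small: "leg m x (z + int (r + R * q) *s x) \<omega> \<le> ennreal (\<epsilon> * real Q)" if "r < R" "q < Q" for r q
        proof -
          have "r + R * q \<le> R * Q" using that mult_le_mono2[of "Suc q" Q R] by simp
          then have "int (r + R * q) * l1norm x \<le> int (R * Q) * l1norm x"
            by (intro mult_right_mono) (simp_all only: of_nat_le_iff l1norm_nonneg)
          then have "l1norm (int (r + R * q) *s x) \<le> int (R * Q) * l1norm x" by (simp only: l1norm_scale abs_of_nat)
          with zQ l1norm_triangle[of z "int (r + R * q) *s x"]
          have "l1norm (z + int (r + R * q) *s x) \<le> int (C * R) * int Q + int (R * Q) * l1norm x" by linarith
          also have "\<dots> = int C' * int Q" by (simp add: C'_def algebra_simps)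
          finally show ?thesis using elim(2) unfolding Q_def by blast
        qed
        have "(\<Sum>i<n. leg m x (z + int i *s x) \<omega>) \<le> (\<Sum>i<R * Q. leg m x (z + int i *s x) \<omega>)"
          using nQ(1) by (intro sum_mono2) auto
        also have "\<dots> = (\<Sum>r<R. \<Sum>q<Q. leg m x (z + int (r + R * q) *s x) \<omega>)"
          by (rule sum_residue_classes)
        also have "\<dots> = (\<Sum>r<R. \<Sum>q<Q. ennreal (tleg m x (\<epsilon> * real Q) (z + int (r + R * q) *s x) \<omega>))"
        proof (intro sum.cong refl)
          fix r q assume "r \<in> {..<R}" "q \<in> {..<Q}"
          then have "leg m x (z + int (r + R * q) *s x) \<omega> \<le> ennreal (\<epsilon> * real Q)" using small by simp
          then show "leg m x (z + int (r + R * q) *s x) \<omega> = ennreal (tleg m x (\<epsilon> * real Q) (z + int (r + R * q) *s x) \<omega>)"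
            unfolding tleg_def by (auto simp: min_def ennreal_enn2real_if top_unique)
        qed
        also have "\<dots> \<le> (\<Sum>r<R. ennreal (real Q * (a0 + \<eta>)))"
        proof (intro sum_mono)
          fix r assume "r \<in> {..<R}"
          then have "(\<Sum>q<Q. tleg m x (\<epsilon> * real Q) (z + int (r + R * q) *s x) \<omega>) \<le> real Q * (a0 + \<eta>)"
            using elim(1) zQ unfolding Q_def by blast
          then show "(\<Sum>q<Q. ennreal (tleg m x (\<epsilon> * real Q) (z + int (r + R * q) *s x) \<omega>)) \<le> ennreal (real Q * (a0 + \<eta>))"
            using tleg_bounds[of "\<epsilon> * real Q" m x] \<epsilon>(1) by (subst sum_ennreal) (auto intro: ennreal_leI)
        qed
        also have "\<dots> = ennreal (real (R * Q) * (a0 + \<eta>))"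
          using a0 \<eta> by (subst sum_ennreal) (auto simp: algebra_simps)
        also have "\<dots> \<le> ennreal (real n * a)"
        proof (rule ennreal_leI)
          have "real (R * Q) \<le> real n + real R" using nQ(2) by linarith
          then have "real (R * Q) * (a0 + \<eta>) \<le> (real n + real R) * (a0 + \<eta>)"
            using a0 \<eta> by (intro mult_right_mono) auto
          moreover have "real R * (a0 + \<eta>) \<le> real n * \<eta>" using elim(3) \<eta> by (simp add: field_simps)
          moreover have "a = a0 + \<eta> + \<eta>" by (simp add: \<eta>_def)
          ultimately show "real (R * Q) * (a0 + \<eta>) \<le> real n * a" by (simp add: algebra_simps)
        qed
        finally show "(\<Sum>i<n. leg m x (z + int i *s x) \<omega>) \<le> ennreal (real n * a)" .
      qed
    qed
  qed
qed

end

subsection \<open>Lower bounds for subadditive processes\<close>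

text \<open>A finite first term and a shift of the index disappear after division by n. Applied to X
  and its shift, it shows that the lower limit cannot decrease along an orbit.\<close>

lemma liminf_ratio_le_shift:
  fixes f g :: "nat \<Rightarrow> ennreal"
  assumes le: "\<And>n. f (Suc n) \<le> a + g n" and a: "a < \<top>"
  shows "liminf (\<lambda>n. f n / of_nat n) \<le> liminf (\<lambda>n. g n / of_nat n)"
proof (rule dense_ge)
  fix y assume y: "liminf (\<lambda>n. g n / of_nat n) < y"
  show "liminf (\<lambda>n. f n / of_nat n) \<le> y"
  proof (rule ccontr)
    assume "\<not> ?thesis"
    then have yf: "y < liminf (\<lambda>n. f n / of_nat n)" by simp
    then obtain r where r: "y = ennreal r" "0 \<le> r" by (cases y) auto
    obtain y' where y': "liminf (\<lambda>n. g n / of_nat n) < y'" "y' < y" using y dense by blast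
    then obtain r' where r': "y' = ennreal r'" "0 \<le> r'" by (cases y') auto
    have rr: "r' < r" using y'(2) r r' by (simp add: ennreal_less_iff)
    obtain b where b: "a = ennreal b" "0 \<le> b" using a by (cases a) auto
    have ev: "eventually (\<lambda>n. y < f (Suc n) / of_nat (Suc n)) sequentially"
      using less_LiminfD[OF yf] eventually_sequentially_Suc[of "\<lambda>n. y < f n / of_nat n"] by blast
    have "eventually (\<lambda>n. b / (r - r') \<le> real n) sequentially"
      using filterlim_real_sequentially unfolding filterlim_at_top by blast
    then have "eventually (\<lambda>n. y' \<le> g n / of_nat n) sequentially"
      using ev eventually_gt_at_top[of 0]
    proof eventually_elim
      case (elim n)
      show ?case
      proof (rule ccontr)
        assume "\<not> ?thesis"
        then have "g n / of_nat n < ennreal r'" using r' by simp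
        then have g: "g n < ennreal r' * of_nat n"
          using elim(3) by (subst (asm) divide_less_ennreal) (auto simp: of_nat_less_top)
        have "f (Suc n) \<le> ennreal b + ennreal r' * of_nat n"
          using le[of n] b g by (meson add_left_mono less_imp_le order_trans)
        also have "\<dots> = ennreal (b + r' * real n)"
          using b r' by (simp add: ennreal_of_nat_eq_real_of_nat ennreal_mult[symmetric])
        also have "\<dots> \<le> ennreal (r * real (Suc n))"
        proof (rule ennreal_leI)
          have "b \<le> real n * (r - r')" using elim(1) rr by (simp add: field_simps)
          then show "b + r' * real n \<le> r * real (Suc n)" using r by (simp add: algebra_simps)
        qed
        also have "\<dots> = y * of_nat (Suc n)"
          using r by (simp add: ennreal_of_nat_eq_real_of_nat ennreal_mult)
        finally have "f (Suc n) / of_nat (Suc n) \<le> y"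
          by (intro divide_le_posI_ennreal)
            (simp_all add: mult.commute ennreal_of_nat_eq_real_of_nat del: of_nat_Suc)
        then show False using elim(2) by simp
      qed
    qed
    then have "y' \<le> liminf (\<lambda>n. g n / of_nat n)" by (rule Liminf_bounded)
    then show False using y'(1) by simp
  qed
qed

context prob_space
begin

text \<open>The nonnegative difference has integral zero. It yields both the invariance of the lower
  limit and, at the end, its constancy.\<close>

lemma AE_eq_of_integral_le:
  assumes [measurable]: "f \<in> borel_measurable M" "g \<in> borel_measurable M"
    and "AE x in M. f x \<le> g x" "(\<integral>\<^sup>+x. g x \<partial>M) \<le> (\<integral>\<^sup>+x. f x \<partial>M)" "(\<integral>\<^sup>+x. f x \<partial>M) < \<infinity>"
  shows "AE x in M. f x = (g x :: ennreal)"
proof -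
  have "(\<integral>\<^sup>+x. g x - f x \<partial>M) = (\<integral>\<^sup>+x. g x \<partial>M) - (\<integral>\<^sup>+x. f x \<partial>M)"
    using assms by (intro nn_integral_diff) auto
  also have "\<dots> = 0" using assms by (simp add: diff_eq_0_iff_ennreal)
  finally have "AE x in M. g x - f x = 0" by (simp add: nn_integral_0_iff_AE)
  then show ?thesis using assms(3)
    by eventually_elim (auto simp: diff_eq_0_iff_ennreal top_unique intro: antisym)
qed

lemma measure_preserving_funpow:
  assumes T: "T \<in> M \<rightarrow>\<^sub>M M" "distr M M T = M"
  shows "(T ^^ n) \<in> M \<rightarrow>\<^sub>M M" "distr M M (T ^^ n) = M"
proof -
  have "(T ^^ n) \<in> M \<rightarrow>\<^sub>M M \<and> distr M M (T ^^ n) = M"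
  proof (induction n)
    case (Suc n)
    then have "distr M M (T \<circ> (T ^^ n)) = distr (distr M M (T ^^ n)) M T"
      using T(1) by (subst distr_distr) auto
    then show ?case using Suc T by (simp add: comp_def measurable_compose[of "T ^^ n" M M T M])
  qed (simp add: id_def)
  then show "(T ^^ n) \<in> M \<rightarrow>\<^sub>M M" "distr M M (T ^^ n) = M" by auto
qed

text \<open>The covering argument of Katznelson and Weiss: an orbit segment of length \<open>K\<close> is cut into blocks
  of length at most \<open>m\<close> on which the average is almost the lower limit, plus unit steps from the exceptional
  set \<open>B\<close> and at most \<open>m\<close> unit steps at the end.\<close>

lemma subadditive_covering:
  fixes X :: "nat \<Rightarrow> 'a \<Rightarrow> ennreal"
  assumes sub: "\<And>m n \<omega>. X (m + n) \<omega> \<le> X m \<omega> + X n ((T ^^ m) \<omega>)" and X0: "\<And>\<omega>. X 0 \<omega> = 0"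
    and B: "\<And>\<omega>. \<omega> \<notin> B \<Longrightarrow> \<exists>n. 1 \<le> n \<and> n \<le> m \<and> X n \<omega> \<le> of_nat n * v \<omega>"
    and \<phi>: "\<And>\<omega>. \<omega> \<in> B \<Longrightarrow> X 1 \<omega> \<le> \<phi> \<omega>"
    and inv: "\<And>j. v ((T ^^ j) \<omega>) = v \<omega>"
  shows "X K \<omega> \<le> of_nat K * v \<omega> + (\<Sum>j<K. \<phi> ((T ^^ j) \<omega>))
     + (\<Sum>j\<in>{K - m..<K}. X 1 ((T ^^ j) \<omega>))"
  using inv
proof (induction K arbitrary: \<omega> rule: less_induct)
  case (less K)
  have step: "X K \<omega> \<le> X n \<omega> + (of_nat (K - n) * v \<omega> + (\<Sum>j\<in>{n..<K}. \<phi> ((T ^^ j) \<omega>))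
     + (\<Sum>j\<in>{K - m..<K}. X 1 ((T ^^ j) \<omega>)))" if n: "1 \<le> n" "n \<le> K" for n
  proof -
    let ?w = "(T ^^ n) \<omega>"
    have pw: "(T ^^ j) ?w = (T ^^ (j + n)) \<omega>" for j by (simp add: funpow_add)
    have "X K \<omega> \<le> X n \<omega> + X (K - n) ?w" using sub[of n "K - n" \<omega>] n by simp
    also have "X (K - n) ?w \<le> of_nat (K - n) * v ?w + (\<Sum>j<K - n. \<phi> ((T ^^ j) ?w))
       + (\<Sum>j\<in>{K - n - m..<K - n}. X 1 ((T ^^ j) ?w))"
      by (intro less.IH) (use n less.prems in \<open>auto simp: pw\<close>)
    also have "v ?w = v \<omega>" by (rule less.prems)
    also have "(\<Sum>j<K - n. \<phi> ((T ^^ j) ?w)) = (\<Sum>j\<in>{n..<K}. \<phi> ((T ^^ j) \<omega>))"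
      unfolding pw by (rule sum.reindex_bij_witness[of _ "\<lambda>j. j - n" "\<lambda>j. j + n"]) (use n in auto)
    also have "(\<Sum>j\<in>{K - n - m..<K - n}. X 1 ((T ^^ j) ?w)) = (\<Sum>j\<in>{K - n - m + n..<K}. X 1 ((T ^^ j) \<omega>))"
      unfolding pw by (rule sum.reindex_bij_witness[of _ "\<lambda>j. j - n" "\<lambda>j. j + n"]) (use n in auto)
    \<comment> \<open>Subtraction is truncated: if K < n + m the shifted window starts at n rather
      than at K - m, and it is still contained in {K - m..<K}.\<close>
    also have "\<dots> \<le> (\<Sum>j\<in>{K - m..<K}. X 1 ((T ^^ j) \<omega>))"
      by (rule sum_mono2) auto
    finally show ?thesis by (simp add: add_left_mono)
  qed
  have split: "(\<Sum>j<K. \<phi> ((T ^^ j) \<omega>)) = (\<Sum>j<n. \<phi> ((T ^^ j) \<omega>)) + (\<Sum>j\<in>{n..<K}. \<phi> ((T ^^ j) \<omega>))" if "n \<le> K" for n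
    using sum.atLeastLessThan_concat[of 0 n K "\<lambda>j. \<phi> ((T ^^ j) \<omega>)"] that by (simp add: atLeast0LessThan)
  \<comment> \<open>At a point outside B either an efficient block fits into the remaining time, or
    it is longer than that; then K \<le> m and the last window pays for everything by unit
    steps.\<close>
  consider "K = 0" | "K > 0" "\<omega> \<in> B" | n where "1 \<le> n" "n \<le> m" "n \<le> K" "X n \<omega> \<le> of_nat n * v \<omega>"
    | "K > 0" "K \<le> m" using B[of \<omega>] by force
  then show ?case
  proof cases
    case 1
    then show ?thesis by (simp add: X0)
  next
    case 2
    have "X K \<omega> \<le> X 1 \<omega> + (of_nat (K - 1) * v \<omega> + (\<Sum>j\<in>{1..<K}. \<phi> ((T ^^ j) \<omega>))
     + (\<Sum>j\<in>{K - m..<K}. X 1 ((T ^^ j) \<omega>)))" using 2 by (intro step) auto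
    also have "\<dots> = of_nat (K - 1) * v \<omega> + (X 1 \<omega> + (\<Sum>j\<in>{1..<K}. \<phi> ((T ^^ j) \<omega>)))
     + (\<Sum>j\<in>{K - m..<K}. X 1 ((T ^^ j) \<omega>))" by (simp add: ac_simps)
    also have "X 1 \<omega> + (\<Sum>j\<in>{1..<K}. \<phi> ((T ^^ j) \<omega>)) \<le> (\<Sum>j<K. \<phi> ((T ^^ j) \<omega>))"
      using split[of 1] 2 \<phi>[of \<omega>] by (simp add: add_right_mono)
    also have "of_nat (K - 1) * v \<omega> \<le> of_nat K * v \<omega>" by (intro mult_right_mono) auto
    finally show ?thesis by (simp add: add_mono)
  next
    case 3
    have "X K \<omega> \<le> X n \<omega> + (of_nat (K - n) * v \<omega> + (\<Sum>j\<in>{n..<K}. \<phi> ((T ^^ j) \<omega>))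
     + (\<Sum>j\<in>{K - m..<K}. X 1 ((T ^^ j) \<omega>)))" using 3 by (intro step) auto
    also have "\<dots> \<le> of_nat n * v \<omega> + (of_nat (K - n) * v \<omega> + (\<Sum>j<K. \<phi> ((T ^^ j) \<omega>))
     + (\<Sum>j\<in>{K - m..<K}. X 1 ((T ^^ j) \<omega>)))" using split[OF 3(3)]
      by (intro add_mono 3 order_refl) (simp add: add_increasing)
    also have "\<dots> = (of_nat n + of_nat (K - n)) * v \<omega> + (\<Sum>j<K. \<phi> ((T ^^ j) \<omega>))
     + (\<Sum>j\<in>{K - m..<K}. X 1 ((T ^^ j) \<omega>))" by (simp only: distrib_right add.assoc)
    also have "of_nat n + of_nat (K - n) = (of_nat K :: ennreal)" using 3 by (simp flip: of_nat_add)
    finally show ?thesis .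
  next
    case 4
    have "X k \<omega> \<le> (\<Sum>j<k. X 1 ((T ^^ j) \<omega>))" for k
    proof (induction k)
      case (Suc k)
      have "X (Suc k) \<omega> \<le> X k \<omega> + X 1 ((T ^^ k) \<omega>)" using sub[of k 1 \<omega>] by simp
      also have "\<dots> \<le> (\<Sum>j<k. X 1 ((T ^^ j) \<omega>)) + X 1 ((T ^^ k) \<omega>)" by (intro add_right_mono Suc)
      finally show ?case by simp
    qed (simp add: X0)
    from this[of K] 4 have "X K \<omega> \<le> (\<Sum>j\<in>{K - m..<K}. X 1 ((T ^^ j) \<omega>))" by (simp add: atLeast0LessThan)
    then show ?thesis by (rule add_increasing[rotated]) simp
  qed
qed

text \<open>The covering gives that the mean of h is at least \<mu>. Together with h \<le> \<mu>
  almost surely this leaves only equality.\<close>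

lemma subadditive_liminf_eq:
  fixes X :: "nat \<Rightarrow> 'a \<Rightarrow> ennreal" and \<mu> :: ennreal
  assumes T: "T \<in> M \<rightarrow>\<^sub>M M" "distr M M T = M"
    and X [measurable]: "\<And>n. X n \<in> borel_measurable M"
    and sub: "\<And>m n \<omega>. X (m + n) \<omega> \<le> X m \<omega> + X n ((T ^^ m) \<omega>)" and X0: "\<And>\<omega>. X 0 \<omega> = 0"
    and fin: "(\<integral>\<^sup>+\<omega>. X 1 \<omega> \<partial>M) < \<infinity>"
    and \<mu>: "\<And>n. of_nat n * \<mu> \<le> (\<integral>\<^sup>+\<omega>. X n \<omega> \<partial>M)"
    and upper: "AE \<omega> in M. liminf (\<lambda>n. X n \<omega> / of_nat n) \<le> \<mu>"
  shows "AE \<omega> in M. liminf (\<lambda>n. X n \<omega> / of_nat n) = \<mu>"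
proof -
  define h where "h \<omega> = liminf (\<lambda>n. X n \<omega> / of_nat n)" for \<omega>
  have h [measurable]: "h \<in> borel_measurable M" unfolding h_def by measurable
  note Tm [measurable] = measure_preserving_funpow(1)[OF T]
  have pres: "(\<integral>\<^sup>+\<omega>. f ((T ^^ n) \<omega>) \<partial>M) = (\<integral>\<^sup>+\<omega>. f \<omega> \<partial>M)" if "f \<in> borel_measurable M" for f n
    using that by (subst (2) measure_preserving_funpow(2)[OF T, of n, symmetric]) (simp add: nn_integral_distr)
  have \<mu>_fin: "\<mu> < \<top>" using \<mu>[of 1] fin by simp
  have int_h: "(\<integral>\<^sup>+\<omega>. h \<omega> \<partial>M) \<le> \<mu>"
  proof -
    have "(\<integral>\<^sup>+\<omega>. h \<omega> \<partial>M) \<le> (\<integral>\<^sup>+\<omega>. \<mu> \<partial>M)" using upper by (intro nn_integral_mono_AE) (simp add: h_def)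
    then show ?thesis by (simp add: emeasure_space_1)
  qed
  have "AE \<omega> in M. X 1 \<omega> \<noteq> \<infinity>" by (rule nn_integral_noteq_infinite) (use fin in auto)
  \<comment> \<open>Measure preservation gives h and its shift the same finite integral, so this
    inequality becomes invariance.\<close>
  then have "AE \<omega> in M. h \<omega> \<le> h (T \<omega>)"
  proof eventually_elim
    case (elim \<omega>)
    show ?case unfolding h_def
      by (rule liminf_ratio_le_shift[where a="X 1 \<omega>"]) (use sub[of 1 _ \<omega>] elim in \<open>auto simp: less_top\<close>)
  qed
  moreover have "(\<integral>\<^sup>+\<omega>. h (T \<omega>) \<partial>M) = (\<integral>\<^sup>+\<omega>. h \<omega> \<partial>M)" using pres[OF h, of 1] by simp
  ultimately have "AE \<omega> in M. h \<omega> = h (T \<omega>)"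
    using int_h \<mu>_fin T(1) by (intro AE_eq_of_integral_le) auto
  then have "AE \<omega> in distr M M (T ^^ j). h \<omega> = h (T \<omega>)" for j
    by (simp only: measure_preserving_funpow(2)[OF T])
  then have "AE \<omega> in M. h ((T ^^ j) \<omega>) = h (T ((T ^^ j) \<omega>))" for j
    by (rule AE_distrD[OF Tm])
  then have "AE \<omega> in M. \<forall>j. h ((T ^^ j) \<omega>) = h (T ((T ^^ j) \<omega>))" by (simp add: AE_all_countable)
  then have inv: "AE \<omega> in M. \<forall>j. h ((T ^^ j) \<omega>) = h \<omega>"
  proof eventually_elim
    case (elim \<omega>)
    show ?case
    proof
      fix j show "h ((T ^^ j) \<omega>) = h \<omega>" by (induction j) (use elim in auto)
    qed
  qed
  have eps: "\<mu> \<le> (\<integral>\<^sup>+\<omega>. h \<omega> \<partial>M) + ennreal e" if e: "e > 0" for e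
  proof -
    \<comment> \<open>Three errors of size e / 3 per unit time: almost optimal blocks, unit steps
      from exceptional points, and unit steps at the end.\<close>
    define \<epsilon> where "\<epsilon> = ennreal (e / 3)"
    have \<epsilon>: "0 < \<epsilon>" "\<epsilon> < \<top>" using e by (auto simp: \<epsilon>_def)
    \<comment> \<open>Points where no block of length at most m comes within \<epsilon> of the lower
      limit. Almost every point leaves B m for large m, so by dominated convergence X 1 has small
      integral over B m.\<close>
    define B where "B m = {\<omega> \<in> space M. \<forall>n\<in>{1..m}. of_nat n * (h \<omega> + \<epsilon>) < X n \<omega>}" for m :: nat
    have [measurable]: "B m \<in> sets M" for m unfolding B_def by measurable
    have "(\<lambda>m. \<integral>\<^sup>+\<omega>. X 1 \<omega> * indicator (B m) \<omega> \<partial>M) \<longlonglongrightarrow> (\<integral>\<^sup>+\<omega>. 0 \<partial>M)"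
    proof (rule nn_integral_dominated_convergence[where w="X 1"])
      show "AE \<omega> in M. (\<lambda>m. X 1 \<omega> * indicator (B m) \<omega>) \<longlonglongrightarrow> 0"
        using upper
      proof eventually_elim
        case (elim \<omega>)
        then have "h \<omega> < \<top>" using \<mu>_fin unfolding h_def by (rule le_less_trans)
        then have lt: "h \<omega> < h \<omega> + \<epsilon>"
          using \<epsilon> ennreal_add_left_cancel_less[of "h \<omega>" 0 \<epsilon>] by simp
        have "\<exists>\<^sub>F n in sequentially. X n \<omega> / of_nat n < h \<omega> + \<epsilon>"
        proof (rule ccontr)
          assume "\<not> ?thesis"
          then have "\<forall>\<^sub>F n in sequentially. h \<omega> + \<epsilon> \<le> X n \<omega> / of_nat n"
            by (simp add: not_frequently not_less)
          from Liminf_bounded[OF this] show False using lt by (simp add: h_def[symmetric])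
        qed
        then have "\<exists>\<^sub>F n in sequentially. X n \<omega> / of_nat n < h \<omega> + \<epsilon> \<and> 0 < n"
          by (rule frequently_eventually_frequently[OF _ eventually_gt_at_top[of 0]])
        then obtain n where n: "0 < n" "X n \<omega> / of_nat n < h \<omega> + \<epsilon>"
          using frequently_ex by blast
        then have "X n \<omega> \<le> of_nat n * (h \<omega> + \<epsilon>)"
          by (subst (asm) divide_less_ennreal) (auto simp: of_nat_less_top mult.commute)
        then have "\<omega> \<notin> B m" if "m \<ge> n" for m
          using n that unfolding B_def by (auto intro!: bexI[of _ n] simp: not_less)
        then have "eventually (\<lambda>m. X 1 \<omega> * indicator (B m) \<omega> = 0) sequentially"
          unfolding eventually_sequentially by (intro exI[of _ n]) (simp add: indicator_def)
        then show ?case by (rule tendsto_eventually)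
      qed
    qed (use fin in \<open>auto simp: indicator_def\<close>)
    then have "eventually (\<lambda>m. (\<integral>\<^sup>+\<omega>. X 1 \<omega> * indicator (B m) \<omega> \<partial>M) < \<epsilon>) sequentially"
      using \<epsilon> by (intro order_tendstoD(2)) auto
    then obtain m where m: "(\<integral>\<^sup>+\<omega>. X 1 \<omega> * indicator (B m) \<omega> \<partial>M) < \<epsilon>"
      using eventually_happens by force
    define \<phi> where "\<phi> \<omega> = X 1 \<omega> * indicator (B m) \<omega>" for \<omega>
    have \<phi> [measurable]: "\<phi> \<in> borel_measurable M" unfolding \<phi>_def by measurable
    let ?I = "\<integral>\<^sup>+\<omega>. X 1 \<omega> \<partial>M"
    obtain i where i: "?I = ennreal i" "0 \<le> i" using fin by (cases ?I) auto
    \<comment> \<open>The final window has at most m unit steps of mean i; K is taken so large that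
      m i \<le> K e / 3.\<close>
    obtain K :: nat where K: "real m * i / (e / 3) < real K" "0 < K"
    proof -
      obtain K where K: "real m * i / (e / 3) < real K" using reals_Archimedean2 by blast
      have "0 \<le> real m * i / (e / 3)" using i e by simp
      then have "0 < K" using K by (cases K) auto
      then show ?thesis using that K by blast
    qed
    have mK: "of_nat m * ?I \<le> of_nat K * \<epsilon>"
    proof -
      have "real m * i \<le> real K * (e / 3)" using K e by (simp add: field_simps)
      then show ?thesis unfolding i \<epsilon>_def using i e
        by (simp add: ennreal_of_nat_eq_real_of_nat ennreal_mult[symmetric] ennreal_leI)
    qed
    have "AE \<omega> in M. X K \<omega> \<le> of_nat K * (h \<omega> + \<epsilon>) + (\<Sum>j<K. \<phi> ((T ^^ j) \<omega>))
       + (\<Sum>j\<in>{K - m..<K}. X 1 ((T ^^ j) \<omega>))"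
      using inv AE_space
    proof eventually_elim
      case (elim \<omega>)
      \<comment> \<open>The covering lemma is stated for all points, so the complement of the space
        is added to the exceptional set. The orbit of a point of the space never meets it, and there
        \<psi> agrees with \<phi>.\<close>
      define \<psi> where "\<psi> \<omega> = X 1 \<omega> * indicator (B m \<union> - space M) \<omega>" for \<omega>
      have sp: "(T ^^ j) \<omega> \<in> space M" for j using measurable_space[OF Tm elim(2)] .
      have "X K \<omega> \<le> of_nat K * (h \<omega> + \<epsilon>) + (\<Sum>j<K. \<psi> ((T ^^ j) \<omega>))
       + (\<Sum>j\<in>{K - m..<K}. X 1 ((T ^^ j) \<omega>))"
      proof (rule subadditive_covering[where v="\<lambda>\<omega>. h \<omega> + \<epsilon>" and X=X and T=T and B="B m \<union> - space M", OF sub X0])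
        fix \<omega> assume "\<omega> \<in> B m \<union> - space M"
        then show "X 1 \<omega> \<le> \<psi> \<omega>" by (auto simp: \<psi>_def)
      next
        fix \<omega> assume "\<omega> \<notin> B m \<union> - space M"
        then show "\<exists>n. 1 \<le> n \<and> n \<le> m \<and> X n \<omega> \<le> of_nat n * (h \<omega> + \<epsilon>)" by (auto simp: B_def not_less)
      qed (use elim in simp)
      also have "(\<Sum>j<K. \<psi> ((T ^^ j) \<omega>))
        = (\<Sum>j<K. \<phi> ((T ^^ j) \<omega>))"
        using sp by (intro sum.cong refl) (auto simp: \<psi>_def \<phi>_def indicator_def)
      finally show ?case .
    qed
    then have "(\<integral>\<^sup>+\<omega>. X K \<omega> \<partial>M) \<le> (\<integral>\<^sup>+\<omega>. of_nat K * (h \<omega> + \<epsilon>) + (\<Sum>j<K. \<phi> ((T ^^ j) \<omega>))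
       + (\<Sum>j\<in>{K - m..<K}. X 1 ((T ^^ j) \<omega>)) \<partial>M)"
      by (rule nn_integral_mono_AE)
    also have "\<dots> = of_nat K * ((\<integral>\<^sup>+\<omega>. h \<omega> \<partial>M) + \<epsilon>)
       + (\<Sum>j<K. \<integral>\<^sup>+\<omega>. \<phi> ((T ^^ j) \<omega>) \<partial>M)
       + (\<Sum>j\<in>{K - m..<K}. \<integral>\<^sup>+\<omega>. X 1 ((T ^^ j) \<omega>) \<partial>M)"
      by (simp add: nn_integral_add nn_integral_cmult nn_integral_sum emeasure_space_1)
    also have "(\<Sum>j<K. \<integral>\<^sup>+\<omega>. \<phi> ((T ^^ j) \<omega>) \<partial>M)
       = of_nat K * (\<integral>\<^sup>+\<omega>. \<phi> \<omega> \<partial>M)"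
      using pres[OF \<phi>] by simp
    also have "(\<Sum>j\<in>{K - m..<K}. \<integral>\<^sup>+\<omega>. X 1 ((T ^^ j) \<omega>) \<partial>M) = of_nat (K - (K - m)) * ?I"
      using pres[of "X 1"] by simp
    also have "\<dots> \<le> of_nat m * ?I" by (intro mult_right_mono) auto
    also have "\<dots> \<le> of_nat K * \<epsilon>" by (rule mK)
    also have "of_nat K * (\<integral>\<^sup>+\<omega>. \<phi> \<omega> \<partial>M) \<le> of_nat K * \<epsilon>"
      using m unfolding \<phi>_def by (intro mult_left_mono) auto
    finally have "(\<integral>\<^sup>+\<omega>. X K \<omega> \<partial>M) \<le> of_nat K * ((\<integral>\<^sup>+\<omega>. h \<omega> \<partial>M) + \<epsilon>) + of_nat K * \<epsilon> + of_nat K * \<epsilon>"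
      by (simp add: add_left_mono add_right_mono add_mono)
    then have "of_nat K * \<mu> \<le> of_nat K * ((\<integral>\<^sup>+\<omega>. h \<omega> \<partial>M) + (\<epsilon> + \<epsilon> + \<epsilon>))"
      using \<mu>[of K] by (simp add: distrib_left add.assoc)
    then have "\<mu> \<le> (\<integral>\<^sup>+\<omega>. h \<omega> \<partial>M) + (\<epsilon> + \<epsilon> + \<epsilon>)"
      using K(2) by (subst (asm) ennreal_mult_le_mult_iff) (auto simp: of_nat_less_top less_top[symmetric])
    also have "\<epsilon> + \<epsilon> + \<epsilon> = ennreal e" unfolding \<epsilon>_def using e by (simp flip: ennreal_plus)
    finally show ?thesis .
  qed
  have "\<mu> \<le> (\<integral>\<^sup>+\<omega>. h \<omega> \<partial>M)" by (rule ennreal_le_epsilon) (rule eps)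
  then have "AE \<omega> in M. h \<omega> = \<mu>"
  proof (intro AE_eq_of_integral_le)
    show "AE \<omega> in M. h \<omega> \<le> \<mu>" using upper by (simp add: h_def)
    show "(\<integral>\<^sup>+\<omega>. h \<omega> \<partial>M) < \<infinity>" using int_h \<mu>_fin by (simp add: le_less_trans)
  qed (simp_all add: emeasure_space_1)
  then show ?thesis unfolding h_def .
qed

end

subsection \<open>Typical environments\<close>

context fpp
begin

text \<open>Asymptotic cost per copy of the pair (m, x), that is per m steps; the cost per step is
  obtained later by dividing by m.\<close>

definition rate :: "nat \<Rightarrow> int^'d \<Rightarrow> ennreal" where
  "rate m x = (INF j\<in>{1..}. (\<integral>\<^sup>+\<omega>. leg (j * m) (int j *s x) 0 \<omega> \<partial>P) / of_nat j)"

text \<open>All probability is collected in this condition and the next. Later arguments fix one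
  environment satisfying them, so uncountably many sequences and directions cause no further null
  sets.\<close>

definition goodU :: "((int^'d) set \<Rightarrow> real) \<Rightarrow> bool" where
  "goodU \<omega> \<longleftrightarrow> (\<forall>m x C a. finite_moment m x \<longrightarrow> x \<noteq> 0 \<longrightarrow> (\<integral>\<^sup>+\<omega>. leg m x 0 \<omega> \<partial>P) < ennreal a \<longrightarrow>
     eventually (\<lambda>n. \<forall>z. l1norm z \<le> int C * int n \<longrightarrow>
       (\<Sum>i<n. leg m x (z + int i *s x) \<omega>) \<le> ennreal (real n * a)) sequentially)"

text \<open>Lower bounds are required only from the origin and along multiples of one vector; the
  uniform upper bounds transfer them to other endpoints.\<close>

definition goodL :: "((int^'d) set \<Rightarrow> real) \<Rightarrow> bool" where
  "goodL \<omega> \<longleftrightarrow> (\<forall>m x. finite_moment m x \<longrightarrow> x \<noteq> 0 \<longrightarrow>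
     liminf (\<lambda>n. pt (n * m) 0 (int n *s x) \<omega> / of_nat n) = rate m x)"

lemma leg_sum_bound: "pt (n * m) z (z + int n *s x) \<omega> \<le> (\<Sum>i<n. leg m x (z + int i *s x) \<omega>)"
proof -
  have eq: "z + int i *s x + x = z + int (Suc i) *s x" for i by (simp add: vec_eq_iff algebra_simps)
  show ?thesis unfolding leg_def eq by (rule ptime_sum[OF S_fin])
qed

text \<open>The real threshold a is replaced by a rational between the mean and a, so that countably
  many events suffice.\<close>

lemma AE_goodU: "AE \<omega> in P. goodU \<omega>"
proof -
  have "AE \<omega> in P. \<forall>m x C. \<forall>q::rat. finite_moment m x \<longrightarrow> x \<noteq> 0 \<longrightarrow> (\<integral>\<^sup>+\<omega>. leg m x 0 \<omega> \<partial>P) < ennreal (of_rat q) \<longrightarrow>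
     eventually (\<lambda>n. \<forall>z. l1norm z \<le> int C * int n \<longrightarrow>
       (\<Sum>i<n. leg m x (z + int i *s x) \<omega>) \<le> ennreal (real n * of_rat q)) sequentially"
    unfolding AE_all_countable using AE_line_sums_le by (intro allI AE_impI) auto
  then show ?thesis
  proof eventually_elim
    case (elim \<omega>)
    show ?case unfolding goodU_def
    proof (intro allI impI)
      fix m x C a assume *: "finite_moment m x" "x \<noteq> 0" "(\<integral>\<^sup>+\<omega>. leg m x 0 \<omega> \<partial>P) < ennreal a"
      then obtain i where i: "(\<integral>\<^sup>+\<omega>. leg m x 0 \<omega> \<partial>P) = ennreal i" "0 \<le> i"
        by (cases "\<integral>\<^sup>+\<omega>. leg m x 0 \<omega> \<partial>P") auto
      then have "i < a" using *(3) by (simp add: ennreal_less_iff)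
      then obtain q where q: "i < of_rat q" "of_rat q < a" using of_rat_dense by blast
      have "eventually (\<lambda>n. \<forall>z. l1norm z \<le> int C * int n \<longrightarrow>
       (\<Sum>i<n. leg m x (z + int i *s x) \<omega>) \<le> ennreal (real n * of_rat q)) sequentially"
        using elim * i q by (auto simp: ennreal_less_iff)
      then show "eventually (\<lambda>n. \<forall>z. l1norm z \<le> int C * int n \<longrightarrow>
       (\<Sum>i<n. leg m x (z + int i *s x) \<omega>) \<le> ennreal (real n * a)) sequentially"
      proof eventually_elim
        case (elim n)
        have "ennreal (real n * of_rat q) \<le> ennreal (real n * a)"
          using q by (intro ennreal_leI mult_left_mono) auto
        then show ?case using elim order_trans by blast
      qed
    qed
  qed
qed

lemma finite_moment_mult:
  assumes "finite_moment m x" "1 \<le> j"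
  shows "finite_moment (j * m) (int j *s x)"
  using assms(2)
proof (induction j rule: nat_induct_at_least)
  case (Suc n)
  have "finite_moment (m + n * m) (x + int n *s x)" using assms(1) Suc by (intro finite_moment_add)
  moreover have "x + int n *s x = int (Suc n) *s x" by (simp add: vec_eq_iff algebra_simps)
  ultimately show ?case by (simp only: mult_Suc)
qed (use assms in simp)

lemma leg_0: "leg m x 0 = pt m 0 x"
  by (simp add: fun_eq_iff leg_def)

lemma rate_less_top: "finite_moment m x \<Longrightarrow> rate m x < \<top>"
proof -
  assume fm: "finite_moment m x"
  have "rate m x \<le> (\<integral>\<^sup>+\<omega>. leg (1 * m) (int 1 *s x) 0 \<omega> \<partial>P) / of_nat 1"
    unfolding rate_def by (rule INF_lower) simp
  also have "\<dots> < \<top>" using finite_moment_less_top[OF fm, of 1] dim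
    by (simp add: leg_0 divide_ennreal_def)
  finally show ?thesis .
qed

text \<open>Some j almost attains the infimum defining the rate, and j copies of (m, x) are then
  used as a single leg.\<close>

lemma rate_upper:
  assumes "finite_moment m x" "x \<noteq> 0" "rate m x < ennreal a"
  obtains j where "1 \<le> j" "\<And>\<omega> C. goodU \<omega> \<Longrightarrow> eventually (\<lambda>n. \<forall>z. l1norm z \<le> int C * int n \<longrightarrow>
     pt (n * (j * m)) z (z + int (n * j) *s x) \<omega> \<le> ennreal (real (n * j) * a)) sequentially"
proof -
  obtain j where j: "1 \<le> j" "(\<integral>\<^sup>+\<omega>. leg (j * m) (int j *s x) 0 \<omega> \<partial>P) / of_nat j < ennreal a"
    using assms(3) unfolding rate_def INF_less_iff by auto
  then have lt: "(\<integral>\<^sup>+\<omega>. leg (j * m) (int j *s x) 0 \<omega> \<partial>P) < ennreal (real j * a)"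
    by (subst (asm) divide_less_ennreal)
       (auto simp: of_nat_less_top ennreal_of_nat_eq_real_of_nat ennreal_mult'' mult.commute)
  have nz: "int j *s x \<noteq> 0" using j(1) assms(2) by (simp add: vec_eq_iff)
  have "eventually (\<lambda>n. \<forall>z. l1norm z \<le> int C * int n \<longrightarrow>
     pt (n * (j * m)) z (z + int (n * j) *s x) \<omega> \<le> ennreal (real (n * j) * a)) sequentially" if "goodU \<omega>" for \<omega> C
  proof -
    have "eventually (\<lambda>n. \<forall>z. l1norm z \<le> int C * int n \<longrightarrow>
       (\<Sum>i<n. leg (j * m) (int j *s x) (z + int i *s (int j *s x)) \<omega>) \<le> ennreal (real n * (real j * a))) sequentially"
      using that finite_moment_mult[OF assms(1) j(1)] nz lt unfolding goodU_def by blast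
    then show ?thesis
    proof eventually_elim
      case (elim n)
      have "pt (n * (j * m)) z (z + int (n * j) *s x) \<omega> \<le> ennreal (real (n * j) * a)"
        if "l1norm z \<le> int C * int n" for z
      proof -
        have "int (n * j) *s x = int n *s (int j *s x)" by (simp add: vec_eq_iff algebra_simps)
        then show ?thesis using leg_sum_bound[of \<omega> n "j * m" z "int j *s x"] elim that order_trans
          by (fastforce simp: mult.assoc)
      qed
      then show ?case by blast
    qed
  qed
  then show ?thesis using that j(1) by blast
qed

lemma pt_funpow_translate:
  "pt n y z ((translate x ^^ k) \<omega>) = pt n (y + int k *s x) (z + int k *s x) \<omega>"
proof (induction k arbitrary: y z)
  case (Suc k)
  have "y + x + int k *s x = y + int (Suc k) *s x" for y by (simp add: vec_eq_iff algebra_simps)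
  then show ?case using Suc[of "y + x" "z + x"] by (simp only: funpow.simps comp_apply pt_shift[symmetric])
qed simp

text \<open>The shift is translation by x. The upper bound that the subadditive lemma asks for comes
  from \<open>goodU\<close>.\<close>

lemma AE_goodL: "AE \<omega> in P. goodL \<omega>"
proof -
  have "AE \<omega> in P. liminf (\<lambda>n. pt (n * m) 0 (int n *s x) \<omega> / of_nat n) = rate m x"
    if fm: "finite_moment m x" and x: "x \<noteq> 0" for m x
  proof (rule P.subadditive_liminf_eq[OF translate_measurable[of x] distr_translate])
    fix k n \<omega>
    have "pt ((k + n) * m) 0 (int (k + n) *s x) \<omega> \<le> pt (k * m) 0 (int k *s x) \<omega> + pt (n * m) (int k *s x) (int (k + n) *s x) \<omega>"
      unfolding add_mult_distrib by (rule pt_add)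
    moreover have "int n *s x + int k *s x = int (k + n) *s x" by (simp add: vec_eq_iff algebra_simps)
    ultimately show "pt ((k + n) * m) 0 (int (k + n) *s x) \<omega>
       \<le> pt (k * m) 0 (int k *s x) \<omega> + pt (n * m) 0 (int n *s x) ((translate x ^^ k) \<omega>)"
      by (simp only: pt_funpow_translate add_0_left)
  next
    show "(\<integral>\<^sup>+\<omega>. pt (1 * m) 0 (int 1 *s x) \<omega> \<partial>P) < \<infinity>"
      using finite_moment_less_top[OF fm, of 1] dim by simp
  next
    fix n :: nat
    show "of_nat n * rate m x \<le> (\<integral>\<^sup>+\<omega>. pt (n * m) 0 (int n *s x) \<omega> \<partial>P)"
    proof (cases "n = 0")
      case False
      let ?I = "\<integral>\<^sup>+\<omega>. pt (n * m) 0 (int n *s x) \<omega> \<partial>P"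
      have "rate m x \<le> ?I / of_nat n"
        unfolding rate_def using False by (intro INF_lower2[of n]) (auto simp: leg_0)
      then have "of_nat n * rate m x \<le> of_nat n * (?I / of_nat n)" by (intro mult_left_mono) auto
      also have "\<dots> = ?I * of_nat n / of_nat n" by (simp add: ennreal_times_divide mult.commute)
      also have "\<dots> = ?I" using False by (intro mult_divide_eq_ennreal) auto
      finally show ?thesis .
    qed simp
  next
    show "AE \<omega> in P. liminf (\<lambda>n. pt (n * m) 0 (int n *s x) \<omega> / of_nat n) \<le> rate m x"
      using AE_goodU
    proof eventually_elim
      case (elim \<omega>)
      show ?case
      proof (rule dense_ge)
        fix y assume y: "rate m x < y"
        show "liminf (\<lambda>n. pt (n * m) 0 (int n *s x) \<omega> / of_nat n) \<le> y"
        proof (cases y)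
          case (real a)
          then have ya: "y = ennreal a" by simp
          obtain j where j: "1 \<le> j" and *: "\<And>\<omega> C. goodU \<omega> \<Longrightarrow> eventually (\<lambda>n. \<forall>z. l1norm z \<le> int C * int n \<longrightarrow>
             pt (n * (j * m)) z (z + int (n * j) *s x) \<omega> \<le> ennreal (real (n * j) * a)) sequentially"
            by (rule rate_upper[OF fm x y[unfolded ya]]) (erule that, assumption)
          show ?thesis
          proof (rule ccontr)
            assume "\<not> ?thesis"
            then have "y < liminf (\<lambda>n. pt (n * m) 0 (int n *s x) \<omega> / of_nat n)" by simp
            from less_LiminfD[OF this]
            have ev: "\<forall>\<^sub>F n in sequentially. y < pt (n * m) 0 (int n *s x) \<omega> / of_nat n" .
            \<comment> \<open>The upper bound is available only at multiples of j; this is enough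
              for a lower limit, since one large multiple contradicts an eventual strict lower
              bound.\<close>
            have "filterlim (\<lambda>n. n * j) at_top sequentially"
              using j by (intro filterlim_subseq) (auto simp: strict_mono_def)
            from eventually_happens'[OF sequentially_bot eventually_conj[OF eventually_compose_filterlim[OF ev this]
                eventually_conj[OF *[OF elim, of 0] eventually_gt_at_top[of 0]]]]
            obtain n where n: "y < pt (n * j * m) 0 (int (n * j) *s x) \<omega> / of_nat (n * j)" "0 < n"
              and all: "\<forall>z. l1norm z \<le> int 0 * int n \<longrightarrow>
                pt (n * (j * m)) z (z + int (n * j) *s x) \<omega> \<le> ennreal (real (n * j) * a)" by blast
            have n3: "pt (n * (j * m)) 0 (0 + int (n * j) *s x) \<omega> \<le> ennreal (real (n * j) * a)"
              by (rule all[rule_format]) simp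
            have "pt (n * j * m) 0 (int (n * j) *s x) \<omega> / of_nat (n * j) \<le> y"
            proof (rule divide_le_posI_ennreal)
              show "0 < (of_nat (n * j) :: ennreal)" using n(2) j
                by (simp add: ennreal_of_nat_eq_real_of_nat del: of_nat_mult)
              show "pt (n * j * m) 0 (int (n * j) *s x) \<omega> \<le> of_nat (n * j) * y"
              proof -
                have "of_nat (n * j) * y = ennreal (real (n * j) * a)"
                  unfolding ya by (simp only: ennreal_of_nat_eq_real_of_nat ennreal_mult'[OF of_nat_0_le_iff])
                then show ?thesis using n3 by (simp only: mult.assoc add_0_left)
              qed
            qed
            then show False using n(1) by simp
          qed
        qed simp
      qed
    qed
  qed simp_all
  then have "AE \<omega> in P. \<forall>m x. finite_moment m x \<longrightarrow> x \<noteq> 0 \<longrightarrow>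
     liminf (\<lambda>n. pt (n * m) 0 (int n *s x) \<omega> / of_nat n) = rate m x"
    unfolding AE_all_countable by (intro allI AE_impI) auto
  then show ?thesis by (simp add: goodL_def)
qed

lemma rate_lower:
  assumes "goodL \<omega>" "finite_moment m x" "x \<noteq> 0" "ennreal a < rate m x" "0 \<le> a"
  shows "eventually (\<lambda>n. ennreal (real n * a) \<le> pt (n * m) 0 (int n *s x) \<omega>) sequentially"
proof -
  have "ennreal a < liminf (\<lambda>n. pt (n * m) 0 (int n *s x) \<omega> / of_nat n)"
    using assms by (simp add: goodL_def)
  from less_LiminfD[OF this] show ?thesis
    using eventually_gt_at_top[of 0]
  proof eventually_elim
    case (elim n)
    show ?case
    proof (rule ccontr)
      assume "\<not> ?thesis"
      then have "pt (n * m) 0 (int n *s x) \<omega> \<le> ennreal a * of_nat n"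
        using assms(5) by (simp add: ennreal_of_nat_eq_real_of_nat ennreal_mult mult.commute)
      then have "pt (n * m) 0 (int n *s x) \<omega> / of_nat n \<le> ennreal a"
        using elim(2) by (intro divide_le_posI_ennreal) (auto simp: ennreal_of_nat_eq_real_of_nat mult.commute)
      then show False using elim(1) by simp
    qed
  qed
qed

end

subsection \<open>A crude bound in every cone strictly inside the reachable cone\<close>

text \<open>Unlike the norm, the sum of the coordinates is additive, which makes parity easy to
  follow along walks.\<close>

lemma even_l1norm: "even (l1norm (v :: int^'d)) \<longleftrightarrow> even (\<Sum>i\<in>UNIV. v $ i)"
proof -
  have "even (\<Sum>i\<in>I. \<bar>v $ i\<bar>) \<longleftrightarrow> even (\<Sum>i\<in>I. v $ i)" if "finite I" for I
    using that by (induction I) auto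
  then show ?thesis by (simp add: l1norm_def)
qed

context fpp
begin

text \<open>An edge step changes the parity of the coordinate sum, a zero step does not; hence
  parity constrains only \<open>steps\<close>.\<close>

definition parity_ok :: "nat \<Rightarrow> int^'d \<Rightarrow> bool" where
  "parity_ok l v \<longleftrightarrow> S = steps0 \<or> even (int l + (\<Sum>i\<in>UNIV. v $ i))"

text \<open>A run of n \<le> l legs is bounded by the run of l legs, since legs are nonnegative.
  This includes runs too short for the asymptotic bound itself.\<close>

lemma run_bounds:
  assumes F: "finite F" "\<And>m x. (m, x) \<in> F \<Longrightarrow> finite_moment m x \<and> x \<noteq> 0"
  obtains a where "a \<ge> 0" "\<And>\<omega> C. goodU \<omega> \<Longrightarrow> eventually (\<lambda>l. \<forall>(m, x)\<in>F. \<forall>z n. l1norm z \<le> int C * int l \<longrightarrow>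
     n \<le> l \<longrightarrow> pt (n * m) z (z + int n *s x) \<omega> \<le> ennreal (a * real l)) sequentially"
proof -
  \<comment> \<open>One is added to the mean because \<open>goodU\<close> asks for a strict
    inequality.\<close>
  define b where "b = (\<lambda>(m, x). enn2real (\<integral>\<^sup>+\<omega>. leg m x 0 \<omega> \<partial>P) + 1)"
  define a where "a = (\<Sum>f\<in>F. b f)"
  have b0: "0 \<le> b f" for f by (auto simp: b_def split: prod.split)
  have ba: "b f \<le> a" if "f \<in> F" for f unfolding a_def using that b0 F(1) by (intro member_le_sum) auto
  have "eventually (\<lambda>l. \<forall>(m, x)\<in>F. \<forall>z n. l1norm z \<le> int C * int l \<longrightarrow>
     n \<le> l \<longrightarrow> pt (n * m) z (z + int n *s x) \<omega> \<le> ennreal (a * real l)) sequentially" if good: "goodU \<omega>" for \<omega> C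
  proof (rule eventually_ball_finite[OF F(1)], safe)
    fix m x assume f: "(m, x) \<in> F"
    have "(\<integral>\<^sup>+\<omega>. leg m x 0 \<omega> \<partial>P) < \<top>"
      using finite_moment_less_top[of m x 1] F(2)[OF f] dim by (simp add: leg_0)
    then have "(\<integral>\<^sup>+\<omega>. leg m x 0 \<omega> \<partial>P) < ennreal (b (m, x))"
      by (cases "\<integral>\<^sup>+\<omega>. leg m x 0 \<omega> \<partial>P") (auto simp: b_def ennreal_less_iff)
    then have "eventually (\<lambda>l. \<forall>z. l1norm z \<le> int C * int l \<longrightarrow>
       (\<Sum>i<l. leg m x (z + int i *s x) \<omega>) \<le> ennreal (real l * b (m, x))) sequentially"
      using good F(2)[OF f] unfolding goodU_def by blast
    then show "eventually (\<lambda>l. \<forall>z n. l1norm z \<le> int C * int l \<longrightarrow>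
       n \<le> l \<longrightarrow> pt (n * m) z (z + int n *s x) \<omega> \<le> ennreal (a * real l)) sequentially"
    proof eventually_elim
      case (elim l)
      show ?case
      proof (intro allI impI)
        fix z :: "int^'d" and n assume z: "l1norm z \<le> int C * int l" "n \<le> l"
        have "pt (n * m) z (z + int n *s x) \<omega> \<le> (\<Sum>i<n. leg m x (z + int i *s x) \<omega>)" by (rule leg_sum_bound)
        also have "\<dots> \<le> (\<Sum>i<l. leg m x (z + int i *s x) \<omega>)" using z by (intro sum_mono2) auto
        also have "\<dots> \<le> ennreal (real l * b (m, x))" using elim z by blast
        also have "\<dots> \<le> ennreal (a * real l)"
          using mult_right_mono[OF ba[OF f], of "real l"] by (intro ennreal_leI) (simp add: mult.commute)
        finally show "pt (n * m) z (z + int n *s x) \<omega> \<le> ennreal (a * real l)" .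
      qed
    qed
  qed
  moreover have "a \<ge> 0" unfolding a_def using b0 by (intro sum_nonneg) auto
  ultimately show ?thesis using that by blast
qed

lemma pt_add_le:
  assumes "pt m x y \<omega> \<le> ennreal a" "pt n y z \<omega> \<le> ennreal b" "0 \<le> a" "0 \<le> b"
  shows "pt (m + n) x z \<omega> \<le> ennreal (a + b)"
  using order_trans[OF pt_add add_mono[OF assms(1,2)]] assms(3,4) by simp

text \<open>A leg of length \<open>L\<close> along an axis takes \<open>L + 18\<close> steps, see \<open>finite_moment_axis\<close>.\<close>

definition run_time :: "nat \<Rightarrow> nat \<Rightarrow> nat" where
  "run_time L n = n div L * (L + 18) + n mod L * 19"

text \<open>A long leg adds 18 steps to L, so the overhead factor 1 + 18 / L is close to 1; the unit
  legs of the remainder cost only a constant. All overheads are even.\<close>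

lemma run_time_bounds:
  assumes "L \<ge> 1"
  shows "real (run_time L n) \<le> (1 + 18 / real L) * real n + 18 * real L" "even (run_time L n + n)"
proof -
  define A where "A = n div L"
  define r where "r = n mod L"
  have n: "n = L * A + r" unfolding A_def r_def by simp
  have r: "r \<le> L" unfolding r_def using assms by (simp add: less_imp_le)
  have t: "run_time L n = A * (L + 18) + r * 19" by (simp add: run_time_def A_def r_def)
  have "(1 + 18 / real L) * real n = real L * real A + real r + 18 * real A + 18 * real r / real L"
    using assms unfolding n by (simp add: field_simps)
  moreover have "0 \<le> 18 * real r / real L" by simp
  moreover have "real (run_time L n) = real L * real A + 18 * real A + 19 * real r"
    unfolding t by (simp add: algebra_simps)
  ultimately show "real (run_time L n) \<le> (1 + 18 / real L) * real n + 18 * real L" using r by linarith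
  show "even (run_time L n + n)" unfolding t unfolding n by (simp add: algebra_simps) 
qed

text \<open>Travel to z + v axis by axis, then use up the remaining time there. Pacing one edge for
  the rest would cost l times its weight, with no bound uniform in z; instead a walk goes out along
  an axis and returns, and both runs are controlled by \<open>goodU\<close>.\<close>

lemma cone_bound:
  assumes \<rho>: "0 \<le> \<rho>" "\<rho> < 1"
  obtains K where "K \<ge> 0" "\<And>\<omega> C. goodU \<omega> \<Longrightarrow> eventually (\<lambda>l. \<forall>z v. l1norm z \<le> int C * int l \<longrightarrow>
     real_of_int (l1norm v) \<le> \<rho> * real l \<longrightarrow> parity_ok l v \<longrightarrow> pt l z (z + v) \<omega> \<le> ennreal (K * real l)) sequentially"
proof -
  let ?d = "CARD('d)"
  obtain L :: nat where L0: "18 / (1 - \<rho>) < real L" using reals_Archimedean2 by blast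
  have "0 < 18 / (1 - \<rho>)" using \<rho> by simp
  then have "0 < real L" using L0 by linarith
  then have L: "L \<ge> 1" "18 < (1 - \<rho>) * real L" using L0 \<rho> by (auto simp: field_simps)
  \<comment> \<open>Fraction of the available time spent on travelling, overhead included; L was
    chosen to keep it below 1.\<close>
  define \<rho>' where "\<rho>' = (1 + 18 / real L) * \<rho>"
  have "\<rho>' = \<rho> + 18 / real L * \<rho>" by (simp add: \<rho>'_def algebra_simps)
  also have "\<dots> \<le> \<rho> + 18 / real L" using \<rho> by (intro add_left_mono mult_left_le) auto
  also have "\<dots> < 1" using L by (simp add: field_simps)
  finally have \<rho>': "\<rho>' < 1" .
  define i0 :: 'd where "i0 = undefined"
  let ?sg = "{1, -1} :: int set"
  \<comment> \<open>All legs ever needed: length L in L + 18 steps, and unit legs in 19 + 2u steps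
    with u < 19. Finiteness of F gives one common constant a.\<close>
  define F where "F = (\<lambda>(i, s). (L + 18, axis i (s * int L) :: int^'d)) ` (UNIV \<times> ?sg)
     \<union> (\<lambda>(u, i, s). (19 + 2 * u, axis i s)) ` ({..<19} \<times> UNIV \<times> ?sg)"
  have F_long: "(L + 18, axis i (s * int L)) \<in> F" if "s \<in> ?sg" for i s
    unfolding F_def using that by (intro UnI1 image_eqI[where x="(i, s)"]) auto
  have F_unit: "(19 + 2 * u, axis i s) \<in> F" if "s \<in> ?sg" "u < 19" for i s u
    unfolding F_def using that by (intro UnI2 image_eqI[where x="(u, i, s)"]) auto
  have Ffin: "finite F" unfolding F_def by simp
  have Ffm: "finite_moment m x \<and> x \<noteq> 0" if "(m, x) \<in> F" for m x
  proof -
    consider i s where "s \<in> ?sg" "m = L + 18" "x = axis i (s * int L)"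
      | u i s where "s \<in> ?sg" "m = 19 + 2 * u" "x = axis i s"
      using \<open>(m, x) \<in> F\<close> unfolding F_def
      by (elim UnE imageE SigmaE; simp only: prod.case prod.inject; blast)
    then show ?thesis
    proof cases
      case 1
      have "finite_moment (nat \<bar>s * int L\<bar> + 18 + 2 * 0) (axis i (s * int L))" by (rule finite_moment_axis)
      moreover have "nat \<bar>s * int L\<bar> = L" using 1(1) by auto
      ultimately show ?thesis using 1 L by (auto simp: axis_eq_0_iff)
    next
      case 2
      have "finite_moment (nat \<bar>s\<bar> + 18 + 2 * u) (axis i s)" by (rule finite_moment_axis)
      moreover have "nat \<bar>s\<bar> = 1" using 2(1) by auto
      ultimately show ?thesis using 2 by (auto simp: axis_eq_0_iff)
    qed
  qed
  obtain a where a: "a \<ge> 0" and run: "\<And>\<omega> C. goodU \<omega> \<Longrightarrow> eventually (\<lambda>l. \<forall>(m, x)\<in>F. \<forall>z n. l1norm z \<le> int C * int l \<longrightarrow>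
     n \<le> l \<longrightarrow> pt (n * m) z (z + int n *s x) \<omega> \<le> ennreal (a * real l)) sequentially"
    by (rule run_bounds[OF Ffin Ffm]) (assumption, erule that, assumption)
  \<comment> \<open>Two runs per coordinate (long and unit legs), three runs for the waiting time,
    and possibly one zero step of weight -c.\<close>
  define K where "K = 2 * a * real ?d + 3 * a + \<bar>c\<bar>"
  have "eventually (\<lambda>l. \<forall>z v. l1norm z \<le> int C * int l \<longrightarrow>
     real_of_int (l1norm v) \<le> \<rho> * real l \<longrightarrow> parity_ok l v \<longrightarrow> pt l z (z + v) \<omega> \<le> ennreal (K * real l)) sequentially"
    if good: "goodU \<omega>" for \<omega> C
  proof -
    \<comment> \<open>Leaves at least 80 spare steps after travelling; 39 would do to make q \<ge> 1
      below.\<close>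
    have "eventually (\<lambda>l. (80 + 18 * real L * real ?d) / (1 - \<rho>') \<le> real l) sequentially"
      using filterlim_real_sequentially unfolding filterlim_at_top by blast
    with run[OF good, of "C + 2"] eventually_gt_at_top[of 0]
    show ?thesis
    proof eventually_elim
      case (elim l)
      have R: "pt (n * m) z (z + int n *s x) \<omega> \<le> ennreal (a * real l)"
        if "(m, x) \<in> F" "l1norm z \<le> int C * int l + 2 * int l" "n \<le> l" for m x z n
        using elim(1) that by (fastforce simp: distrib_right)
      show ?case
      proof (intro allI impI)
        fix z v :: "int^'d"
        assume z: "l1norm z \<le> int C * int l" and v: "real_of_int (l1norm v) \<le> \<rho> * real l" and ok: "parity_ok l v"
        have "\<rho> * real l \<le> real l" using \<rho> by (simp add: mult_left_le_one_le)
        then have vl: "l1norm v \<le> int l" using v by linarith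
        have vi: "nat \<bar>v $ i\<bar> \<le> l" for i using abs_nth_le_l1norm[of v i] vl by linarith
        let ?T = "\<lambda>i. run_time L (nat \<bar>v $ i\<bar>)"
        have travel: "pt (\<Sum>i\<in>I. ?T i) z (z + (\<Sum>i\<in>I. axis i (v $ i))) \<omega> \<le> ennreal (2 * a * real (card I) * real l)"
          if "finite I" for I
          using that
        proof induction
          case (insert i I)
          let ?y = "z + (\<Sum>i\<in>I. axis i (v $ i))"
          define s :: int where "s = (if 0 \<le> v $ i then 1 else -1)"
          define n where "n = nat \<bar>v $ i\<bar>"
          have n: "n \<le> l" "s * int n = v $ i" using vi[of i] by (auto simp: n_def s_def)
          have "l1norm (\<Sum>i\<in>I. axis i (v $ i)) \<le> (\<Sum>i\<in>I. \<bar>v $ i\<bar>)"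
            using insert(1)
          proof induction
            case (insert i I)
            then show ?case using l1norm_triangle[of "axis i (v $ i)" "\<Sum>i\<in>I. axis i (v $ i)"] by simp
          qed simp
          also have "\<dots> \<le> l1norm v" unfolding l1norm_def by (rule sum_mono2) auto
          finally have y: "l1norm ?y \<le> int C * int l + int l"
            using l1norm_triangle[of z "\<Sum>i\<in>I. axis i (v $ i)"] z vl by linarith
          let ?y' = "?y + int (n div L) *s axis i (s * int L)"
          have "l1norm (int (n div L) *s (axis i (s * int L) :: int^'d)) = int (n div L * L)"
            by (simp add: l1norm_scale s_def abs_mult)
          also have "\<dots> \<le> int l" using n(1) div_times_less_eq_dividend[of n L] by linarith
          finally have y': "l1norm ?y' \<le> int C * int l + 2 * int l"
            using l1norm_triangle[of ?y "int (n div L) *s axis i (s * int L)"] y by linarith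
          have 1: "pt (n div L * (L + 18)) ?y ?y' \<omega> \<le> ennreal (a * real l)"
          proof (rule R)
            show "(L + 18, axis i (s * int L)) \<in> F" by (rule F_long) (simp add: s_def)
            show "n div L \<le> l" using n(1) div_le_dividend[of n L] by linarith
          qed (use y in simp)
          have F19: "(19, axis i s) \<in> F" using F_unit[of s 0 i] by (simp add: s_def)
          have 2: "pt (n mod L * 19) ?y' (?y' + int (n mod L) *s axis i s) \<omega> \<le> ennreal (a * real l)"
          proof (rule R[OF F19 y'])
            show "n mod L \<le> l" using n(1) mod_less_eq_dividend[of n L] by linarith
          qed
          have "int (n div L) *s axis i (s * int L) + int (n mod L) *s axis i s = (axis i (s * (int L * int (n div L) + int (n mod L))) :: int^'d)"
            by (simp add: vec_eq_iff axis_def algebra_simps)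
          also have "int L * int (n div L) + int (n mod L) = int n"
            by (metis mult_div_mod_eq of_nat_add of_nat_mult)
          finally have end_eq: "?y' + int (n mod L) *s axis i s = ?y + axis i (v $ i)"
            by (simp only: add.assoc n(2))
          have leg2: "pt (?T i) ?y (?y + axis i (v $ i)) \<omega> \<le> ennreal (a * real l + a * real l)"
          proof -
            have "n div L * (L + 18) + n mod L * 19 = ?T i" by (simp add: run_time_def n_def)
            then show ?thesis using pt_add_le[OF 1 2[unfolded end_eq]] a by simp
          qed
          have "pt ((\<Sum>i\<in>I. ?T i) + ?T i) z (?y + axis i (v $ i)) \<omega> \<le>
             ennreal (2 * a * real (card I) * real l + (a * real l + a * real l))"
            using a by (intro pt_add_le[OF insert.IH leg2]) auto
          moreover have "2 * a * real (card I) * real l + (a * real l + a * real l) = 2 * a * real (card (insert i I)) * real l"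
            using insert by (simp add: algebra_simps)
          ultimately show ?case using insert by (simp add: add.commute add.left_commute)
        qed simp
        define w where "w = z + v"
        have "(\<Sum>i\<in>UNIV. axis i (v $ i)) = v"
          by (simp add: vec_eq_iff axis_def if_distrib cong: if_cong)
        then have P1: "pt (\<Sum>i\<in>UNIV. ?T i) z w \<omega> \<le> ennreal (2 * a * real ?d * real l)"
          using travel[of UNIV] by (simp add: w_def)
        have w: "l1norm w \<le> int C * int l + int l" using l1norm_triangle[of z v] z vl by (simp add: w_def)
        define N where "N = (\<Sum>i\<in>UNIV. ?T i)"
        have "real N \<le> (\<Sum>i\<in>UNIV. (1 + 18 / real L) * real (nat \<bar>v $ i\<bar>) + 18 * real L)"
          unfolding N_def of_nat_sum using run_time_bounds(1)[OF L(1)] by (intro sum_mono)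
        also have "\<dots> = (1 + 18 / real L) * real_of_int (l1norm v) + 18 * real L * real ?d"
          by (simp add: sum.distrib sum_distrib_left[symmetric] l1norm_def)
        also have "\<dots> \<le> (1 + 18 / real L) * (\<rho> * real l) + 18 * real L * real ?d"
          using v by (intro add_right_mono mult_left_mono) auto
        also have "\<dots> = \<rho>' * real l + 18 * real L * real ?d" by (simp add: \<rho>'_def)
        finally have "real N + 80 \<le> real l" using elim(3) \<rho>' by (simp add: field_simps)
        then have Nl: "N + 80 \<le> l" by linarith
        have evN: "even (int N + (\<Sum>i\<in>UNIV. v $ i))"
        proof -
          have "even (\<Sum>i\<in>UNIV. ?T i + nat \<bar>v $ i\<bar>)" using run_time_bounds(2)[OF L(1)] by (intro dvd_sum)
          then have "even (N + (\<Sum>i\<in>UNIV. nat \<bar>v $ i\<bar>))" by (simp add: N_def sum.distrib)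
          moreover have "int (\<Sum>i\<in>UNIV. nat \<bar>v $ i\<bar>) = l1norm v" by (simp add: l1norm_def)
          ultimately have "even (int N + l1norm v)" by (metis even_of_nat of_nat_add)
          then show ?thesis using even_l1norm[of v] by simp
        qed
        \<comment> \<open>An odd surplus can occur only when zero steps are allowed, and one zero
          step then repairs it.\<close>
        define \<epsilon> where "\<epsilon> = (l - N) mod 2"
        have \<epsilon>: "\<epsilon> = 0 \<or> \<epsilon> = 1 \<and> S = steps0"
        proof -
          have "even (int l + s) \<Longrightarrow> even (int N + s) \<Longrightarrow> N + 80 \<le> l \<Longrightarrow> (l - N) mod 2 = 0" for s
            by presburger
          from this[OF _ evN Nl] ok show ?thesis unfolding parity_ok_def \<epsilon>_def by auto
        qed
        \<comment> \<open>38 is a unit leg out and one back, 19 steps each. There are q legs each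
          way, and one outward leg is lengthened by the even remainder 2u, so that the total time is
          exact.\<close>
        define q where "q = (l - N - \<epsilon>) div 38"
        define u where "u = (l - N - \<epsilon>) mod 38 div 2"
        have "38 \<le> l - N - \<epsilon>" using Nl \<epsilon> by linarith
        then have "1 \<le> q" unfolding q_def by (simp add: Suc_le_eq div_greater_zero_iff)
        moreover have "q \<le> l" unfolding q_def using div_le_dividend[of "l - N - \<epsilon>" 38] by linarith
        ultimately have q: "1 \<le> q" "q \<le> l" .
        have u: "u < 19" unfolding u_def by simp
        have "even (l - N - \<epsilon>)" unfolding \<epsilon>_def minus_mod_eq_mult_div by simp
        then have "even ((l - N - \<epsilon>) mod 38)" by (intro dvd_mod) auto
        then have "2 * u = (l - N - \<epsilon>) mod 38" unfolding u_def by (rule dvd_mult_div_cancel)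
        then have "l - N - \<epsilon> = 38 * q + 2 * u" unfolding q_def by simp
        moreover have "l = N + (\<epsilon> + (l - N - \<epsilon>))" using Nl \<epsilon> by auto
        moreover have "38 * q + 2 * u = (q - 1) * 19 + (1 * (19 + 2 * u) + q * 19)" using q by (cases q) auto
        ultimately have l_eq: "l = N + (\<epsilon> + ((q - 1) * 19 + (1 * (19 + 2 * u) + q * 19)))" by simp
        have P2: "pt \<epsilon> w w \<omega> \<le> ennreal (\<bar>c\<bar> * real l)"
        proof (cases "\<epsilon> = 0")
          case False
          then have "0 \<in> S" "\<epsilon> = Suc 0" using \<epsilon> by (auto simp: steps0_def)
          then have "pt \<epsilon> w w \<omega> \<le> ennreal (- c)"
            using ptime_step[of 0 S "wt r0 c \<omega>" 0 w w] by (simp add: wt_def)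
          also have "\<dots> \<le> ennreal (\<bar>c\<bar> * real l)"
          proof (rule ennreal_leI)
            have "\<bar>c\<bar> * 1 \<le> \<bar>c\<bar> * real l" using elim(2) by (intro mult_left_mono) auto
            then show "- c \<le> \<bar>c\<bar> * real l" by linarith
          qed
          finally show ?thesis .
        qed simp
        let ?e = "axis i0 1 :: int^'d" and ?e' = "axis i0 (-1) :: int^'d"
        let ?w1 = "w + int (q - 1) *s ?e"
        let ?w2 = "?w1 + int 1 *s ?e"
        have n1: "l1norm (int (q - 1) *s ?e) = int (q - 1)" "l1norm (int 1 *s ?e) = 1"
          by (simp_all only: l1norm_scale l1norm_axis abs_of_nat abs_one mult_1_right of_nat_1)
        have n2: "int (q - 1) \<le> int l - 1" using q by (simp add: of_nat_diff)
        have w1: "l1norm ?w1 \<le> int C * int l + 2 * int l" "l1norm ?w2 \<le> int C * int l + 2 * int l"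
          using l1norm_triangle[of w "int (q - 1) *s ?e"] l1norm_triangle[of ?w1 "int 1 *s ?e"] n1 n2 w
          by linarith+
        have F0: "(19 + 2 * u, ?e) \<in> F" if "u < 19" for u using F_unit[of 1] that by simp
        have F1: "(19 + 2 * 0, ?e') \<in> F" by (rule F_unit) simp_all
        have P3: "pt ((q - 1) * 19) w ?w1 \<omega> \<le> ennreal (a * real l)"
          using R[OF F0[of 0], of w "q - 1"] w q by simp
        have P4: "pt (1 * (19 + 2 * u)) ?w1 ?w2 \<omega> \<le> ennreal (a * real l)"
          using R[OF F0[OF u] w1(1), of 1] elim(2) by simp
        have end_w: "?w2 + int q *s ?e' = w" using q by (simp add: vec_eq_iff axis_def of_nat_diff)
        have P5: "pt (q * 19) ?w2 w \<omega> \<le> ennreal (a * real l)"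
          using R[OF F1 w1(2) q(2)] by (simp only: end_w mult_zero_right add_0_right)
        have "pt (N + (\<epsilon> + ((q - 1) * 19 + (1 * (19 + 2 * u) + q * 19)))) z w \<omega>
          \<le> ennreal (2 * a * real ?d * real l + (\<bar>c\<bar> * real l + (a * real l + (a * real l + a * real l))))"
          by (rule pt_add_le[OF P1[folded N_def] pt_add_le[OF P2 pt_add_le[OF P3 pt_add_le[OF P4 P5]]]])
            (use a in simp_all)
        then have "pt l z w \<omega> \<le> ennreal (2 * a * real ?d * real l + (\<bar>c\<bar> * real l + (a * real l + (a * real l + a * real l))))"
          by (simp only: l_eq[symmetric])
        also have "2 * a * real ?d * real l + (\<bar>c\<bar> * real l + (a * real l + (a * real l + a * real l))) = K * real l"
          by (simp add: K_def algebra_simps)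
        finally show "pt l z (z + v) \<omega> \<le> ennreal (K * real l)" by (simp add: w_def)
      qed
    qed
  qed
  moreover have "K \<ge> 0" using a by (simp add: K_def)
  ultimately show ?thesis using that by blast
qed

end

subsection \<open>The limit along arbitrary directions\<close>

lemma tendsto_floor_div: "(\<lambda>n. real_of_int \<lfloor>\<beta> * real n\<rfloor> / real n) \<longlonglongrightarrow> \<beta>"
proof (rule real_tendsto_sandwich)
  show "eventually (\<lambda>n. \<beta> - 1 / real n \<le> real_of_int \<lfloor>\<beta> * real n\<rfloor> / real n) sequentially"
    using eventually_gt_at_top[of 0]
  proof eventually_elim
    case (elim n)
    have "(\<beta> * real n - 1) / real n \<le> real_of_int \<lfloor>\<beta> * real n\<rfloor> / real n"
      by (intro divide_right_mono) linarith+
    then show ?case using elim by (simp add: diff_divide_distrib)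
  qed
  show "eventually (\<lambda>n. real_of_int \<lfloor>\<beta> * real n\<rfloor> / real n \<le> \<beta>) sequentially"
    using eventually_gt_at_top[of 0]
  proof eventually_elim
    case (elim n)
    have "real_of_int \<lfloor>\<beta> * real n\<rfloor> / real n \<le> \<beta> * real n / real n"
      by (intro divide_right_mono) linarith+
    then show ?case using elim by simp
  qed
  show "(\<lambda>n. \<beta> - 1 / real n) \<longlonglongrightarrow> \<beta>" by real_asymp
qed simp

lemma tendsto_nat_floor_div:
  assumes "0 \<le> \<beta>"
  shows "(\<lambda>n. real (nat \<lfloor>\<beta> * real n\<rfloor>) / real n) \<longlonglongrightarrow> \<beta>"
proof -
  have "real (nat \<lfloor>\<beta> * real n\<rfloor>) = real_of_int \<lfloor>\<beta> * real n\<rfloor>" for n using assms by simp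
  then show ?thesis using tendsto_floor_div by simp
qed

lemma tendsto_l1norm_div:
  fixes v :: "nat \<Rightarrow> int^'d"
  assumes "\<And>i. (\<lambda>n. real_of_int (v n $ i) / real n) \<longlonglongrightarrow> u $ i"
  shows "(\<lambda>n. real_of_int (l1norm (v n)) / real n) \<longlonglongrightarrow> l1norm u"
proof -
  have eq: "real_of_int (l1norm (v n)) / real n = (\<Sum>i\<in>UNIV. \<bar>real_of_int (v n $ i) / real n\<bar>)" for n
    by (simp add: l1norm_def sum_divide_distrib)
  show ?thesis unfolding l1norm_def[of u] eq by (intro tendsto_sum tendsto_rabs assms)
qed

lemma filterlim_of_tendsto_div:
  assumes "(\<lambda>n. real (l n) / real n) \<longlonglongrightarrow> \<beta>" "0 < \<beta>"
  shows "filterlim l at_top sequentially" "eventually (\<lambda>n. \<beta> / 2 * real n \<le> real (l n)) sequentially"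
proof -
  have "eventually (\<lambda>n. \<beta> / 2 < real (l n) / real n) sequentially"
    using assms by (intro order_tendstoD(1)) auto
  then show ev: "eventually (\<lambda>n. \<beta> / 2 * real n \<le> real (l n)) sequentially"
    using eventually_gt_at_top[of 0] by eventually_elim (simp add: field_simps)
  show "filterlim l at_top sequentially"
    unfolding filterlim_at_top
  proof
    fix Z :: nat
    have "eventually (\<lambda>n. real Z * 2 / \<beta> \<le> real n) sequentially"
      using filterlim_real_sequentially unfolding filterlim_at_top by blast
    with ev show "eventually (\<lambda>n. Z \<le> l n) sequentially"
    proof eventually_elim
      case (elim n)
      have "real Z \<le> \<beta> / 2 * real n" using elim(2) assms(2) by (simp add: field_simps)
      then show ?case using elim(1) by linarith
    qed
  qed
qed

context fpp
begin

definition good :: "((int^'d) set \<Rightarrow> real) \<Rightarrow> bool" where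
  "good \<omega> \<longleftrightarrow> goodU \<omega> \<and> goodL \<omega>"

text \<open>Here \<eta> is the displacement per step, so the displacement per unit of n is \<alpha>
  \<eta>. In the theorem \<eta> = \<xi> / \<alpha>.\<close>

definition drifts :: "(nat \<Rightarrow> nat) \<Rightarrow> (nat \<Rightarrow> int^'d) \<Rightarrow> real \<Rightarrow> real^'d \<Rightarrow> bool" where
  "drifts k x \<alpha> \<eta> \<longleftrightarrow> (\<lambda>n. real (k n) / real n) \<longlonglongrightarrow> \<alpha> \<and>
     (\<forall>i. (\<lambda>n. real_of_int (x n $ i) / real n) \<longlonglongrightarrow> \<alpha> * \<eta> $ i) \<and>
     eventually (\<lambda>n. parity_ok (k n) (x n)) sequentially"

text \<open>Even time and even coordinates mean that subtracting any multiple of (m, x) preserves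
  parity.\<close>

lemma rational_approximation:
  assumes \<eta>: "l1norm (\<eta> :: real^'d) < 1" and \<delta>: "\<delta> > 0"
  obtains m x where "finite_moment m x" "x \<noteq> 0" "0 < m" "even m" "\<And>i. even (x $ i)"
    "l1norm ((\<chi> i. real_of_int (x $ i) / real m) - \<eta>) < \<delta>"
proof -
  let ?d = "real CARD('d)"
  have d: "?d \<ge> 1" using dim by simp
  \<comment> \<open>The first bound gives the approximation. The second leaves 20 d spare steps out
    of 2N: 2 d for rounding the coordinates and 18 d for the overhead of
    \<open>finite_moment_vec\<close>.\<close>
  obtain N :: nat where N: "max (?d / \<delta>) (10 * ?d / (1 - l1norm \<eta>)) < real N"
    using reals_Archimedean2 by blast
  have "0 < ?d / \<delta>" using d \<delta> by simp
  then have N0: "0 < real N" using N by simp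
  have N1: "?d / real N < \<delta>" "10 * ?d < (1 - l1norm \<eta>) * real N"
    using N N0 \<delta> \<eta> by (simp_all add: field_simps)
  \<comment> \<open>A vanishing coordinate is replaced by 1, so that x \<noteq> 0 even for \<eta> =
    0; the rounding error stays at most 1.\<close>
  define y where "y i = (if \<lfloor>real N * \<eta> $ i\<rfloor> = 0 then 1 else \<lfloor>real N * \<eta> $ i\<rfloor>)" for i
  define x :: "int^'d" where "x = (\<chi> i. 2 * y i)"
  have yd: "\<bar>real_of_int (y i) - real N * \<eta> $ i\<bar> \<le> 1" for i
  proof (cases "\<lfloor>real N * \<eta> $ i\<rfloor> = 0")
    case True
    then have "0 \<le> real N * \<eta> $ i" "real N * \<eta> $ i < 1" by linarith+
    then show ?thesis using True by (simp add: y_def)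
  next
    case False
    then have "y i = \<lfloor>real N * \<eta> $ i\<rfloor>" by (simp add: y_def)
    then show ?thesis by linarith
  qed
  have y0: "y i \<noteq> 0" for i by (simp add: y_def)
  have dist: "\<bar>real_of_int (x $ i) / real (2 * N) - \<eta> $ i\<bar> \<le> 1 / real N" for i
  proof -
    have "real_of_int (x $ i) / real (2 * N) - \<eta> $ i = (real_of_int (y i) - real N * \<eta> $ i) / real N"
      using N0 by (simp add: x_def field_simps)
    then show ?thesis using yd[of i] N0 by (simp add: abs_divide divide_right_mono)
  qed
  have "l1norm ((\<chi> i. real_of_int (x $ i) / real (2 * N)) - \<eta>) \<le> (\<Sum>i\<in>(UNIV::'d set). 1 / real N)"
    unfolding l1norm_def using dist by (intro sum_mono) simp
  then have close: "l1norm ((\<chi> i. real_of_int (x $ i) / real (2 * N)) - \<eta>) < \<delta>" using N1(1) by simp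
  have "real_of_int (l1norm x) \<le> (\<Sum>i\<in>UNIV. 2 * real N * \<bar>\<eta> $ i\<bar> + 2)"
    unfolding l1norm_def of_int_sum
  proof (intro sum_mono)
    fix i
    have "real N * \<bar>\<eta> $ i\<bar> = \<bar>real N * \<eta> $ i\<bar>" by (simp add: abs_mult)
    then show "real_of_int \<bar>x $ i\<bar> \<le> 2 * real N * \<bar>\<eta> $ i\<bar> + 2" using yd[of i] unfolding x_def by simp
  qed
  also have "\<dots> = 2 * real N * l1norm \<eta> + 2 * ?d"
    by (simp add: l1norm_def sum.distrib sum_distrib_left)
  finally have "real_of_int (l1norm x) + 18 * ?d \<le> 2 * real N" using N1(2) by (simp add: algebra_simps)
  then have slack: "l1norm x + 18 * int CARD('d) \<le> int (2 * N)" by linarith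
  have ev: "even (x $ i)" for i by (simp add: x_def)
  have "finite_moment (2 * N) x"
    using slack ev by (intro finite_moment_vec) (auto simp: even_l1norm intro: dvd_sum)
  moreover have "x \<noteq> 0" using y0 by (auto simp: x_def vec_eq_iff)
  ultimately show ?thesis using that[of "2 * N" x] close N0 ev by simp
qed

text \<open>The cone bound along sequences. The limiting speed |u| / \<beta> lies strictly below
  \<rho>, so the displacement is eventually in the cone, and starting points O(n) are O(l
  n).\<close>

lemma residual_bound:
  assumes cone: "\<And>C. eventually (\<lambda>l. \<forall>z v. l1norm z \<le> int C * int l \<longrightarrow>
     real_of_int (l1norm v) \<le> \<rho> * real l \<longrightarrow> parity_ok l v \<longrightarrow> pt l z (z + v) \<omega> \<le> ennreal (K * real l)) sequentially"
    and l: "(\<lambda>n. real (l n) / real n) \<longlonglongrightarrow> \<beta>" "0 < \<beta>"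
    and v: "\<And>i. (\<lambda>n. real_of_int (v n $ i) / real n) \<longlonglongrightarrow> u $ i" "l1norm u < \<rho> * \<beta>"
    and ok: "eventually (\<lambda>n. parity_ok (l n) (v n)) sequentially"
    and z: "eventually (\<lambda>n. real_of_int (l1norm (z n)) \<le> C * real n) sequentially"
  shows "eventually (\<lambda>n. pt (l n) (z n) (z n + v n) \<omega> \<le> ennreal (K * real (l n))) sequentially"
proof -
  define C' where "C' = nat \<lceil>2 * \<bar>C\<bar> / \<beta>\<rceil>"
  have "(\<lambda>n. \<rho> * (real (l n) / real n) - real_of_int (l1norm (v n)) / real n) \<longlonglongrightarrow> \<rho> * \<beta> - l1norm u"
    by (intro tendsto_intros l tendsto_l1norm_div v)
  then have "eventually (\<lambda>n. 0 < \<rho> * (real (l n) / real n) - real_of_int (l1norm (v n)) / real n) sequentially"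
    using v(2) by (intro order_tendstoD(1)) auto
  with eventually_compose_filterlim[OF cone filterlim_of_tendsto_div(1)[OF l], of C']
    filterlim_of_tendsto_div(2)[OF l] ok z eventually_gt_at_top[of 0]
  show ?thesis
  proof eventually_elim
    case (elim n)
    have "C * real n \<le> \<bar>C\<bar> * real n" by (intro mult_right_mono) auto
    also have "\<dots> = (2 * \<bar>C\<bar> / \<beta>) * (\<beta> / 2 * real n)" using l(2) by simp
    also have "\<dots> \<le> real C' * real (l n)"
      using elim(2) l(2) unfolding C'_def by (intro mult_mono real_nat_ceiling_ge of_nat_0_le_iff) auto
    finally have "real_of_int (l1norm (z n)) \<le> real_of_int (int C' * int (l n))" using elim(4) by simp
    then have "l1norm (z n) \<le> int C' * int (l n)" by (simp only: of_int_le_iff)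
    moreover have "real_of_int (l1norm (v n)) \<le> \<rho> * real (l n)" using elim(5,6) by (simp add: field_simps)
    ultimately show ?case using elim(1,3) by blast
  qed
qed

lemma parity_ok_even_shift:
  assumes "parity_ok k x" "even t" "\<And>i. even (y $ i)"
  shows "t \<le> k \<Longrightarrow> parity_ok (k - t) (x - y)" "k \<le> t \<Longrightarrow> parity_ok (t - k) (y - x)"
proof -
  have "even (\<Sum>i\<in>UNIV. y $ i)" using assms(3) by (intro dvd_sum) auto
  then show "t \<le> k \<Longrightarrow> parity_ok (k - t) (x - y)" "k \<le> t \<Longrightarrow> parity_ok (t - k) (y - x)"
    using assms(1,2) by (auto simp: parity_ok_def sum_subtractf of_nat_diff)
qed

text \<open>Upper bound: follow the rational direction for about (1 - \<theta>) k_n steps and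
  correct the endpoint in the rest. Lower bound: extend an optimal path beyond x_n to the rational
  line at time about (1 + \<theta>) k_n, where the cost is known from below. The number b depends on
  neither the environment nor the sequences.\<close>

lemma two_sided_bounds:
  assumes \<eta>: "l1norm (\<eta> :: real^'d) < 1" and \<epsilon>: "\<epsilon> > 0"
  obtains b where "b \<ge> 0"
    "\<And>\<omega> k x \<alpha> C z. good \<omega> \<Longrightarrow> \<alpha> > 0 \<Longrightarrow> drifts k x \<alpha> \<eta> \<Longrightarrow> eventually (\<lambda>n. real_of_int (l1norm (z n)) \<le> C * real n) sequentially \<Longrightarrow>
       eventually (\<lambda>n. pt (k n) (z n) (z n + x n) \<omega> \<le> ennreal (real n * (\<alpha> * (b + \<epsilon>)))) sequentially"
    "\<And>\<omega> k x \<alpha>. good \<omega> \<Longrightarrow> \<alpha> > 0 \<Longrightarrow> drifts k x \<alpha> \<eta> \<Longrightarrow>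
       eventually (\<lambda>n. ennreal (real n * (\<alpha> * (b - \<epsilon>))) \<le> pt (k n) 0 (x n) \<omega>) sequentially"
proof -
  \<comment> \<open>The midpoint between |\<eta>| and 1 leaves room on both sides: the cone bound
    holds, and small errors in the direction stay in the cone.\<close>
  define \<rho> where "\<rho> = (l1norm \<eta> + 1) / 2"
  have \<rho>: "l1norm \<eta> < \<rho>" "0 \<le> \<rho>" "\<rho> < 1" using \<eta> l1norm_nonneg[of \<eta>] by (auto simp: \<rho>_def)
  obtain K where K: "K \<ge> 0" and cone: "\<And>\<omega> C. goodU \<omega> \<Longrightarrow> eventually (\<lambda>l. \<forall>z v. l1norm z \<le> int C * int l \<longrightarrow>
     real_of_int (l1norm v) \<le> \<rho> * real l \<longrightarrow> parity_ok l v \<longrightarrow> pt l z (z + v) \<omega> \<le> ennreal (K * real l)) sequentially"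
    by (rule cone_bound[OF \<rho>(2,3)]) (erule that, assumption)
  \<comment> \<open>The correction costs K \<theta> per step of k_n, which is made at most
    \<epsilon> / 4.\<close>
  define \<theta> where "\<theta> = min (1 / 2) (\<epsilon> / (4 * (K + 1)))"
  have \<theta>: "0 < \<theta>" "\<theta> \<le> 1 / 2" "K * \<theta> \<le> \<epsilon> / 4"
  proof -
    show "0 < \<theta>" using \<epsilon> K by (simp add: \<theta>_def)
    show "\<theta> \<le> 1 / 2" unfolding \<theta>_def by (rule min.cobounded1)
    have "K * \<theta> \<le> K * (\<epsilon> / (4 * (K + 1)))" using K unfolding \<theta>_def by (intro mult_left_mono) auto
    also have "\<dots> \<le> \<epsilon> / 4" using K \<epsilon> by (simp add: field_simps)
    finally show "K * \<theta> \<le> \<epsilon> / 4" .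
  qed
  define \<delta> where "\<delta> = \<theta> * (\<rho> - l1norm \<eta>) / 2"
  have \<delta>: "\<delta> > 0" using \<theta> \<rho> by (simp add: \<delta>_def)
  obtain m x0 where fm: "finite_moment m x0" and x0: "x0 \<noteq> 0" and m: "0 < m" "even m"
    and x0_even: "\<And>i. even (x0 $ i)" and close: "l1norm ((\<chi> i. real_of_int (x0 $ i) / real m) - \<eta>) < \<delta>"
    by (rule rational_approximation[OF \<eta> \<delta>]) (rule that, assumption+)
  define \<zeta> :: "real^'d" where "\<zeta> = (\<chi> i. real_of_int (x0 $ i) / real m)"
  have close': "l1norm (\<zeta> - \<eta>) < \<delta>" using close by (simp add: \<zeta>_def)
  \<comment> \<open>Limit displacement of the correction, per step of k_n: s is -(1 - \<theta>) in
    the upper and 1 + \<theta> in the lower bound. The size of \<delta> is chosen for this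
    inequality.\<close>
  have resid: "l1norm (\<theta> *s \<eta> + s *s (\<zeta> - \<eta>)) < \<rho> * \<theta>" if "\<bar>s\<bar> \<le> 2" for s
  proof -
    have "l1norm (\<theta> *s \<eta> + s *s (\<zeta> - \<eta>)) \<le> \<theta> * l1norm \<eta> + \<bar>s\<bar> * l1norm (\<zeta> - \<eta>)"
      using l1norm_triangle[of "\<theta> *s \<eta>" "s *s (\<zeta> - \<eta>)"] \<theta>(1) unfolding l1norm_scale by simp
    also have "\<bar>s\<bar> * l1norm (\<zeta> - \<eta>) \<le> 2 * l1norm (\<zeta> - \<eta>)" using that by (intro mult_right_mono) auto
    finally have "l1norm (\<theta> *s \<eta> + s *s (\<zeta> - \<eta>)) < \<theta> * l1norm \<eta> + 2 * \<delta>" using close' by linarith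
    moreover have "\<theta> * l1norm \<eta> + 2 * \<delta> = \<rho> * \<theta>" unfolding \<delta>_def by (simp add: field_simps)
    ultimately show ?thesis by linarith
  qed
  obtain r where r: "rate m x0 = ennreal r" "0 \<le> r" using rate_less_top[OF fm] by (cases "rate m x0") auto
  define b where "b = r / real m"
  have b: "0 \<le> b" "b * real m = r" using r m by (auto simp: b_def)
  have upper: "eventually (\<lambda>n. pt (k n) (z n) (z n + x n) \<omega> \<le> ennreal (real n * (\<alpha> * (b + \<epsilon>)))) sequentially"
    if good: "good \<omega>" and \<alpha>: "\<alpha> > 0" and dr: "drifts k x \<alpha> \<eta>"
      and z: "eventually (\<lambda>n. real_of_int (l1norm (z n)) \<le> C * real n) sequentially" for \<omega> k x \<alpha> C z
  proof -
    define a where "a = (b + \<epsilon> / 2) * real m"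
    have "rate m x0 < ennreal a" using r b m \<epsilon> by (simp add: a_def ennreal_less_iff algebra_simps)
    then obtain j where j: "1 \<le> j" and up: "\<And>\<omega> C. goodU \<omega> \<Longrightarrow> eventually (\<lambda>n. \<forall>z. l1norm z \<le> int C * int n \<longrightarrow>
       pt (n * (j * m)) z (z + int (n * j) *s x0) \<omega> \<le> ennreal (real (n * j) * a)) sequentially"
      by (rule rate_upper[OF fm x0]) (erule that, assumption)
    \<comment> \<open>Speed of q: q n blocks of j copies of m steps take about \<alpha> (1 -
      \<theta>) n steps.\<close>
    define \<beta> where "\<beta> = \<alpha> * (1 - \<theta>) / (real j * real m)"
    have \<beta>: "0 < \<beta>" "\<beta> * real j * real m = \<alpha> * (1 - \<theta>)" using \<alpha> \<theta> j m by (auto simp: \<beta>_def)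
    define q where "q n = nat \<lfloor>\<beta> * real n\<rfloor>" for n :: nat
    have q: "(\<lambda>n. real (q n) / real n) \<longlonglongrightarrow> \<beta>" unfolding q_def using \<beta> by (intro tendsto_nat_floor_div) auto
    have qle: "real (q n) \<le> \<beta> * real n" for n using \<beta> by (simp add: q_def)
    define t where "t n = q n * (j * m)" for n
    have t: "(\<lambda>n. real (t n) / real n) \<longlonglongrightarrow> \<alpha> * (1 - \<theta>)"
      using tendsto_mult_right[OF q, of "real j * real m"] \<beta>(2) by (simp add: t_def mult.assoc)
    have k: "(\<lambda>n. real (k n) / real n) \<longlonglongrightarrow> \<alpha>" using dr by (simp add: drifts_def)
    have ok: "eventually (\<lambda>n. parity_ok (k n) (x n)) sequentially" using dr by (simp add: drifts_def)
    have tk: "eventually (\<lambda>n. t n \<le> k n) sequentially"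
    proof -
      have "(\<lambda>n. real (k n) / real n - real (t n) / real n) \<longlonglongrightarrow> \<alpha> * \<theta>"
        using tendsto_diff[OF k t] by (simp add: algebra_simps)
      from order_tendstoD(1)[OF this, of 0]
      have "eventually (\<lambda>n. 0 < real (k n) / real n - real (t n) / real n) sequentially"
        using \<alpha> \<theta> by simp
      then show ?thesis using eventually_gt_at_top[of 0] by eventually_elim (simp add: field_simps)
    qed
    have l: "(\<lambda>n. real (k n - t n) / real n) \<longlonglongrightarrow> \<alpha> * \<theta>"
    proof (rule Lim_transform_eventually)
      show "(\<lambda>n. real (k n) / real n - real (t n) / real n) \<longlonglongrightarrow> \<alpha> * \<theta>"
        using tendsto_diff[OF k t] by (simp add: algebra_simps)
      show "eventually (\<lambda>n. real (k n) / real n - real (t n) / real n = real (k n - t n) / real n) sequentially"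
        using tk by eventually_elim (simp add: of_nat_diff diff_divide_distrib)
    qed
    define y where "y n = int (q n * j) *s x0" for n
    have v: "(\<lambda>n. real_of_int ((x n - y n) $ i) / real n) \<longlonglongrightarrow> (\<alpha> *s (\<theta> *s \<eta> + (-(1 - \<theta>)) *s (\<zeta> - \<eta>))) $ i" for i
    proof -
      have "(\<lambda>n. real_of_int (x n $ i) / real n - real (q n) / real n * (real j * real_of_int (x0 $ i))) \<longlonglongrightarrow>
         \<alpha> * \<eta> $ i - \<beta> * (real j * real_of_int (x0 $ i))"
        using dr unfolding drifts_def by (intro tendsto_intros q) auto
      also have "\<beta> * (real j * real_of_int (x0 $ i)) = \<alpha> * (1 - \<theta>) * \<zeta> $ i"
        unfolding \<beta>(2)[symmetric] \<zeta>_def using m by simp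
      also have "\<alpha> * \<eta> $ i - \<alpha> * (1 - \<theta>) * \<zeta> $ i = (\<alpha> *s (\<theta> *s \<eta> + (-(1 - \<theta>)) *s (\<zeta> - \<eta>))) $ i"
        by (simp add: algebra_simps)
      finally show ?thesis by (simp add: y_def diff_divide_distrib mult.assoc)
    qed
    have res: "eventually (\<lambda>n. pt (k n - t n) (z n + y n) (z n + y n + (x n - y n)) \<omega> \<le> ennreal (K * real (k n - t n))) sequentially"
    proof (rule residual_bound[where \<rho>=\<rho> and z="\<lambda>n. z n + y n" and C="C + \<beta> * real j * real_of_int (l1norm x0)"])
      show "eventually (\<lambda>l. \<forall>z v. l1norm z \<le> int C * int l \<longrightarrow> real_of_int (l1norm v) \<le> \<rho> * real l \<longrightarrow>
        parity_ok l v \<longrightarrow> pt l z (z + v) \<omega> \<le> ennreal (K * real l)) sequentially" for C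
        using good by (intro cone) (simp add: good_def)
      show "l1norm (\<alpha> *s (\<theta> *s \<eta> + (-(1 - \<theta>)) *s (\<zeta> - \<eta>))) < \<rho> * (\<alpha> * \<theta>)"
      proof -
        have "\<alpha> * l1norm (\<theta> *s \<eta> + (-(1 - \<theta>)) *s (\<zeta> - \<eta>)) < \<alpha> * (\<rho> * \<theta>)"
          by (rule mult_strict_left_mono[OF resid \<alpha>]) (use \<theta> in simp)
        then show ?thesis unfolding l1norm_scale[of \<alpha>] using \<alpha> by (simp only: abs_of_pos mult.left_commute)
      qed
      show "eventually (\<lambda>n. parity_ok (k n - t n) (x n - y n)) sequentially"
        using tk ok
      proof eventually_elim
        case (elim n)
        then show ?case using m x0_even by (intro parity_ok_even_shift) (auto simp: t_def y_def)
      qed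
      show "eventually (\<lambda>n. real_of_int (l1norm (z n + y n)) \<le> (C + \<beta> * real j * real_of_int (l1norm x0)) * real n) sequentially"
        using z
      proof eventually_elim
        case (elim n)
        have "real_of_int (l1norm (y n)) = real (q n) * (real j * real_of_int (l1norm x0))"
          by (simp add: y_def l1norm_scale)
        also have "\<dots> \<le> \<beta> * real n * (real j * real_of_int (l1norm x0))"
          using qle[of n] by (intro mult_right_mono) auto
        moreover have "real_of_int (l1norm (z n + y n)) \<le> real_of_int (l1norm (z n)) + real_of_int (l1norm (y n))"
          using l1norm_triangle[of "z n" "y n"] by linarith
        ultimately show ?case using elim by (simp add: algebra_simps)
      qed
    qed (use l v \<alpha> \<theta> in auto)
    \<comment> \<open>\<open>goodU\<close> measures starting points in units of q n, which is
      eventually at least \<beta> n / 2.\<close>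
    define C' where "C' = nat \<lceil>2 * \<bar>C\<bar> / \<beta>\<rceil>"
    have "eventually (\<lambda>n. \<forall>z. l1norm z \<le> int C' * int (q n) \<longrightarrow>
       pt (q n * (j * m)) z (z + int (q n * j) *s x0) \<omega> \<le> ennreal (real (q n * j) * a)) sequentially"
      using good eventually_compose_filterlim[OF up filterlim_of_tendsto_div(1)[OF q \<beta>(1)]] by (simp add: good_def)
    moreover have "eventually (\<lambda>n. real (q n) / real n * (real j * a) + K * (real (k n - t n) / real n) < \<alpha> * (b + \<epsilon>)) sequentially"
    proof (rule order_tendstoD(2))
      show "(\<lambda>n. real (q n) / real n * (real j * a) + K * (real (k n - t n) / real n)) \<longlonglongrightarrow> \<beta> * (real j * a) + K * (\<alpha> * \<theta>)"
        by (intro tendsto_intros q l)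
      have "\<beta> * (real j * a) = \<alpha> * (1 - \<theta>) * (b + \<epsilon> / 2)"
        unfolding \<beta>(2)[symmetric] by (simp add: a_def algebra_simps)
      also have "\<dots> \<le> \<alpha> * 1 * (b + \<epsilon> / 2)"
        using \<alpha> \<theta> b \<epsilon> by (intro mult_right_mono mult_left_mono) auto
      finally have "\<beta> * (real j * a) \<le> \<alpha> * (b + \<epsilon> / 2)" by simp
      moreover have "K * (\<alpha> * \<theta>) \<le> \<alpha> * (\<epsilon> / 4)" using \<theta>(3) \<alpha> by (simp add: mult.left_commute)
      moreover have "0 < \<alpha> * \<epsilon>" using \<alpha> \<epsilon> by simp
      ultimately show "\<beta> * (real j * a) + K * (\<alpha> * \<theta>) < \<alpha> * (b + \<epsilon>)"
        unfolding distrib_left by linarith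
    qed
    ultimately show ?thesis
      using res tk z filterlim_of_tendsto_div(2)[OF q \<beta>(1)] eventually_gt_at_top[of 0]
    proof eventually_elim
      case (elim n)
      have a0: "0 \<le> a" using b \<epsilon> by (simp add: a_def)
      have "C * real n \<le> \<bar>C\<bar> * real n" by (intro mult_right_mono) auto
      also have "\<dots> = (2 * \<bar>C\<bar> / \<beta>) * (\<beta> / 2 * real n)" using \<beta> by simp
      also have "\<dots> \<le> real C' * real (q n)"
        using elim(6) \<beta>(1) unfolding C'_def by (intro mult_mono real_nat_ceiling_ge of_nat_0_le_iff) auto
      finally have "real_of_int (l1norm (z n)) \<le> real_of_int (int C' * int (q n))" using elim(5) by simp
      then have "l1norm (z n) \<le> int C' * int (q n)" by (simp only: of_int_le_iff)
      then have "pt (t n) (z n) (z n + y n) \<omega> \<le> ennreal (real (q n * j) * a)"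
        using elim(1) unfolding t_def y_def by blast
      from pt_add_le[OF this elim(3)] a0 K
      have "pt (t n + (k n - t n)) (z n) (z n + y n + (x n - y n)) \<omega> \<le> ennreal (real (q n * j) * a + K * real (k n - t n))"
        by simp
      moreover have "t n + (k n - t n) = k n" "z n + y n + (x n - y n) = z n + x n" using elim(4) by auto
      ultimately have "pt (k n) (z n) (z n + x n) \<omega> \<le> ennreal (real (q n * j) * a + K * real (k n - t n))" by simp
      also have "\<dots> \<le> ennreal (real n * (\<alpha> * (b + \<epsilon>)))"
      proof (rule ennreal_leI)
        have "(real (q n) / real n * (real j * a) + K * (real (k n - t n) / real n)) * real n \<le> \<alpha> * (b + \<epsilon>) * real n"
          using elim(2) by (intro mult_right_mono) auto
        moreover have "real (q n * j) * a + K * real (k n - t n)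
            = (real (q n) / real n * (real j * a) + K * (real (k n - t n) / real n)) * real n"
          using elim(7) by (simp add: distrib_right)
        ultimately show "real (q n * j) * a + K * real (k n - t n) \<le> real n * (\<alpha> * (b + \<epsilon>))"
          by (simp only: mult.commute)
      qed
      finally show ?case .
    qed
  qed
  \<comment> \<open>If b \<le> \<epsilon> the claim is void, because \<open>ennreal\<close> sends
    nonpositive numbers to 0.\<close>
  have lower: "eventually (\<lambda>n. ennreal (real n * (\<alpha> * (b - \<epsilon>))) \<le> pt (k n) 0 (x n) \<omega>) sequentially"
    if good: "good \<omega>" and \<alpha>: "\<alpha> > 0" and dr: "drifts k x \<alpha> \<eta>" for \<omega> k x \<alpha>
  proof (cases "b - \<epsilon> \<le> 0")
    case True
    then have "real n * (\<alpha> * (b - \<epsilon>)) \<le> 0" for n using \<alpha> by (intro mult_nonneg_nonpos) auto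
    then show ?thesis by (simp add: ennreal_neg)
  next
    case False
    define a where "a = (b - \<epsilon> / 2) * real m"
    have a0: "0 \<le> a" using False \<epsilon> by (simp add: a_def)
    have "ennreal a < rate m x0" using r b m \<epsilon> a0 by (simp add: a_def ennreal_less_iff algebra_simps)
    then have lo: "eventually (\<lambda>n. ennreal (real n * a) \<le> pt (n * m) 0 (int n *s x0) \<omega>) sequentially"
      using good a0 by (intro rate_lower fm x0) (auto simp: good_def)
    define \<beta> where "\<beta> = \<alpha> * (1 + \<theta>) / real m"
    have \<beta>: "0 < \<beta>" "\<beta> * real m = \<alpha> * (1 + \<theta>)" using \<alpha> \<theta> m by (auto simp: \<beta>_def)
    define q where "q n = nat \<lfloor>\<beta> * real n\<rfloor>" for n :: nat
    have q: "(\<lambda>n. real (q n) / real n) \<longlonglongrightarrow> \<beta>" unfolding q_def using \<beta> by (intro tendsto_nat_floor_div) auto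
    define t where "t n = q n * m" for n
    have t: "(\<lambda>n. real (t n) / real n) \<longlonglongrightarrow> \<alpha> * (1 + \<theta>)"
      using tendsto_mult_right[OF q, of "real m"] \<beta>(2) by (simp add: t_def)
    have k: "(\<lambda>n. real (k n) / real n) \<longlonglongrightarrow> \<alpha>" using dr by (simp add: drifts_def)
    have ok: "eventually (\<lambda>n. parity_ok (k n) (x n)) sequentially" using dr by (simp add: drifts_def)
    have tk: "eventually (\<lambda>n. k n \<le> t n) sequentially"
    proof -
      have "(\<lambda>n. real (t n) / real n - real (k n) / real n) \<longlonglongrightarrow> \<alpha> * \<theta>"
        using tendsto_diff[OF t k] by (simp add: algebra_simps)
      from order_tendstoD(1)[OF this, of 0]
      have "eventually (\<lambda>n. 0 < real (t n) / real n - real (k n) / real n) sequentially"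
        using \<alpha> \<theta> by simp
      then show ?thesis using eventually_gt_at_top[of 0] by eventually_elim (simp add: field_simps)
    qed
    have l: "(\<lambda>n. real (t n - k n) / real n) \<longlonglongrightarrow> \<alpha> * \<theta>"
    proof (rule Lim_transform_eventually)
      show "(\<lambda>n. real (t n) / real n - real (k n) / real n) \<longlonglongrightarrow> \<alpha> * \<theta>"
        using tendsto_diff[OF t k] by (simp add: algebra_simps)
      show "eventually (\<lambda>n. real (t n) / real n - real (k n) / real n = real (t n - k n) / real n) sequentially"
        using tk by eventually_elim (simp add: of_nat_diff diff_divide_distrib)
    qed
    define y where "y n = int (q n) *s x0" for n
    have xlim: "(\<lambda>n. real_of_int (x n $ i) / real n) \<longlonglongrightarrow> (\<alpha> *s \<eta>) $ i" for i using dr by (simp add: drifts_def)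
    have v: "(\<lambda>n. real_of_int ((y n - x n) $ i) / real n) \<longlonglongrightarrow> (\<alpha> *s (\<theta> *s \<eta> + (1 + \<theta>) *s (\<zeta> - \<eta>))) $ i" for i
    proof -
      have "(\<lambda>n. real (q n) / real n * real_of_int (x0 $ i) - real_of_int (x n $ i) / real n) \<longlonglongrightarrow>
         \<beta> * real_of_int (x0 $ i) - (\<alpha> *s \<eta>) $ i"
        by (intro tendsto_intros q xlim)
      also have "\<beta> * real_of_int (x0 $ i) = \<alpha> * (1 + \<theta>) * \<zeta> $ i"
        unfolding \<beta>(2)[symmetric] \<zeta>_def using m by simp
      also have "\<alpha> * (1 + \<theta>) * \<zeta> $ i - (\<alpha> *s \<eta>) $ i = (\<alpha> *s (\<theta> *s \<eta> + (1 + \<theta>) *s (\<zeta> - \<eta>))) $ i"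
        by (simp add: algebra_simps)
      finally show ?thesis by (simp add: y_def diff_divide_distrib)
    qed
    have res: "eventually (\<lambda>n. pt (t n - k n) (x n) (x n + (y n - x n)) \<omega> \<le> ennreal (K * real (t n - k n))) sequentially"
    proof (rule residual_bound[where \<rho>=\<rho> and C="l1norm (\<alpha> *s \<eta>) + 1"])
      show "eventually (\<lambda>l. \<forall>z v. l1norm z \<le> int C * int l \<longrightarrow> real_of_int (l1norm v) \<le> \<rho> * real l \<longrightarrow>
        parity_ok l v \<longrightarrow> pt l z (z + v) \<omega> \<le> ennreal (K * real l)) sequentially" for C
        using good by (intro cone) (simp add: good_def)
      show "l1norm (\<alpha> *s (\<theta> *s \<eta> + (1 + \<theta>) *s (\<zeta> - \<eta>))) < \<rho> * (\<alpha> * \<theta>)"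
      proof -
        have "\<alpha> * l1norm (\<theta> *s \<eta> + (1 + \<theta>) *s (\<zeta> - \<eta>)) < \<alpha> * (\<rho> * \<theta>)"
          by (rule mult_strict_left_mono[OF resid \<alpha>]) (use \<theta> in simp)
        then show ?thesis unfolding l1norm_scale[of \<alpha>] using \<alpha> by (simp only: abs_of_pos mult.left_commute)
      qed
      show "eventually (\<lambda>n. parity_ok (t n - k n) (y n - x n)) sequentially"
        using tk ok
      proof eventually_elim
        case (elim n)
        then show ?case using m x0_even by (intro parity_ok_even_shift) (auto simp: t_def y_def)
      qed
      have "eventually (\<lambda>n. real_of_int (l1norm (x n)) / real n < l1norm (\<alpha> *s \<eta>) + 1) sequentially"
        using tendsto_l1norm_div[of x, OF xlim] by (intro order_tendstoD(2)) auto
      then show "eventually (\<lambda>n. real_of_int (l1norm (x n)) \<le> (l1norm (\<alpha> *s \<eta>) + 1) * real n) sequentially"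
        using eventually_gt_at_top[of 0] by eventually_elim (simp add: field_simps)
    qed (use l v \<alpha> \<theta> in auto)
    have "eventually (\<lambda>n. \<alpha> * (b - \<epsilon>) < real (q n) / real n * a - K * (real (t n - k n) / real n)) sequentially"
    proof (rule order_tendstoD(1))
      show "(\<lambda>n. real (q n) / real n * a - K * (real (t n - k n) / real n)) \<longlonglongrightarrow> \<beta> * a - K * (\<alpha> * \<theta>)"
        by (intro tendsto_intros q l)
      have "\<alpha> * 1 * (b - \<epsilon> / 2) \<le> \<alpha> * (1 + \<theta>) * (b - \<epsilon> / 2)"
        using \<alpha> \<theta> False \<epsilon> by (intro mult_right_mono mult_left_mono) auto
      also have "\<dots> = \<beta> * a" unfolding \<beta>(2)[symmetric] by (simp add: a_def algebra_simps)
      finally have "\<alpha> * (b - \<epsilon> / 2) \<le> \<beta> * a" by simp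
      moreover have "K * (\<alpha> * \<theta>) \<le> \<alpha> * (\<epsilon> / 4)" using \<theta>(3) \<alpha> by (simp add: mult.left_commute)
      moreover have "0 < \<alpha> * \<epsilon>" using \<alpha> \<epsilon> by simp
      ultimately show "\<alpha> * (b - \<epsilon>) < \<beta> * a - K * (\<alpha> * \<theta>)"
        unfolding right_diff_distrib by linarith
    qed
    with eventually_compose_filterlim[OF lo filterlim_of_tendsto_div(1)[OF q \<beta>(1)]]
    show ?thesis using res tk eventually_gt_at_top[of 0]
    proof eventually_elim
      case (elim n)
      show ?case
      proof (rule ccontr)
        assume "\<not> ?thesis"
        then have "pt (k n) 0 (x n) \<omega> \<le> ennreal (real n * (\<alpha> * (b - \<epsilon>)))" by simp
        from pt_add_le[OF this elim(3)] False \<alpha> K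
        have "pt (k n + (t n - k n)) 0 (y n) \<omega> \<le> ennreal (real n * (\<alpha> * (b - \<epsilon>)) + K * real (t n - k n))" by simp
        moreover have "k n + (t n - k n) = t n" using elim(4) by simp
        ultimately have "pt (t n) 0 (y n) \<omega> \<le> ennreal (real n * (\<alpha> * (b - \<epsilon>)) + K * real (t n - k n))" by simp
        with elim(1) have "ennreal (real (q n) * a) \<le> ennreal (real n * (\<alpha> * (b - \<epsilon>)) + K * real (t n - k n))"
          unfolding t_def y_def by (rule order_trans)
        then have "real (q n) * a \<le> real n * (\<alpha> * (b - \<epsilon>)) + K * real (t n - k n)"
          using False \<alpha> K by (subst (asm) ennreal_le_iff) auto
        moreover have "\<alpha> * (b - \<epsilon>) * real n < (real (q n) / real n * a - K * (real (t n - k n) / real n)) * real n"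
          using elim(2,5) by (intro mult_strict_right_mono) auto
        moreover have "(real (q n) / real n * a - K * (real (t n - k n) / real n)) * real n
            = real (q n) * a - K * real (t n - k n)"
          using elim(5) by (simp add: left_diff_distrib)
        moreover have "\<alpha> * (b - \<epsilon>) * real n = real n * (\<alpha> * (b - \<epsilon>))" by (rule mult.commute)
        ultimately show False by linarith
      qed
    qed
  qed
  show ?thesis by (rule that[OF b(1) upper lower])
qed

end

subsection \<open>The limit function\<close>

lemma linear_bounds_le:
  assumes "eventually (\<lambda>n. real n * a \<le> b + real n * c') sequentially"
  shows "a \<le> (c' :: real)"
proof (rule ccontr)
  assume "\<not> a \<le> c'"
  then have "0 < a - c'" by simp
  have "eventually (\<lambda>n. (b + 1) / (a - c') \<le> real n) sequentially"
    using filterlim_real_sequentially unfolding filterlim_at_top by blast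
  with assms have "eventually (\<lambda>n :: nat. False) sequentially"
  proof eventually_elim
    case (elim n)
    have "b + 1 \<le> real n * (a - c')" using elim(2) \<open>0 < a - c'\<close> by (simp add: field_simps)
    then show ?case using elim(1) by (simp add: algebra_simps)
  qed
  then show False by simp
qed

text \<open>Test sequences with all entries even, admissible for both step sets; used whenever
  deterministic constants are compared.\<close>

definition even_time :: "real \<Rightarrow> nat \<Rightarrow> nat" where
  "even_time \<alpha> n = 2 * nat \<lfloor>\<alpha> / 2 * real n\<rfloor>"

definition even_point :: "real^'d \<Rightarrow> nat \<Rightarrow> int^'d" where
  "even_point \<xi> n = (\<chi> i. 2 * \<lfloor>\<xi> $ i / 2 * real n\<rfloor>)"

lemma tendsto_even_time: "0 \<le> \<alpha> \<Longrightarrow> (\<lambda>n. real (even_time \<alpha> n) / real n) \<longlonglongrightarrow> \<alpha>"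
  using tendsto_mult_left[OF tendsto_nat_floor_div[of "\<alpha> / 2"], of 2] by (simp add: even_time_def)

lemma tendsto_even_point: "(\<lambda>n. real_of_int (even_point \<xi> n $ i) / real n) \<longlonglongrightarrow> \<xi> $ i"
  using tendsto_mult_left[OF tendsto_floor_div[of "\<xi> $ i / 2"], of 2] by (simp add: even_point_def)

context fpp
begin

lemma parity_ok_even: "even k \<Longrightarrow> (\<And>i. even (x $ i)) \<Longrightarrow> parity_ok k x"
  unfolding parity_ok_def by (auto intro!: dvd_sum)

lemma even_even [simp]: "even (even_time \<alpha> n)" "even (even_point \<xi> n $ i)"
  by (simp_all add: even_time_def even_point_def)

lemma drifts_even:
  assumes "0 \<le> \<alpha>"
  shows "drifts (even_time \<alpha>) (even_point (\<alpha> *s \<eta>)) \<alpha> \<eta>"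
  unfolding drifts_def using tendsto_even_time[OF assms] tendsto_even_point[of "\<alpha> *s \<eta>"]
  by (auto intro!: always_eventually parity_ok_even)

text \<open>The upper bound is kept for starting points z_n = O(n), not only for the origin: in the
  proof of convexity the second piece of a path starts at the end of the first.\<close>

definition is_rate :: "real^'d \<Rightarrow> real \<Rightarrow> bool" where
  "is_rate \<eta> g \<longleftrightarrow> 0 \<le> g \<and> (\<forall>\<epsilon>>0. \<forall>\<omega> k x \<alpha>. good \<omega> \<longrightarrow> \<alpha> > 0 \<longrightarrow> drifts k x \<alpha> \<eta> \<longrightarrow>
     eventually (\<lambda>n. ennreal (real n * (\<alpha> * (g - \<epsilon>))) \<le> pt (k n) 0 (x n) \<omega>) sequentially \<and>
     (\<forall>C z. eventually (\<lambda>n. real_of_int (l1norm (z n)) \<le> C * real n) sequentially \<longrightarrow>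
        eventually (\<lambda>n. pt (k n) (z n) (z n + x n) \<omega> \<le> ennreal (real n * (\<alpha> * (g + \<epsilon>)))) sequentially))"

lemma is_rateD:
  assumes "is_rate \<eta> g" "good \<omega>" "\<alpha> > 0" "drifts k x \<alpha> \<eta>" "\<epsilon> > 0"
  shows "eventually (\<lambda>n. ennreal (real n * (\<alpha> * (g - \<epsilon>))) \<le> pt (k n) 0 (x n) \<omega>) sequentially"
    "eventually (\<lambda>n. real_of_int (l1norm (z n)) \<le> C * real n) sequentially \<Longrightarrow>
       eventually (\<lambda>n. pt (k n) (z n) (z n + x n) \<omega> \<le> ennreal (real n * (\<alpha> * (g + \<epsilon>)))) sequentially"
    "eventually (\<lambda>n. pt (k n) 0 (x n) \<omega> \<le> ennreal (real n * (\<alpha> * (g + \<epsilon>)))) sequentially"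
proof -
  have *: "eventually (\<lambda>n. ennreal (real n * (\<alpha> * (g - \<epsilon>))) \<le> pt (k n) 0 (x n) \<omega>) sequentially \<and>
     (\<forall>C z. eventually (\<lambda>n. real_of_int (l1norm (z n)) \<le> C * real n) sequentially \<longrightarrow>
        eventually (\<lambda>n. pt (k n) (z n) (z n + x n) \<omega> \<le> ennreal (real n * (\<alpha> * (g + \<epsilon>)))) sequentially)"
    using assms unfolding is_rate_def by blast
  show "eventually (\<lambda>n. ennreal (real n * (\<alpha> * (g - \<epsilon>))) \<le> pt (k n) 0 (x n) \<omega>) sequentially"
    using * by blast
  show up: "eventually (\<lambda>n. real_of_int (l1norm (z n)) \<le> C * real n) sequentially \<Longrightarrow>
       eventually (\<lambda>n. pt (k n) (z n) (z n + x n) \<omega> \<le> ennreal (real n * (\<alpha> * (g + \<epsilon>)))) sequentially" for z C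
    using * by blast
  show "eventually (\<lambda>n. pt (k n) 0 (x n) \<omega> \<le> ennreal (real n * (\<alpha> * (g + \<epsilon>)))) sequentially"
    using up[of "\<lambda>_. 0" 0] by simp
qed

text \<open>A single good environment suffices to compare constants that do not depend on the
  environment.\<close>

lemma ex_good: "\<exists>\<omega>. good \<omega>"
proof (rule ccontr)
  assume no: "\<nexists>\<omega>. good \<omega>"
  have "AE \<omega> in P. good \<omega>" using AE_goodU AE_goodL by eventually_elim (simp add: good_def)
  then have "AE \<omega> in P. False" using no by simp
  then show False by simp
qed

text \<open>For each \<epsilon> there is a constant b \<epsilon> with error \<epsilon>. Testing all
  of them on one sequence in one environment shows that the intervals of radius \<epsilon> about b
  \<epsilon> meet pairwise; the infimum of their right ends lies in every one of them.\<close>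

lemma ex_is_rate:
  assumes \<eta>: "l1norm \<eta> < 1"
  shows "\<exists>g. is_rate \<eta> g"
proof -
  let ?U = "\<lambda>b \<epsilon>. \<forall>\<omega> k x \<alpha> C z. good \<omega> \<longrightarrow> \<alpha> > 0 \<longrightarrow> drifts k x \<alpha> \<eta> \<longrightarrow>
     eventually (\<lambda>n. real_of_int (l1norm (z n)) \<le> C * real n) sequentially \<longrightarrow>
       eventually (\<lambda>n. pt (k n) (z n) (z n + x n) \<omega> \<le> ennreal (real n * (\<alpha> * (b + \<epsilon>)))) sequentially"
  let ?L = "\<lambda>b \<epsilon>. \<forall>\<omega> k x \<alpha>. good \<omega> \<longrightarrow> \<alpha> > 0 \<longrightarrow> drifts k x \<alpha> \<eta> \<longrightarrow>
       eventually (\<lambda>n. ennreal (real n * (\<alpha> * (b - \<epsilon>))) \<le> pt (k n) 0 (x n) \<omega>) sequentially"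
  have ex: "\<forall>\<epsilon>. \<exists>b. \<epsilon> > 0 \<longrightarrow> 0 \<le> b \<and> ?U b \<epsilon> \<and> ?L b \<epsilon>"
  proof
    fix \<epsilon> :: real
    show "\<exists>b. \<epsilon> > 0 \<longrightarrow> 0 \<le> b \<and> ?U b \<epsilon> \<and> ?L b \<epsilon>"
    proof (cases "\<epsilon> > 0")
      case True
      show ?thesis
        apply (rule two_sided_bounds[OF \<eta> True])
        subgoal for b by (intro exI[of _ b] impI conjI allI) simp_all
        done
    qed auto
  qed
  obtain b where "\<forall>\<epsilon>. \<epsilon> > 0 \<longrightarrow> 0 \<le> b \<epsilon> \<and> ?U (b \<epsilon>) \<epsilon> \<and> ?L (b \<epsilon>) \<epsilon>"
    using choice[OF ex] by (rule exE)
  then have b: "\<And>\<epsilon>. \<epsilon> > 0 \<Longrightarrow> 0 \<le> b \<epsilon> \<and> ?U (b \<epsilon>) \<epsilon> \<and> ?L (b \<epsilon>) \<epsilon>" 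
    by (elim allE impE)
  obtain \<omega> where \<omega>: "good \<omega>" using ex_good by blast
  have dr: "drifts (even_time 1) (even_point (1 *s \<eta>)) 1 \<eta>" by (rule drifts_even) simp
  have cmp: "b \<epsilon> - \<epsilon> \<le> b \<delta> + \<delta>" if "\<epsilon> > 0" "\<delta> > 0" for \<epsilon> \<delta>
  proof (rule linear_bounds_le[where b=0])
    have "eventually (\<lambda>n. ennreal (real n * (1 * (b \<epsilon> - \<epsilon>))) \<le> pt (even_time 1 n) 0 (even_point (1 *s \<eta>) n) \<omega>) sequentially"
      using b[OF that(1)] \<omega> dr by (meson zero_less_one)
    moreover have "eventually (\<lambda>n. pt (even_time 1 n) 0 (0 + even_point (1 *s \<eta>) n) \<omega> \<le> ennreal (real n * (1 * (b \<delta> + \<delta>)))) sequentially"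
      using b[OF that(2), THEN conjunct2, THEN conjunct1, rule_format, OF \<omega> zero_less_one dr, of "\<lambda>_. 0" 0] by simp
    ultimately show "eventually (\<lambda>n. real n * (b \<epsilon> - \<epsilon>) \<le> 0 + real n * (b \<delta> + \<delta>)) sequentially"
    proof eventually_elim
      case (elim n)
      then have "ennreal (real n * (1 * (b \<epsilon> - \<epsilon>))) \<le> ennreal (real n * (1 * (b \<delta> + \<delta>)))" by simp
      then show ?case using b[OF that(2)] that(2) by (subst (asm) ennreal_le_iff) auto
    qed
  qed
  define g where "g = (INF \<delta>\<in>{0<..}. b \<delta> + \<delta>)"
  have bdd: "bdd_below ((\<lambda>\<delta>. b \<delta> + \<delta>) ` {0<..})"
    using b by (intro bdd_belowI[of _ 0]) (auto intro!: add_nonneg_nonneg)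
  have g1: "g \<le> b \<epsilon> + \<epsilon>" if "\<epsilon> > 0" for \<epsilon> unfolding g_def using that by (intro cINF_lower bdd) auto
  have g2: "b \<epsilon> - \<epsilon> \<le> g" if "\<epsilon> > 0" for \<epsilon> unfolding g_def using that cmp by (intro cINF_greatest) auto
  have g0: "0 \<le> g" unfolding g_def using b by (intro cINF_greatest) (auto intro!: add_nonneg_nonneg)
  have "is_rate \<eta> g" unfolding is_rate_def
  proof (intro conjI g0 allI impI)
    fix \<epsilon> :: real and \<omega> k x \<alpha> assume *: "\<epsilon> > 0" "good \<omega>" "\<alpha> > 0" "drifts k x \<alpha> \<eta>"
    then have e2: "\<epsilon> / 2 > 0" by simp
    have "eventually (\<lambda>n. ennreal (real n * (\<alpha> * (b (\<epsilon> / 2) - \<epsilon> / 2))) \<le> pt (k n) 0 (x n) \<omega>) sequentially"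
      using b[OF e2] * by blast
    then show "eventually (\<lambda>n. ennreal (real n * (\<alpha> * (g - \<epsilon>))) \<le> pt (k n) 0 (x n) \<omega>) sequentially"
    proof eventually_elim
      case (elim n)
      have "ennreal (real n * (\<alpha> * (g - \<epsilon>))) \<le> ennreal (real n * (\<alpha> * (b (\<epsilon> / 2) - \<epsilon> / 2)))"
        using g1[OF e2] * by (intro ennreal_leI mult_left_mono) auto
      then show ?case using elim by (rule order_trans)
    qed
    fix C and z :: "nat \<Rightarrow> int^'d" assume "eventually (\<lambda>n. real_of_int (l1norm (z n)) \<le> C * real n) sequentially"
    then have "eventually (\<lambda>n. pt (k n) (z n) (z n + x n) \<omega> \<le> ennreal (real n * (\<alpha> * (b (\<epsilon> / 2) + \<epsilon> / 2)))) sequentially"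
      using b[OF e2] * by blast
    then show "eventually (\<lambda>n. pt (k n) (z n) (z n + x n) \<omega> \<le> ennreal (real n * (\<alpha> * (g + \<epsilon>)))) sequentially"
    proof eventually_elim
      case (elim n)
      have "ennreal (real n * (\<alpha> * (b (\<epsilon> / 2) + \<epsilon> / 2))) \<le> ennreal (real n * (\<alpha> * (g + \<epsilon>)))"
        using g2[OF e2] * by (intro ennreal_leI mult_left_mono) auto
      with elim show ?case by (rule order_trans)
    qed
  qed
  then show ?thesis ..
qed

definition Lam :: "real^'d \<Rightarrow> real" where
  "Lam \<eta> = (SOME g. is_rate \<eta> g)"

lemma is_rate_Lam: "l1norm \<eta> < 1 \<Longrightarrow> is_rate \<eta> (Lam \<eta>)"
  unfolding Lam_def using ex_is_rate by (rule someI_ex)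

lemma Lam_nonneg: "l1norm \<eta> < 1 \<Longrightarrow> 0 \<le> Lam \<eta>"
  using is_rate_Lam by (auto simp: is_rate_def)

text \<open>Spend a fraction u of the time at velocity \<eta>1 and the fraction v at velocity
  \<eta>2; the concatenated path competes for the mixed velocity.\<close>

lemma Lam_convex:
  assumes \<eta>: "l1norm \<eta>1 < 1" "l1norm \<eta>2 < 1" and uv: "0 < u" "0 < v" "u + v = 1"
  shows "Lam (u *s \<eta>1 + v *s \<eta>2) \<le> u * Lam \<eta>1 + v * Lam \<eta>2"
proof (rule field_le_epsilon)
  fix e :: real assume e: "0 < e"
  let ?\<eta> = "u *s \<eta>1 + v *s \<eta>2"
  have "l1norm ?\<eta> \<le> u * l1norm \<eta>1 + v * l1norm \<eta>2"
    using l1norm_triangle[of "u *s \<eta>1" "v *s \<eta>2"] uv by (simp add: l1norm_scale)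
  also have "\<dots> < u * 1 + v * 1" using uv \<eta> by (intro add_strict_mono mult_strict_left_mono)
  finally have \<eta>': "l1norm ?\<eta> < 1" using uv by simp
  obtain \<omega> where \<omega>: "good \<omega>" using ex_good by blast
  define k1 where "k1 = even_time u"
  define k2 where "k2 = even_time v"
  define x1 where "x1 = even_point (u *s \<eta>1)"
  define x2 where "x2 = even_point (v *s \<eta>2)"
  have d: "drifts k1 x1 u \<eta>1" "drifts k2 x2 v \<eta>2"
    unfolding k1_def x1_def k2_def x2_def using uv by (auto intro: drifts_even)
  have d3: "drifts (\<lambda>n. k1 n + k2 n) (\<lambda>n. x1 n + x2 n) 1 ?\<eta>"
    unfolding drifts_def
  proof (intro conjI allI)
    show "(\<lambda>n. real (k1 n + k2 n) / real n) \<longlonglongrightarrow> 1"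
      using tendsto_add[of "\<lambda>n. real (k1 n) / real n" u _ "\<lambda>n. real (k2 n) / real n" v] d uv
      by (simp add: drifts_def add_divide_distrib)
    show "(\<lambda>n. real_of_int ((x1 n + x2 n) $ i) / real n) \<longlonglongrightarrow> 1 * ?\<eta> $ i" for i
      using tendsto_add[of "\<lambda>n. real_of_int (x1 n $ i) / real n" "u * \<eta>1 $ i" _ "\<lambda>n. real_of_int (x2 n $ i) / real n" "v * \<eta>2 $ i"] d
      by (simp add: drifts_def add_divide_distrib)
    show "eventually (\<lambda>n. parity_ok (k1 n + k2 n) (x1 n + x2 n)) sequentially"
      by (intro always_eventually allI parity_ok_even) (auto simp: k1_def k2_def x1_def x2_def)
  qed
  have e2: "e / 2 > 0" using e by simp
  have xb: "eventually (\<lambda>n. real_of_int (l1norm (x1 n)) \<le> (l1norm (u *s \<eta>1) + 1) * real n) sequentially"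
  proof -
    have "(\<lambda>n. real_of_int (l1norm (x1 n)) / real n) \<longlonglongrightarrow> l1norm (u *s \<eta>1)"
      unfolding x1_def by (intro tendsto_l1norm_div tendsto_even_point)
    from order_tendstoD(2)[OF this, of "l1norm (u *s \<eta>1) + 1"]
    have "eventually (\<lambda>n. real_of_int (l1norm (x1 n)) / real n < l1norm (u *s \<eta>1) + 1) sequentially" by simp
    then show ?thesis using eventually_gt_at_top[of 0] by eventually_elim (simp add: field_simps)
  qed
  note n1 = Lam_nonneg[OF \<eta>(1)] and n2 = Lam_nonneg[OF \<eta>(2)]
  have "Lam ?\<eta> - e / 2 \<le> u * (Lam \<eta>1 + e / 2) + v * (Lam \<eta>2 + e / 2)"
  proof (rule linear_bounds_le[where b=0])
    show "eventually (\<lambda>n. real n * (Lam ?\<eta> - e / 2) \<le> 0 + real n * (u * (Lam \<eta>1 + e / 2) + v * (Lam \<eta>2 + e / 2))) sequentially"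
      using is_rateD(1)[OF is_rate_Lam[OF \<eta>'] \<omega> zero_less_one d3 e2]
        is_rateD(3)[OF is_rate_Lam[OF \<eta>(1)] \<omega> uv(1) d(1) e2]
        is_rateD(2)[OF is_rate_Lam[OF \<eta>(2)] \<omega> uv(2) d(2) e2 xb]
    proof eventually_elim
      case (elim n)
      have "pt (k1 n + k2 n) 0 (x1 n + x2 n) \<omega> \<le> ennreal (real n * (u * (Lam \<eta>1 + e / 2)) + real n * (v * (Lam \<eta>2 + e / 2)))"
        by (rule pt_add_le[OF elim(2,3)]) (use n1 n2 uv e in auto)
      with elim(1) have "ennreal (real n * (1 * (Lam ?\<eta> - e / 2))) \<le> ennreal (real n * (u * (Lam \<eta>1 + e / 2)) + real n * (v * (Lam \<eta>2 + e / 2)))"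
        by (rule order_trans)
      then have "real n * (1 * (Lam ?\<eta> - e / 2)) \<le> real n * (u * (Lam \<eta>1 + e / 2)) + real n * (v * (Lam \<eta>2 + e / 2))"
        by (subst (asm) ennreal_le_iff) (use n1 n2 uv e in auto)
      then show ?case by (simp add: distrib_left)
    qed
  qed
  moreover have "u * (e / 2) + v * (e / 2) = e / 2" using uv by (simp flip: distrib_right)
  ultimately show "Lam ?\<eta> \<le> u * Lam \<eta>1 + v * Lam \<eta>2 + e" by (simp add: distrib_left)
qed

section \<open>Pacing a cheap step and the value at the origin\<close>

lemma pt_back_forth:
  assumes "s \<in> S" "wt r0 c \<omega> z (z + s) \<le> \<epsilon>" "0 \<le> \<epsilon>"
  shows "pt (2 * j) z z \<omega> \<le> ennreal (real (2 * j) * \<epsilon>)"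
proof -
  have s': "- s \<in> S" using assms(1) S_cases uminus_steps[of s] by (auto simp: steps0_def)
  have sym: "wt r0 c \<omega> (z + s) (z + s + - s) = wt r0 c \<omega> z (z + s)"
    by (auto simp: wt_def insert_commute)
  have two: "pt 2 z z \<omega> \<le> ennreal (\<epsilon> + \<epsilon>)"
  proof -
    have "pt (Suc (Suc 0)) z z \<omega> \<le> ennreal (wt r0 c \<omega> z (z + s)) + pt (Suc 0) (z + s) z \<omega>"
      by (rule ptime_step[OF assms(1)])
    also have "pt (Suc 0) (z + s) z \<omega> \<le> ennreal (wt r0 c \<omega> (z + s) (z + s + - s)) + pt 0 (z + s + - s) z \<omega>"
      by (rule ptime_step[OF s'])
    finally have "pt 2 z z \<omega> \<le> ennreal (wt r0 c \<omega> z (z + s)) + ennreal (wt r0 c \<omega> z (z + s))"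
      unfolding sym by (simp add: numeral_2_eq_2 add_left_mono)
    also have "\<dots> \<le> ennreal \<epsilon> + ennreal \<epsilon>" using assms(2) by (intro add_mono ennreal_leI)
    finally show ?thesis unfolding ennreal_plus[OF assms(3) assms(3)] .
  qed
  show ?thesis
  proof (induction j)
    case (Suc j)
    have "pt (2 + 2 * j) z z \<omega> \<le> ennreal ((\<epsilon> + \<epsilon>) + real (2 * j) * \<epsilon>)"
      using assms(3) by (intro pt_add_le[OF two Suc]) auto
    then show ?case by (simp add: algebra_simps)
  qed simp
qed

text \<open>For a fixed z, a long enough time of the right parity puts both journeys in the cone;
  their cost does not depend on n and disappears in the limit.\<close>

lemma ex_excursion:
  assumes good: "good \<omega>"
  obtains h :: nat and a where "a \<ge> 0" "pt h 0 z \<omega> \<le> ennreal a" "pt h z 0 \<omega> \<le> ennreal a"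
proof -
  obtain K where K: "K \<ge> 0" "\<And>\<omega> C. goodU \<omega> \<Longrightarrow> eventually (\<lambda>l. \<forall>z v. l1norm z \<le> int C * int l \<longrightarrow>
     real_of_int (l1norm v) \<le> 1 / 2 * real l \<longrightarrow> parity_ok l v \<longrightarrow> pt l z (z + v) \<omega> \<le> ennreal (K * real l)) sequentially"
    by (rule cone_bound[of "1 / 2"]) (simp, simp, erule that, assumption)
  have "goodU \<omega>" using good by (simp add: good_def)
  from K(2)[OF this, of 1] obtain l0 where l0: "\<And>l z v. l \<ge> l0 \<Longrightarrow> l1norm z \<le> int l \<Longrightarrow>
     real_of_int (l1norm v) \<le> 1 / 2 * real l \<Longrightarrow> parity_ok l v \<Longrightarrow> pt l z (z + v) \<omega> \<le> ennreal (K * real l)"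
    unfolding eventually_sequentially by auto
  \<comment> \<open>At least l0, at least 2 |z| and of the parity of |z|: hence the factor 3 rather
    than 2.\<close>
  define h where "h = 2 * l0 + 3 * nat (l1norm z)"
  have ev: "even (int h + (\<Sum>i\<in>UNIV. z $ i))" "even (int h + (\<Sum>i\<in>UNIV. (- z) $ i))"
    using even_l1norm[of z] even_l1norm[of "- z"] by (auto simp: h_def)
  have z: "l1norm z \<le> int h" "real_of_int (l1norm z) \<le> 1 / 2 * real h" using l1norm_nonneg[of z] by (auto simp: h_def)
  have "pt h 0 (0 + z) \<omega> \<le> ennreal (K * real h)" "pt h z (z + - z) \<omega> \<le> ennreal (K * real h)"
    using l0[of h 0 z] l0[of h z "- z"] z ev by (auto simp: h_def parity_ok_def)
  then show ?thesis using that[of "K * real h" h] K(1) by simp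
qed

text \<open>Go to the cheap step, wherever it is, pace there for almost all of the time, and return.
  The zero step s = 0 is included.\<close>

lemma Lam_zero_le:
  assumes good: "good \<omega>" and s: "s \<in> S" "wt r0 c \<omega> z (z + s) \<le> \<epsilon>" "0 \<le> \<epsilon>"
  shows "Lam 0 \<le> \<epsilon>"
proof (rule field_le_epsilon)
  fix e :: real assume e: "0 < e"
  obtain h a where h: "a \<ge> 0" "pt h 0 z \<omega> \<le> ennreal a" "pt h z 0 \<omega> \<le> ennreal a"
    using ex_excursion[OF good] .
  have d: "drifts (\<lambda>n. 2 * n) (\<lambda>_. 0) 2 0"
    unfolding drifts_def
  proof (intro conjI allI)
    show "(\<lambda>n. real (2 * n) / real n) \<longlonglongrightarrow> 2" by real_asymp
  qed (auto intro!: always_eventually parity_ok_even)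
  have "l1norm (0 :: real^'d) < 1" by simp
  from is_rateD(1)[OF is_rate_Lam[OF this] good _ d e]
  have ev: "eventually (\<lambda>n. ennreal (real n * (2 * (Lam 0 - e))) \<le> pt (2 * n) 0 0 \<omega>) sequentially" by simp
  have "2 * (Lam 0 - e) \<le> 2 * \<epsilon>"
  proof (rule linear_bounds_le[where b="a + a"])
    show "eventually (\<lambda>n. real n * (2 * (Lam 0 - e)) \<le> a + a + real n * (2 * \<epsilon>)) sequentially"
      using ev eventually_ge_at_top[of h]
    proof eventually_elim
      case (elim n)
      have "pt (h + (2 * (n - h) + h)) 0 0 \<omega> \<le> ennreal (a + (real (2 * (n - h)) * \<epsilon> + a))"
        by (intro pt_add_le[OF h(2) pt_add_le[OF pt_back_forth[OF s] h(3)]]) (use h s in auto)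
      moreover have "h + (2 * (n - h) + h) = 2 * n" using elim(2) by simp
      ultimately have "pt (2 * n) 0 0 \<omega> \<le> ennreal (a + (real (2 * (n - h)) * \<epsilon> + a))" by (simp only:)
      with elim(1) have "ennreal (real n * (2 * (Lam 0 - e))) \<le> ennreal (a + (real (2 * (n - h)) * \<epsilon> + a))"
        by (rule order_trans)
      then have "real n * (2 * (Lam 0 - e)) \<le> a + (real (2 * (n - h)) * \<epsilon> + a)"
        by (subst (asm) ennreal_le_iff) (use h s in auto)
      also have "real (2 * (n - h)) * \<epsilon> \<le> real (2 * n) * \<epsilon>" using s by (intro mult_right_mono) auto
      finally show ?case by (simp add: algebra_simps)
    qed
  qed
  then show "Lam 0 \<le> \<epsilon> + e" by simp
qed

lemma pt_ratio_tendsto: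
  assumes good: "good \<omega>" and \<eta>: "l1norm \<eta> < 1" and \<alpha>: "\<alpha> > 0" and dr: "drifts k x \<alpha> \<eta>"
  shows "(\<lambda>n. (enn2ereal (pt (k n) 0 (x n) \<omega>) + ereal (c * real (k n))) / ereal (real n)) \<longlonglongrightarrow> ereal (\<alpha> * (Lam \<eta> + c))"
proof -
  define p where "p n = enn2real (pt (k n) 0 (x n) \<omega>)" for n
  note L = is_rate_Lam[OF \<eta>] and L0 = Lam_nonneg[OF \<eta>]
  have fin: "eventually (\<lambda>n. pt (k n) 0 (x n) \<omega> = ennreal (p n)) sequentially"
    using is_rateD(3)[OF L good \<alpha> dr zero_less_one]
  proof eventually_elim
    case (elim n)
    then have "pt (k n) 0 (x n) \<omega> < \<top>" by (rule le_less_trans) simp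
    then show ?case by (simp add: p_def)
  qed
  have "(\<lambda>n. p n / real n) \<longlonglongrightarrow> \<alpha> * Lam \<eta>"
  proof (rule LIMSEQ_I)
    fix e :: real assume e: "0 < e"
    define \<epsilon> where "\<epsilon> = e / (2 * \<alpha>)"
    have \<epsilon>: "\<epsilon> > 0" "\<alpha> * \<epsilon> = e / 2" using e \<alpha> by (auto simp: \<epsilon>_def)
    have "eventually (\<lambda>n. norm (p n / real n - \<alpha> * Lam \<eta>) < e) sequentially"
      using is_rateD(1)[OF L good \<alpha> dr \<epsilon>(1)] is_rateD(3)[OF L good \<alpha> dr \<epsilon>(1)] fin eventually_gt_at_top[of 0]
    proof eventually_elim
      case (elim n)
      have p0: "0 \<le> p n" by (simp add: p_def)
      have "real n * (\<alpha> * (Lam \<eta> - \<epsilon>)) \<le> p n"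
        using elim(1) unfolding elim(3) by (subst (asm) ennreal_le_iff) (use p0 in auto)
      moreover have "p n \<le> real n * (\<alpha> * (Lam \<eta> + \<epsilon>))"
        using elim(2) unfolding elim(3) by (subst (asm) ennreal_le_iff) (use L0 \<alpha> \<epsilon> in auto)
      ultimately have "\<alpha> * (Lam \<eta> - \<epsilon>) \<le> p n / real n" "p n / real n \<le> \<alpha> * (Lam \<eta> + \<epsilon>)"
        using elim(4) by (simp_all add: field_simps)
      then show ?case using \<epsilon>(2) e by (simp add: abs_less_iff algebra_simps)
    qed
    then show "\<exists>no. \<forall>n\<ge>no. norm (p n / real n - \<alpha> * Lam \<eta>) < e" by (simp add: eventually_sequentially)
  qed
  moreover have "(\<lambda>n. real (k n) / real n) \<longlonglongrightarrow> \<alpha>" using dr by (simp add: drifts_def)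
  ultimately have "(\<lambda>n. p n / real n + c * (real (k n) / real n)) \<longlonglongrightarrow> \<alpha> * Lam \<eta> + c * \<alpha>"
    by (intro tendsto_intros)
  then have "(\<lambda>n. ereal (p n / real n + c * (real (k n) / real n))) \<longlonglongrightarrow> ereal (\<alpha> * (Lam \<eta> + c))"
    by (simp add: algebra_simps)
  then show ?thesis
  proof (rule Lim_transform_eventually)
    show "eventually (\<lambda>n. ereal (p n / real n + c * (real (k n) / real n)) =
       (enn2ereal (pt (k n) 0 (x n) \<omega>) + ereal (c * real (k n))) / ereal (real n)) sequentially"
      using fin eventually_gt_at_top[of 0]
    proof eventually_elim
      case (elim n)
      have "0 \<le> p n" by (simp add: p_def)
      then show ?case unfolding elim(1) using elim(2) by (simp add: add_divide_distrib)
    qed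
  qed
qed

end

subsection \<open>Cheap edges and removal of zero steps\<close>

lemma infinite_nn_edges: "infinite (nn_edges :: (int^'d) set set)"
proof -
  define i0 :: 'd where "i0 = undefined"
  let ?f = "\<lambda>n :: nat. {axis i0 (int n), axis i0 (int n) + axis i0 1} :: (int^'d) set"
  have "inj ?f"
  proof (rule injI)
    fix m n assume "?f m = ?f n"
    then have "(\<lambda>x. x $ i0) ` ?f m = (\<lambda>x. x $ i0) ` ?f n" by (rule arg_cong)
    then have "{int m, int m + 1} = {int n, int n + 1}" by simp
    then show "m = n" by (auto simp: doubleton_eq_iff)
  qed
  then have "infinite (range ?f)" by (rule range_inj_infinite)
  moreover have "range ?f \<subseteq> nn_edges" by (auto intro!: edge_in_nn_edges simp: steps_def)
  ultimately show ?thesis using finite_subset by blast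
qed

lemma countable_nn_edges: "countable (nn_edges :: (int^'d) set set)"
proof -
  have "nn_edges \<subseteq> range (\<lambda>(x, y). {x, y :: int^'d})" by (auto simp: nn_edges_def)
  then show ?thesis by (rule countable_subset) simp
qed

lemma nn_edgesE:
  assumes "e \<in> nn_edges"
  obtains z s where "s \<in> steps" "e = {z, z + s}"
proof -
  obtain x y :: "int^'a" where e: "e = {x, y}" "l1norm (x - y) = 1" using assms by (auto simp: nn_edges_def)
  define s where "s = y - x"
  have s1: "(\<Sum>i\<in>UNIV. \<bar>s $ i\<bar>) = 1" using e(2) by (simp add: s_def l1norm_def abs_minus_commute)
  then obtain i where i: "s $ i \<noteq> 0" by (metis abs_zero sum.neutral zero_neq_one)
  have "(\<Sum>j\<in>UNIV. \<bar>s $ j\<bar>) = \<bar>s $ i\<bar> + (\<Sum>j\<in>UNIV - {i}. \<bar>s $ j\<bar>)" by (rule sum.remove) auto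
  moreover have "0 \<le> (\<Sum>j\<in>UNIV - {i}. \<bar>s $ j\<bar>)" by (rule sum_nonneg) simp
  ultimately have "\<bar>s $ i\<bar> = 1" "(\<Sum>j\<in>UNIV - {i}. \<bar>s $ j\<bar>) = 0" using i s1 by linarith+
  then have "\<bar>s $ i\<bar> = 1" "\<And>j. j \<noteq> i \<Longrightarrow> s $ j = 0" by (auto simp: sum_nonneg_eq_0_iff)
  then have "s = axis i 1 \<or> s = axis i (-1)" by (auto simp: vec_eq_iff axis_def abs_if split: if_splits)
  then have "s \<in> steps" by (auto simp: steps_def)
  then show ?thesis using that[of s x] e by (simp add: s_def)
qed

text \<open>Any n + 1 edges are all expensive with probability q^{n+1}, which tends to 0.\<close>

lemma (in fpp) AE_cheap_edge:
  assumes "emeasure D {y. y < r} > 0"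
  shows "AE \<omega> in P. \<exists>e\<in>nn_edges. \<omega> e < r"
proof -
  interpret D: prob_space D by (rule prob_D)
  interpret PP: product_prob_space "\<lambda>_ :: (int^'d) set. D" nn_edges by (intro product_prob_spaceI prob_D)
  have [measurable]: "{y. r \<le> y} \<in> sets D" "{y. y < r} \<in> sets D" by (simp_all add: sets_D)
  have sp: "space D = UNIV" using sets_eq_imp_space_eq[OF sets_D] by simp
  define q where "q = D.prob {y. r \<le> y}"
  have "D.prob (space D - {y. y < r}) = 1 - D.prob {y. y < r}" by (rule D.prob_compl) simp
  moreover have "space D - {y. y < r} = {y. r \<le> y}" by (auto simp: sp)
  ultimately have q: "0 \<le> q" "q < 1" using assms by (auto simp: q_def D.emeasure_eq_measure)
  define A where "A = {\<omega> \<in> space P. \<forall>e\<in>nn_edges. r \<le> \<omega> e}"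
  have comp: "(\<lambda>\<omega>. \<omega> e) \<in> borel_measurable P" if "e \<in> nn_edges" for e :: "(int^'d) set"
    using measurable_component_singleton[OF that, of "\<lambda>_. D"] unfolding measurable_cong_sets[OF refl sets_D] .
  have "A = space P - (\<Union>e\<in>nn_edges. {\<omega> \<in> space P. \<omega> e < r})" by (auto simp: A_def not_less)
  moreover have "(\<Union>e\<in>nn_edges. {\<omega> \<in> space P. \<omega> e < r}) \<in> sets P"
    using comp by (intro sets.countable_UN'' countable_nn_edges borel_measurable_less) auto
  ultimately have A: "A \<in> sets P" by auto
  have "emeasure P A \<le> ennreal (q ^ Suc n)" for n
  proof -
    obtain J :: "(int^'d) set set" where J: "J \<subseteq> nn_edges" "finite J" "card J = Suc n"
      using infinite_arbitrarily_large[OF infinite_nn_edges, of "Suc n"] by blast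
    have "emeasure P A \<le> emeasure P {\<omega> \<in> space P. \<forall>e\<in>J. \<omega> e \<in> {y. r \<le> y}}"
    proof (rule emeasure_mono)
      show "A \<subseteq> {\<omega> \<in> space P. \<forall>e\<in>J. \<omega> e \<in> {y. r \<le> y}}" using J by (auto simp: A_def)
      show "{\<omega> \<in> space P. \<forall>e\<in>J. \<omega> e \<in> {y. r \<le> y}} \<in> sets P"
        using J comp by (auto intro!: sets.sets_Collect_finite_All' borel_measurable_le)
    qed
    also have "\<dots> = (\<Prod>e\<in>J. emeasure D {y. r \<le> y})" by (rule PP.emeasure_PiM_Collect) (use J in auto)
    also have "\<dots> = ennreal (q ^ Suc n)" 
      by (simp only: prod_constant J(3) D.emeasure_eq_measure q_def[symmetric] ennreal_power[OF q(1)])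
    finally show ?thesis .
  qed
  moreover have "(\<lambda>n. ennreal (q ^ Suc n)) \<longlonglongrightarrow> ennreal 0"
    using q by (intro tendsto_ennrealI LIMSEQ_Suc LIMSEQ_power_zero) auto
  ultimately have "emeasure P A \<le> ennreal 0" by (intro LIMSEQ_le_const) auto
  then have "A \<in> null_sets P" using A by auto
  then show ?thesis by (rule AE_I') (auto simp: A_def not_less)
qed

lemma ptime_steps_parity:
  "ptime steps W n x y \<noteq> \<top> \<Longrightarrow> even (int n + (\<Sum>i\<in>UNIV. (y - x) $ i))"
proof (induction n arbitrary: x)
  case 0
  then have "x = y" by (auto split: if_splits)
  then show ?case by simp
next
  case (Suc n)
  have ne: "steps \<noteq> ({} :: (int^'a) set)" by (auto simp: steps_def)
  obtain s where s: "s \<in> steps" "ptime steps W (Suc n) x y = ennreal (W x (x + s)) + ptime steps W n (x + s) y"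
    using ptime_Suc_cases[OF finite_steps ne] .
  then have "even (int n + (\<Sum>i\<in>UNIV. (y - (x + s)) $ i))" using Suc.prems by (intro Suc.IH) (simp add: top_add)
  moreover have "odd (\<Sum>i\<in>UNIV. s $ i)" using l1norm_steps[OF s(1)] even_l1norm[of s] by simp
  moreover have "(\<Sum>i\<in>UNIV. (y - (x + s)) $ i) = (\<Sum>i\<in>UNIV. (y - x) $ i) - (\<Sum>i\<in>UNIV. s $ i)"
    by (simp add: sum_subtractf sum.distrib)
  ultimately show ?case by simp
qed

text \<open>Dropping zero steps saves nonnegative weight and keeps the endpoints; it only shortens
  the time, by an amount to be made up elsewhere.\<close>

lemma ptime_remove_zero_steps:
  "\<exists>n'\<le>n. ptime steps W n' x y \<le> ptime steps0 W n x y"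
proof (induction n arbitrary: x)
  case (Suc n)
  have fin: "finite (steps0 :: (int^'a) set)" "steps0 \<noteq> ({} :: (int^'a) set)" by (auto simp: steps0_def)
  obtain s where s: "s \<in> steps0" "ptime steps0 W (Suc n) x y = ennreal (W x (x + s)) + ptime steps0 W n (x + s) y"
    using ptime_Suc_cases[OF fin] .
  obtain n' where n': "n' \<le> n" "ptime steps W n' (x + s) y \<le> ptime steps0 W n (x + s) y" using Suc by blast
  show ?case
  proof (cases "s = 0")
    case True
    have "ptime steps0 W n (x + s) y \<le> ptime steps0 W (Suc n) x y" unfolding s(2) by simp
    then show ?thesis using n' True by (intro exI[of _ n']) auto
  next
    case False
    then have "s \<in> steps" using s(1) by (simp add: steps0_def)
    from ptime_step[OF this] have "ptime steps W (Suc n') x y \<le> ennreal (W x (x + s)) + ptime steps W n' (x + s) y" .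
    also have "\<dots> \<le> ptime steps0 W (Suc n) x y" unfolding s(2) by (intro add_left_mono n')
    finally show ?thesis using n'(1) by (intro exI[of _ "Suc n'"]) auto
  qed
qed auto

lemma reach_parity: "x \<in> reach n \<Longrightarrow> even (int n + (\<Sum>i\<in>UNIV. x $ i))"
proof -
  assume "x \<in> reach n"
  then obtain p where p: "p 0 = 0" "p n = x" "\<And>i. i < n \<Longrightarrow> p (Suc i) - p i \<in> steps"
    by (auto simp: reach_def paths_def)
  have "m \<le> n \<Longrightarrow> even (int m + (\<Sum>i\<in>UNIV. p m $ i))" for m
  proof (induction m)
    case (Suc m)
    let ?s = "p (Suc m) - p m"
    have "odd (\<Sum>i\<in>UNIV. ?s $ i)" using l1norm_steps[OF p(3)[of m]] even_l1norm[of ?s] Suc.prems by simp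
    moreover have "(\<Sum>i\<in>UNIV. p (Suc m) $ i) = (\<Sum>i\<in>UNIV. p m $ i) + (\<Sum>i\<in>UNIV. ?s $ i)"
      by (simp add: sum_subtractf)
    ultimately show ?case using Suc by auto
  qed (simp add: p)
  from this[of n] show ?thesis by (simp add: p)
qed

subsection \<open>The open unit ball\<close>

lemma l1norm_scaleR: "l1norm (a *\<^sub>R \<xi>) = \<bar>a\<bar> * l1norm (\<xi> :: real^'d)"
  by (simp add: l1norm_def abs_mult sum_distrib_left)

lemma scaleR_eq_vector_smult: "a *\<^sub>R \<xi> = a *s (\<xi> :: real^'d)"
  by (simp add: vec_eq_iff)

lemma open_intU: "open (intU :: (real^'d) set)"
  unfolding intU_def l1norm_def by (intro open_Collect_less continuous_intros)

lemma convex_intU: "convex (intU :: (real^'d) set)"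
  unfolding convex_def
proof (intro ballI allI impI)
  fix x y :: "real^'d" and u v :: real assume *: "x \<in> intU" "y \<in> intU" "0 \<le> u" "0 \<le> v" "u + v = 1"
  have "l1norm (u *\<^sub>R x + v *\<^sub>R y) \<le> u * l1norm x + v * l1norm y"
    using l1norm_triangle[of "u *\<^sub>R x" "v *\<^sub>R y"] * by (simp add: l1norm_scaleR)
  also have "\<dots> \<le> u * max (l1norm x) (l1norm y) + v * max (l1norm x) (l1norm y)"
    using * by (intro add_mono mult_left_mono) auto
  also have "\<dots> = max (l1norm x) (l1norm y)" using * by (simp flip: distrib_right)
  also have "\<dots> < 1" using * by (simp add: intU_def)
  finally show "u *\<^sub>R x + v *\<^sub>R y \<in> intU" by (simp add: intU_def)
qed

lemma (in fpp) convex_on_Lam: "convex_on intU (\<lambda>\<eta>. Lam \<eta> + b)"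
proof (rule convex_onI[OF _ convex_intU])
  fix u :: real and x y :: "real^'d" assume *: "0 < u" "u < 1" "x \<in> intU" "y \<in> intU"
  have "Lam ((1 - u) *s x + u *s y) \<le> (1 - u) * Lam x + u * Lam y"
    using * by (intro Lam_convex) (auto simp: intU_def)
  then show "Lam ((1 - u) *\<^sub>R x + u *\<^sub>R y) + b \<le> (1 - u) * (Lam x + b) + u * (Lam y + b)"
    by (simp add: scaleR_eq_vector_smult algebra_simps)
qed

subsection \<open>The limit theorem\<close>

lemma pass_time_antimono: "S \<subseteq> S' \<Longrightarrow> pass_time S' t x n y \<le> pass_time S t x n y"
  unfolding pass_time_def by (intro INF_superset_mono) (auto simp: paths_def)

lemma (in fpp) pass_time_eq_pt:
  assumes "\<And>e. e \<in> nn_edges \<Longrightarrow> t e = \<omega> e \<and> r0 \<le> \<omega> e"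
  shows "pass_time S t x n y = enn2ereal (pt n x y \<omega>) + ereal (c * real n)"
proof (rule pass_time_eq_ptime[OF S_fin])
  fix a s assume s: "s \<in> S"
  have "step_wt t a (a + s) = wt r0 c \<omega> a (a + s) + c"
    using edge_cases[OF s, of a] assms[of "{a, a + s}"] by (auto simp: wt_def step_wt_def)
  then show "0 \<le> wt r0 c \<omega> a (a + s) \<and> step_wt t a (a + s) = wt r0 c \<omega> a (a + s) + c"
    using wt_nonneg[OF s] by simp
qed

lemma even_time_le: "even_time 1 n \<le> n"
  unfolding even_time_def by linarith

text \<open>With the same c in both models, take an almost optimal path with zero steps, delete
  them, and spend the missing time pacing an edge of weight nearly c, reached by an excursion from
  the origin before the path starts.\<close>

lemma Lam_le_Lam_zero_steps:
  assumes A: "fpp D r0 c (steps :: (int^'d) set)" and B: "fpp D r0 c (steps0 :: (int^'d) set)"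
    and good: "fpp.good D r0 c (steps :: (int^'d) set) \<omega>" "fpp.good D r0 c (steps0 :: (int^'d) set) \<omega>"
    and cheap: "\<And>\<delta>. \<delta> > 0 \<Longrightarrow> \<exists>z s. s \<in> steps \<and> wt r0 c \<omega> z (z + s) \<le> \<delta>"
    and \<eta>: "l1norm (\<eta> :: real^'d) < 1"
  shows "fpp.Lam D r0 c (steps :: (int^'d) set) \<eta> \<le> fpp.Lam D r0 c (steps0 :: (int^'d) set) \<eta>"
proof (rule field_le_epsilon)
  interpret A: fpp D r0 c "steps :: (int^'d) set" by (rule A)
  interpret B: fpp D r0 c "steps0 :: (int^'d) set" by (rule B)
  fix e :: real assume "0 < e"
  define \<epsilon> where "\<epsilon> = e / 3"
  have \<epsilon>: "0 < \<epsilon>" using \<open>0 < e\<close> by (simp add: \<epsilon>_def)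
  obtain z s where s: "s \<in> steps" "wt r0 c \<omega> z (z + s) \<le> \<epsilon>" using cheap[OF \<epsilon>] by blast
  obtain h a where h: "a \<ge> 0" "A.pt h 0 z \<omega> \<le> ennreal a" "A.pt h z 0 \<omega> \<le> ennreal a"
    using A.ex_excursion[OF good(1)] .
  define k where "k = even_time 1"
  define y where "y = even_point (1 *s \<eta>)"
  have dB: "B.drifts k y 1 \<eta>" unfolding k_def y_def by (rule B.drifts_even) simp
  \<comment> \<open>The 2h extra steps of the excursion are fixed and do not affect the limit
    velocity.\<close>
  have "(\<lambda>n. 2 * real h / real n + real (k n) / real n) \<longlonglongrightarrow> 0 + 1"
    unfolding k_def by (intro tendsto_add tendsto_even_time) (real_asymp, simp)
  then have dA: "A.drifts (\<lambda>n. 2 * h + k n) y 1 \<eta>"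
    unfolding A.drifts_def using tendsto_even_point[of "1 *s \<eta>"]
    by (auto intro!: always_eventually A.parity_ok_even simp: k_def y_def add_divide_distrib)
  note LA = A.is_rate_Lam[OF \<eta>] and LB = B.is_rate_Lam[OF \<eta>] and B0 = B.Lam_nonneg[OF \<eta>]
  have "A.Lam \<eta> - \<epsilon> \<le> B.Lam \<eta> + \<epsilon> + \<epsilon>"
  proof (rule linear_bounds_le[where b="a + a"])
    show "eventually (\<lambda>n. real n * (A.Lam \<eta> - \<epsilon>) \<le> a + a + real n * (B.Lam \<eta> + \<epsilon> + \<epsilon>)) sequentially"
      using A.is_rateD(1)[OF LA good(1) zero_less_one dA \<epsilon>] B.is_rateD(3)[OF LB good(2) zero_less_one dB \<epsilon>]
    proof eventually_elim
      case (elim n)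
      obtain n' where n': "n' \<le> k n" "A.pt n' 0 (y n) \<omega> \<le> B.pt (k n) 0 (y n) \<omega>"
        using ptime_remove_zero_steps by blast
      have up: "A.pt n' 0 (y n) \<omega> \<le> ennreal (real n * (1 * (B.Lam \<eta> + \<epsilon>)))"
        using n'(2) elim(2) by (rule order_trans)
      then have "A.pt n' 0 (y n) \<omega> \<noteq> \<top>" by (auto simp: top_unique)
      \<comment> \<open>The endpoint and k n are even, so n' is even and the missing time can be
        filled by going to and fro.\<close>
      from ptime_steps_parity[OF this] have "even (int n' + (\<Sum>i\<in>UNIV. y n $ i))" by simp
      moreover have "even (\<Sum>i\<in>UNIV. y n $ i)" by (intro dvd_sum) (simp add: y_def)
      ultimately have "even n'" by simp
      then have "even (k n - n')" by (simp add: k_def)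
      then obtain j where j: "k n - n' = 2 * j" by (elim evenE)
      have "A.pt (h + (2 * j + (h + n'))) 0 (y n) \<omega>
         \<le> ennreal (a + (real (2 * j) * \<epsilon> + (a + real n * (1 * (B.Lam \<eta> + \<epsilon>)))))"
        by (intro A.pt_add_le[OF h(2) A.pt_add_le[OF A.pt_back_forth[OF s] A.pt_add_le[OF h(3) up]]])
          (use h \<epsilon> B0 in auto)
      moreover have "h + (2 * j + (h + n')) = 2 * h + k n" using j n'(1) by simp
      ultimately have "A.pt (2 * h + k n) 0 (y n) \<omega> \<le> ennreal (a + (real (2 * j) * \<epsilon> + (a + real n * (1 * (B.Lam \<eta> + \<epsilon>)))))"
        by (simp only:)
      with elim(1) have "ennreal (real n * (1 * (A.Lam \<eta> - \<epsilon>))) \<le> ennreal (a + (real (2 * j) * \<epsilon> + (a + real n * (1 * (B.Lam \<eta> + \<epsilon>)))))"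
        by (rule order_trans)
      then have "real n * (1 * (A.Lam \<eta> - \<epsilon>)) \<le> a + (real (2 * j) * \<epsilon> + (a + real n * (1 * (B.Lam \<eta> + \<epsilon>))))"
        by (subst (asm) ennreal_le_iff) (use h \<epsilon> B0 in auto)
      moreover have "2 * j \<le> n" using j even_time_le[of n] by (simp add: k_def)
      then have "real (2 * j) * \<epsilon> \<le> real n * \<epsilon>" using \<epsilon> by (intro mult_right_mono) linarith+
      ultimately show ?case by (simp add: distrib_left)
    qed
  qed
  then show "A.Lam \<eta> \<le> B.Lam \<eta> + e" by (simp add: \<epsilon>_def)
qed

lemma ess_inf_dist_props:
  assumes D: "prob_space D" "sets D = sets borel" and fin: "ess_inf_dist D > -\<infinity>"
  defines "r0 \<equiv> real_of_ereal (ess_inf_dist D)"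
  shows "AE y in D. r0 \<le> y" "\<And>\<epsilon>. \<epsilon> > 0 \<Longrightarrow> emeasure D {y. y < r0 + \<epsilon>} > 0"
proof -
  interpret D: prob_space D by fact
  let ?f = "\<lambda>y :: real. ereal (- y)"
  have m: "?f \<in> borel_measurable D" unfolding measurable_cong_sets[OF D(2) refl] by measurable
  have ae: "AE y in D. ?f y \<le> esssup D ?f" by (rule esssup_AE)
  have "esssup D ?f \<noteq> - \<infinity>"
  proof
    assume "esssup D ?f = - \<infinity>"
    then have "AE y in D. False" using ae by simp
    then show False by simp
  qed
  moreover have "esssup D ?f \<noteq> \<infinity>" using fin by (auto simp: ess_inf_dist_def)
  ultimately obtain e where e: "esssup D ?f = ereal e" by (cases "esssup D ?f") auto
  then have r0: "esssup D ?f = ereal (- r0)" by (simp add: r0_def ess_inf_dist_def)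
  show "AE y in D. r0 \<le> y" using ae unfolding r0 by simp
  fix \<epsilon> :: real assume "\<epsilon> > 0"
  then have "ereal (- (r0 + \<epsilon>)) < esssup D ?f" unfolding r0 by simp
  from esssup_pos_measure[OF m this]
  have "emeasure D {y \<in> space D. ereal (- (r0 + \<epsilon>)) < ereal (- y)} > 0" .
  also have "{y \<in> space D. ereal (- (r0 + \<epsilon>)) < ereal (- y)} = {y. y < r0 + \<epsilon>}"
    using sets_eq_imp_space_eq[OF D(2)] by auto
  finally show "emeasure D {y. y < r0 + \<epsilon>} > 0" .
qed

lemma drifts_of_scaled:
  assumes "fpp D r0 c (S :: (int^'d) set)"
    and "(\<lambda>n. real (k n) / real n) \<longlonglongrightarrow> \<alpha>" "(\<lambda>n. scaled (x n) n) \<longlonglongrightarrow> \<xi>" "\<alpha> > 0"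
    and "\<And>n. fpp.parity_ok S (k n) (x n)"
  shows "fpp.drifts S k x \<alpha> ((1 / \<alpha>) *\<^sub>R (\<xi> :: real^'d))"
proof -
  interpret fpp D r0 c S by fact
  have "(\<lambda>n. real_of_int (x n $ i) / real n) \<longlonglongrightarrow> \<xi> $ i" for i
    using tendsto_vec_nth[OF assms(3), of i] by (simp add: scaled_def)
  then show ?thesis unfolding drifts_def using assms(2,4,5) by simp
qed

theorem theorem2p9:
  fixes M :: "'a measure" and t :: "(int^'d) set \<Rightarrow> 'a \<Rightarrow> real" and D :: "real measure"
  assumes "prob_space M"
    and dim: "CARD('d) \<ge> 2"
    and indep: "prob_space.indep_vars M (\<lambda>_. borel) t nn_edges"
    and ident: "\<forall>e\<in>nn_edges. distr M borel (t e) = D"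
    and r0_fin: "ess_inf_dist D > -\<infinity>"
    and moment: "(\<integral>\<^sup>+ z. ennreal ((Min ((\<lambda>i. max (z i) 0) ` {..<2 * CARD('d)})) ^ CARD('d))
                    \<partial>(PiM {..<2 * CARD('d)} (\<lambda>_. D))) < \<infinity>"
  shows "\<exists>(g :: real^'d \<Rightarrow> real) (go :: real^'d \<Rightarrow> real).
    (let r0 = real_of_ereal (ess_inf_dist D) in
      continuous_on intU g \<and> convex_on intU g \<and> (\<forall>\<xi>\<in>intU. r0 \<le> g \<xi>) \<and>
      continuous_on intU go \<and> convex_on intU go \<and> (\<forall>\<xi>\<in>intU. min r0 0 \<le> go \<xi>) \<and>
      (\<exists>\<Omega>0\<in>sets M. measure M \<Omega>0 = 1 \<and>
        (\<forall>\<omega>\<in>\<Omega>0. \<forall>(\<xi>::real^'d) (\<alpha>::real) (k::nat\<Rightarrow>nat) (x::nat\<Rightarrow>int^'d) (y::nat\<Rightarrow>int^'d).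
           \<alpha> > l1norm \<xi> \<longrightarrow> filterlim k at_top sequentially \<longrightarrow>
           (\<forall>n. x n \<in> reach (k n)) \<longrightarrow> (\<forall>n. y n \<in> reach0 (k n)) \<longrightarrow>
           (\<lambda>n. real (k n) / real n) \<longlonglongrightarrow> \<alpha> \<longrightarrow>
           (\<lambda>n. scaled (x n) n) \<longlonglongrightarrow> \<xi> \<longrightarrow>
           (\<lambda>n. scaled (y n) n) \<longlonglongrightarrow> \<xi> \<longrightarrow>
           ((\<lambda>n. G (\<lambda>e. t e \<omega>) 0 (k n) (x n) / ereal (real n))
               \<longlonglongrightarrow> ereal (\<alpha> * g ((1 / \<alpha>) *\<^sub>R \<xi>))) \<and>
           ((\<lambda>n. Go (\<lambda>e. t e \<omega>) 0 (k n) (y n) / ereal (real n))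
               \<longlonglongrightarrow> ereal (\<alpha> * go ((1 / \<alpha>) *\<^sub>R \<xi>))))) \<and>
      g 0 = r0 \<and> go 0 = min r0 0 \<and>
      (\<forall>\<xi>\<in>intU. go \<xi> \<le> g \<xi>) \<and>
      (r0 \<le> 0 \<longrightarrow> (\<forall>\<xi>\<in>intU. g \<xi> = go \<xi>)) \<and>
      (r0 > 0 \<longrightarrow> (\<exists>\<epsilon>>0. \<forall>\<xi>. norm \<xi> < \<epsilon> \<longrightarrow> go \<xi> < g \<xi>)))"
proof -
  interpret M: prob_space M by fact
  let ?P = "PiM (nn_edges :: (int^'d) set set) (\<lambda>_. D)"
  define r0 where "r0 = real_of_ereal (ess_inf_dist D)"
  define c0 where "c0 = min r0 0"
  have tm: "t e \<in> borel_measurable M" if "e \<in> nn_edges" for e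
    using indep that by (auto simp: M.indep_vars_def)
  obtain e0 :: "(int^'d) set" where e0: "e0 \<in> nn_edges" using infinite_nn_edges by (metis ex_in_conv finite.emptyI)
  have D_eq: "D = distr M borel (t e0)" using ident e0 by simp
  have D: "prob_space D" "sets D = sets borel"
    unfolding D_eq using M.prob_space_distr[OF tm[OF e0]] by auto
  note ess = ess_inf_dist_props[OF D r0_fin, folded r0_def]
  interpret A: fpp D r0 r0 "steps :: (int^'d) set"
    by (intro fpp.intro D dim moment) simp_all
  interpret B: fpp D r0 c0 "steps0 :: (int^'d) set"
    by (intro fpp.intro D dim moment) (simp_all add: c0_def)
  \<comment> \<open>The bound r0 \<le> \<omega> e makes the truncation in \<open>wt\<close>
    inactive; edges arbitrarily close to r0 in weight are needed for pacing.\<close>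
  define typical where "typical \<omega> \<longleftrightarrow> A.good \<omega> \<and> B.good \<omega> \<and> (\<forall>e\<in>nn_edges. r0 \<le> \<omega> e) \<and>
     (\<forall>m :: nat. \<exists>e\<in>nn_edges. \<omega> e < r0 + 1 / real (Suc m))" for \<omega>
  have AE_typical: "AE \<omega> in ?P. typical \<omega>"
  proof -
    have "AE \<omega> in ?P. r0 \<le> \<omega> e" if "e \<in> nn_edges" for e
      using AE_PiM_component[OF D(1) that ess(1)] by simp
    then have "AE \<omega> in ?P. \<forall>e\<in>nn_edges. r0 \<le> \<omega> e"
      by (subst AE_ball_countable[OF countable_nn_edges]) blast
    moreover have "AE \<omega> in ?P. \<forall>m :: nat. \<exists>e\<in>nn_edges. \<omega> e < r0 + 1 / real (Suc m)"
      unfolding AE_all_countable by (intro allI A.AE_cheap_edge ess(2)) simp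
    ultimately show ?thesis using A.AE_goodU A.AE_goodL B.AE_goodU B.AE_goodL
      by eventually_elim (auto simp: typical_def A.good_def B.good_def)
  qed
  have cheap: "\<exists>z s. s \<in> steps \<and> wt r0 r0 \<omega> z (z + s) \<le> \<delta>" if ty: "typical \<omega>" and \<delta>: "\<delta> > 0" for \<omega> and \<delta> :: real
  proof -
    obtain m :: nat where m: "1 / real (Suc m) < \<delta>" using nat_approx_posE[OF \<delta>] .
    obtain e where e: "e \<in> nn_edges" "\<omega> e < r0 + 1 / real (Suc m)" "r0 \<le> \<omega> e"
      using ty unfolding typical_def by blast
    obtain z s where zs: "s \<in> steps" "e = {z, z + s}" using nn_edgesE[OF e(1)] .
    have "s \<noteq> 0" using zs(1) by auto
    then have "wt r0 r0 \<omega> z (z + s) \<le> \<delta>" using e m unfolding zs(2) by (simp add: wt_def)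
    then show ?thesis using zs by blast
  qed
  \<comment> \<open>The relations between g and go are deterministic, so they can be read off in one
    environment.\<close>
  obtain \<omega>1 where \<omega>1: "typical \<omega>1"
  proof (rule ccontr)
    assume "\<not> thesis"
    then have "\<not> typical \<omega>" for \<omega> using that by blast
    then have "AE \<omega> in ?P. False" using AE_typical by simp
    then show False by simp
  qed
  have \<omega>1': "A.good \<omega>1" "B.good \<omega>1" using \<omega>1 by (auto simp: typical_def)
  have Gt: "G u 0 n y = enn2ereal (A.pt n 0 y \<omega>) + ereal (r0 * real n)"
    and Got: "Go u 0 n y = enn2ereal (B.pt n 0 y \<omega>) + ereal (c0 * real n)"
    if "typical \<omega>" "\<And>e. e \<in> nn_edges \<Longrightarrow> u e = \<omega> e" for u \<omega> n y
    using A.pass_time_eq_pt[of u \<omega>] B.pass_time_eq_pt[of u \<omega>] that by (auto simp: typical_def)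
  define g where "g \<eta> = A.Lam \<eta> + r0" for \<eta>
  define go where "go \<eta> = B.Lam \<eta> + c0" for \<eta>
  have conv: "convex_on intU g" "convex_on intU go"
    unfolding g_def go_def by (rule A.convex_on_Lam, rule B.convex_on_Lam)
  have cont: "continuous_on intU g" "continuous_on intU go"
    using conv by (auto intro: convex_on_continuous open_intU)
  have lb: "r0 \<le> g \<xi>" "c0 \<le> go \<xi>" if "\<xi> \<in> intU" for \<xi>
    using that A.Lam_nonneg[of \<xi>] B.Lam_nonneg[of \<xi>] by (auto simp: g_def go_def intU_def)
  have go_le_g: "go \<xi> \<le> g \<xi>" if "\<xi> \<in> intU" for \<xi>
  proof -
    have \<xi>: "l1norm \<xi> < 1" using that by (simp add: intU_def)
    let ?k = "even_time 1" and ?x = "even_point (1 *s \<xi>)"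
    have "(\<lambda>n. Go \<omega>1 0 (?k n) (?x n) / ereal (real n)) \<longlonglongrightarrow> ereal (1 * (B.Lam \<xi> + c0))"
      unfolding Got[OF \<omega>1 refl] by (rule B.pt_ratio_tendsto[OF \<omega>1'(2) \<xi> zero_less_one B.drifts_even]) simp
    moreover have "(\<lambda>n. G \<omega>1 0 (?k n) (?x n) / ereal (real n)) \<longlonglongrightarrow> ereal (1 * (A.Lam \<xi> + r0))"
      unfolding Gt[OF \<omega>1 refl] by (rule A.pt_ratio_tendsto[OF \<omega>1'(1) \<xi> zero_less_one A.drifts_even]) simp
    moreover have "eventually (\<lambda>n. Go \<omega>1 0 (?k n) (?x n) / ereal (real n) \<le> G \<omega>1 0 (?k n) (?x n) / ereal (real n)) sequentially"
      using eventually_gt_at_top[of 0]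
    proof eventually_elim
      case (elim n)
      then show ?case
        by (intro ereal_divide_right_mono pass_time_antimono) (auto simp: steps0_def)
    qed
    ultimately have "ereal (1 * (B.Lam \<xi> + c0)) \<le> ereal (1 * (A.Lam \<xi> + r0))"
      by (intro tendsto_le[OF sequentially_bot])
    then show ?thesis by (simp add: g_def go_def)
  qed
  have A0: "A.Lam 0 \<le> 0"
  proof (rule field_le_epsilon)
    fix \<delta> :: real assume \<delta>: "0 < \<delta>"
    obtain z s where "s \<in> steps" "wt r0 r0 \<omega>1 z (z + s) \<le> \<delta>" using cheap[OF \<omega>1 \<delta>] by blast
    then show "A.Lam 0 \<le> 0 + \<delta>" using A.Lam_zero_le[OF \<omega>1'(1)] \<delta> by simp
  qed
  then have g0: "g 0 = r0" using A.Lam_nonneg[of 0] by (simp add: g_def)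
  have eq: "g \<xi> = go \<xi>" if "r0 \<le> 0" "\<xi> \<in> intU" for \<xi>
  proof -
    \<comment> \<open>For r0 \<le> 0 both models subtract the same constant, which is what makes
      their rates comparable.\<close>
    have c: "c0 = r0" using that by (simp add: c0_def)
    have "A.Lam \<xi> \<le> fpp.Lam D r0 r0 steps0 \<xi>"
    proof (rule Lam_le_Lam_zero_steps[of _ _ _ \<omega>1])
      show "fpp D r0 r0 (steps0 :: (int^'d) set)" using B.fpp_axioms unfolding c .
      show "fpp.good D r0 r0 (steps0 :: (int^'d) set) \<omega>1" using \<omega>1'(2) unfolding c .
      show "\<exists>z s. s \<in> steps \<and> wt r0 r0 \<omega>1 z (z + s) \<le> \<delta>" if "\<delta> > 0" for \<delta> using cheap[OF \<omega>1 that] .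
    qed (use \<omega>1' A.fpp_axioms that in \<open>auto simp: intU_def\<close>)
    then have "g \<xi> \<le> go \<xi>" by (simp add: g_def go_def c)
    then show ?thesis using go_le_g[OF that(2)] by simp
  qed
  have zero: "(0 :: real^'d) \<in> intU" by (simp add: intU_def)
  have go0: "go 0 = min r0 0"
  proof (cases "r0 \<le> 0")
    case True
    then show ?thesis using eq[OF True zero] g0 by simp
  next
    case False
    then have "c0 = 0" by (simp add: c0_def)
    \<comment> \<open>For r0 > 0 the cheap step is the zero step, of weight - c0 = 0.\<close>
    moreover have "B.Lam 0 \<le> 0"
      using \<open>c0 = 0\<close> by (intro B.Lam_zero_le[OF \<omega>1'(2), of 0 0]) (auto simp: steps0_def wt_def)
    ultimately show ?thesis using B.Lam_nonneg[of 0] False by (simp add: go_def)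
  qed
  have near: "\<exists>\<epsilon>>0. \<forall>\<xi> :: real^'d. norm \<xi> < \<epsilon> \<longrightarrow> go \<xi> < g \<xi>" if "r0 > 0"
  proof -
    have "continuous_on intU (\<lambda>\<xi>. g \<xi> - go \<xi>)" by (intro continuous_intros cont)
    from open_Collect_positive[OF this] obtain U where U: "open U" "U \<inter> intU = {\<xi> \<in> intU. 0 < g \<xi> - go \<xi>}" by blast
    have "0 \<in> U \<inter> intU" unfolding U(2) using zero g0 go0 that by simp
    moreover have "open (U \<inter> intU)" using U(1) open_intU by (rule open_Int)
    ultimately obtain \<epsilon> where \<epsilon>: "\<epsilon> > 0" "ball 0 \<epsilon> \<subseteq> U \<inter> intU" using openE by blast
    have "go \<xi> < g \<xi>" if "norm \<xi> < \<epsilon>" for \<xi>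
    proof -
      have "\<xi> \<in> ball 0 \<epsilon>" using that by simp
      then have "\<xi> \<in> U \<inter> intU" using \<epsilon>(2) by blast
      then show ?thesis unfolding U(2) by simp
    qed
    then show ?thesis using \<epsilon>(1) by blast
  qed
  \<comment> \<open>The given weights are pushed to the canonical space. Independence and equal laws
    make the image measure the product measure, so almost sure properties pull back to M.\<close>
  define T where "T \<omega> = (\<lambda>e\<in>nn_edges. t e \<omega>)" for \<omega>
  have T: "T \<in> M \<rightarrow>\<^sub>M ?P"
    unfolding T_def by (intro measurable_restrict) (simp add: tm measurable_cong_sets[OF refl D(2)])
  have "distr M (PiM nn_edges (\<lambda>_. borel)) T = (\<Pi>\<^sub>M e\<in>nn_edges. distr M borel (t e))"
    using M.indep_vars_iff_distr_eq_PiM'[where I=nn_edges and X=t and M'="\<lambda>_. borel"] indep tm e0 unfolding T_def by auto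
  also have "\<dots> = ?P" using ident by (intro PiM_cong) auto
  finally have "distr M (PiM nn_edges (\<lambda>_. borel)) T = ?P" .
  moreover have "distr M ?P T = distr M (PiM nn_edges (\<lambda>_. borel)) T"
    by (rule distr_cong[OF refl sets_PiM_cong[OF refl D(2)] refl])
  ultimately have distr_T: "distr M ?P T = ?P" by simp
  have "AE \<omega> in distr M ?P T. typical \<omega>" unfolding distr_T by (rule AE_typical)
  then have "AE \<omega> in M. typical (T \<omega>)" by (rule AE_distrD[OF T])
  \<comment> \<open>The event is the complement of a measurable null set, so measurability of
    \<open>typical\<close> itself is not at issue.\<close>
  then obtain N where N: "{\<omega> \<in> space M. \<not> typical (T \<omega>)} \<subseteq> N" "emeasure M N = 0" "N \<in> sets M" by (rule AE_E)
  define \<Omega> where "\<Omega> = space M - N"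
  have \<Omega>: "\<Omega> \<in> sets M" "measure M \<Omega> = 1" "\<And>\<omega>. \<omega> \<in> \<Omega> \<Longrightarrow> typical (T \<omega>)"
    using N M.prob_compl[OF N(3)] by (auto simp: \<Omega>_def measure_def)
  have main: "((\<lambda>n. G (\<lambda>e. t e \<omega>) 0 (k n) (x n) / ereal (real n)) \<longlonglongrightarrow> ereal (\<alpha> * g ((1 / \<alpha>) *\<^sub>R \<xi>))) \<and>
     ((\<lambda>n. Go (\<lambda>e. t e \<omega>) 0 (k n) (y n) / ereal (real n)) \<longlonglongrightarrow> ereal (\<alpha> * go ((1 / \<alpha>) *\<^sub>R \<xi>)))"
    if \<omega>: "\<omega> \<in> \<Omega>" and \<alpha>: "\<alpha> > l1norm \<xi>" and x: "\<forall>n. x n \<in> reach (k n)"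
      and lim: "(\<lambda>n. real (k n) / real n) \<longlonglongrightarrow> \<alpha>" "(\<lambda>n. scaled (x n) n) \<longlonglongrightarrow> \<xi>" "(\<lambda>n. scaled (y n) n) \<longlonglongrightarrow> \<xi>"
    for \<omega> \<xi> \<alpha> k x y
  proof -
    have \<alpha>0: "\<alpha> > 0" using \<alpha> l1norm_nonneg[of \<xi>] by linarith
    have \<eta>: "l1norm ((1 / \<alpha>) *\<^sub>R \<xi>) < 1" using \<alpha> \<alpha>0 by (simp add: l1norm_scaleR)
    have ty: "typical (T \<omega>)" by (rule \<Omega>(3)[OF \<omega>])
    then have gd: "A.good (T \<omega>)" "B.good (T \<omega>)" by (auto simp: typical_def)
    have tT: "\<And>e. e \<in> nn_edges \<Longrightarrow> t e \<omega> = T \<omega> e" by (simp add: T_def)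
    have Gt_\<omega>: "G (\<lambda>e. t e \<omega>) 0 n z = enn2ereal (A.pt n 0 z (T \<omega>)) + ereal (r0 * real n)"
      and Got_\<omega>: "Go (\<lambda>e. t e \<omega>) 0 n z = enn2ereal (B.pt n 0 z (T \<omega>)) + ereal (c0 * real n)" for n z
      by (rule Gt[OF ty tT], assumption, rule Got[OF ty tT], assumption)
    have "A.drifts k x \<alpha> ((1 / \<alpha>) *\<^sub>R \<xi>)"
      using x reach_parity by (intro drifts_of_scaled[OF A.fpp_axioms lim(1,2) \<alpha>0]) (auto simp: A.parity_ok_def)
    from A.pt_ratio_tendsto[OF gd(1) \<eta> \<alpha>0 this]
    have 1: "(\<lambda>n. G (\<lambda>e. t e \<omega>) 0 (k n) (x n) / ereal (real n)) \<longlonglongrightarrow> ereal (\<alpha> * g ((1 / \<alpha>) *\<^sub>R \<xi>))"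
      unfolding Gt_\<omega> g_def .
    have "B.drifts k y \<alpha> ((1 / \<alpha>) *\<^sub>R \<xi>)"
      by (intro drifts_of_scaled[OF B.fpp_axioms lim(1,3) \<alpha>0]) (auto simp: B.parity_ok_def)
    from B.pt_ratio_tendsto[OF gd(2) \<eta> \<alpha>0 this]
    have 2: "(\<lambda>n. Go (\<lambda>e. t e \<omega>) 0 (k n) (y n) / ereal (real n)) \<longlonglongrightarrow> ereal (\<alpha> * go ((1 / \<alpha>) *\<^sub>R \<xi>))"
      unfolding Got_\<omega> go_def .
    show ?thesis using 1 2 by blast
  qed
  show ?thesis unfolding Let_def r0_def[symmetric]
    apply (rule exI[of _ g], rule exI[of _ go])
    apply (intro conjI cont conv ballI lb)
    subgoal by assumption
    subgoal for \<xi> using lb(2)[of \<xi>] by (simp add: c0_def)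
    subgoal using \<Omega>(1,2) main by (intro bexI[of _ \<Omega>] conjI ballI allI impI) blast+
    subgoal by (rule g0)
    subgoal by (rule go0)
    subgoal by (rule go_le_g)
    subgoal using eq by blast
    subgoal using near by blast
    done
qed

end
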